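(* Fix $K\in\mathbb{Z}$ and let $A\in\mathcal{A}$ be such that $\langle A,\mathrm{AP}_1\rangle=0$ for every $\mathrm{AP}_1$ relator and $\langle A,\mathrm{AP}_2^{(n-2),2}\rangle=0$ for every $\mathrm{AP}_2^{(n-2),2}$ relator (all $n$). Then the following are equivalent: 1. $A$ is an arrow diagram formula for invariants of virtual knots, i.e. the function $\mathtt{G}\mapsto\langle S(A),I(\mathtt{G})\rangle$ on Gauss diagrams with global marking $K$ is invariant under all $\mathrm{R}_1$, $\mathrm{R}_2$ and $\mathrm{R}_3$ moves. 2. $d(A)=0$ in $\mathcal{DA}_{/\nabla}$ (i.e. modulo the triangle relations). 3. $A\in\operatorname{Span}^\perp(A6T)$, i.e. $\langle A,r\rangle=0$ for every $A6T$ relator $r$ (of any degree).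
   Context: **Diagrams.** Fix $K\in\mathbb{Z}$ (global marking). A Gauss diagram of degree $n$ is an oriented circle (drawn counterclockwise) marked with $K$, together with $n$ abstract oriented chords ("arrows", only endpoints matter) having $2n$ distinct endpoints, each arrow equipped with a sign $\pm1$ and an integer marking, up to oriented homeomorphisms of the circle. An arrow diagram is the same without signs. $\mathcal{G}_n,\mathcal{G}_{\le n},\mathcal{G}$ (resp. $\mathcal{A}_n,\mathcal{A}_{\le n},\mathcal{A}$) are the $\mathbb{Q}$-vector spaces freely generated by Gauss (resp. arrow) diagrams of degree $n$, of degree $\le n$, of any degree. **Pairings.** $(\,,)$ is the scalar product making diagrams orthonormal. $\operatorname{Aut}(D)$ is the group of rotations (cyclic permutations of the endpoints) leaving $D$ unchanged. $\langle D,D'\rangle=|\operatorname{Aut}(D)|\,(D,D')$ for diagrams, extended bilinearly (on $\mathcal{G}$ and on $\mathcal{A}$). **Maps.** $I:\mathcal{G}\to\mathcal{G}$ is linear and sends a Gauss diagram to the sum of its subdiagrams (over all subsets of arrows). For an arrow diagram $A$ with arrows numbered $1,\dots,n$, $S(A)=\sum_{\sigma\in\{\pm1\}^n}\big(\prod_i\sigma(i)\big)A^\sigma\in\mathcal{G}_n$, where $A^\sigma$ gives sign $\sigma(i)$ to arrow $i$; extended linearly. **Triangle condition.** For three distinct points (or disjoint small intervals) $1,2,3$ of the circle, arrows $1\to2$, $1\to3$, $2\to3$ (tail at the first, head at the second) with markings $m_{12},m_{13},m_{23}$ satisfy the triangle condition if $m_{13}=m_{12}+m_{23}-K$ when $1,2,3$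 appear in this cyclic order along the orientation, and $m_{13}=m_{12}+m_{23}$ when they appear in the cyclic order $1,3,2$. **R-moves on Gauss diagrams.** $\mathrm{R}_1$: add/delete an arrow of any sign with consecutive endpoints, with marking $0$ if the oriented arc from head to tail contains no other endpoint, or marking $K$ if the oriented arc from tail to head contains no other endpoint. $\mathrm{R}_2$: add/delete two arrows with opposite signs and the same marking, whose tails are consecutive on the circle and whose heads are consecutive on the circle (any orders). $\mathrm{R}_3$: in a diagram containing three disjoint intervals $1,2,3$ (in either cyclic order) and three arrows $1\to2$, $1\to3$, $2\to3$ whose markings satisfy the triangle condition, with signs $(\varepsilon,-\varepsilon,\varepsilon)$ respectively ($\varepsilon=\pm1$), no other endpoint lying on the intervals, exchange the configuration "on 1 the endpoint of $1\to2$ precedes that of $1\to3$; on 2 that of $2\to3$ precedes that of $1\to2$; on 3 that of $1\to3$ precedes that of $2\to3$" with the configuration where the order is reversed on all three intervals. Signs and markings are unchanged. **Homogeneous arrow relators.** $\mathrm{AP}_1$: any arrow diagram containing an arrow whose head-to-tail oriented arc has no other endpoint and whose marking is $0$, or whose tail-to-head oriented arc has no other endpoint and whose marking is $K$. $\mathrm{AP}_2^{(n-2),2}$: any arrow diagram of degree $n$ containing two arrows with the same marking, consecutive tails and consecutive heads. $A6T$ $(=\mathrm{AP}_3^{(n-2),2})$: given disjoint intervals $1,2,3$ in either cyclic order, $n-2$ unseen arrows with endpoints outside them, and integers $m_{12},m_{13},m_{23}$ satisfying the triangle condition, the relator is $(X_1^+-X_1^-)+(X_2^+-X_2^-)+(X_3^+-X_3^-)$.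 Here $X_1^\pm$ has the additional arrows $1\to2,1\to3$, $X_2^\pm$ has $1\to2,2\to3$, $X_3^\pm$ has $1\to3,2\to3$ (arrow $i\to j$ marked $m_{ij}$), and in $X_k^+$ (resp. $X_k^-$) the endpoint on interval $k$ of the first-listed arrow precedes (resp. follows) that of the second. **Based and degenerate diagrams.** A based arrow diagram is an arrow diagram with a distinguished (base) arc between two consecutive endpoints; $\mathcal{A}_\bullet$ is the space they generate. $\bullet(A)\in\mathcal{A}_\bullet$ is the sum of all based diagrams obtained by choosing a base arc of $A$ (one summand per arc), extended linearly. A degenerate arrow diagram is an arrow diagram in which one arc has been shrunk to a point (if the arc joined the two endpoints of the same arrow, one records which endpoint came first); $\mathcal{DA}$ is the space they generate. $\mathcal{DA}_{/\nabla}$ is the quotient of $\mathcal{DA}$ by the triangle relations: for distinct points $P,Q,R$ of the circle, with all other arrows identical in all terms, $[P\to Q,\,P\to R]=[P\to Q,\,Q\to R]+[P\to R,\,R\to Q]$ and $[Q\to P,\,R\to P]=[Q\to R,\,R\to P]+[R\to Q,\,Q\to P]$. The bracket lists the two arrows meeting at the degenerate point. Arrows with the same tail and head have the same marking in all terms, the markings of $Q\to R$ and $R\to Q$ add up to $K$, and the markings of $Q\to R$ and of the other arrows are determined by the triangle condition applied to the triple $P\to Q,Q\to R,P\to R$ (resp. $Q\to R,R\to P,Q\to P$). **The map $d$.** A based diagram $B_\bullet$ is nice if the endpoints of its base arc belong to two different arrows. If not nice, $d(B_\bullet)=0$. If nice, $d(B_\bullet)=\epsilon(B_\bullet)\cdot$(the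 degenerate diagram obtained by shrinking the base arc to a point), with $\epsilon(B_\bullet)=\eta(B_\bullet)(-1)^{\uparrow(B_\bullet)}$, where $\eta=+1$ if the two arrows bounding the base arc cross each other and $-1$ otherwise, and $\uparrow(B_\bullet)$ is the number of arrowheads at the boundary of the base arc. Extend linearly to $\mathcal{A}_\bullet$ and set $d(A)=d(\bullet(A))\in\mathcal{DA}_{/\nabla}$. *)

theory Defs
  imports Complex_Main "HOL-Library.Poly_Mapping" "HOL-Library.FuncSet"
begin

section \<open>Free rational vector spaces\<close>

text \<open>
  The rational vector space freely generated by \<^typ>\<open>'a\<close> is \<open>'a \<Rightarrow>\<^sub>0 rat\<close>.
\<close>

definition gen :: "'a \<Rightarrow> 'a \<Rightarrow>\<^sub>0 rat" where
  "gen x = Poly_Mapping.single x 1"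

definition scl :: "rat \<Rightarrow> ('a \<Rightarrow>\<^sub>0 rat) \<Rightarrow> ('a \<Rightarrow>\<^sub>0 rat)" where
  "scl c x = Poly_Mapping.map ((*) c) x"

lemma lookup_scl [simp]: "Poly_Mapping.lookup (scl c x) k = c * Poly_Mapping.lookup x k"
  unfolding scl_def by (simp add: Poly_Mapping.map.rep_eq when_def)

interpretation free_vs: vector_space "scl :: rat \<Rightarrow> ('a \<Rightarrow>\<^sub>0 rat) \<Rightarrow> ('a \<Rightarrow>\<^sub>0 rat)"
  by unfold_locales
    (auto intro!: poly_mapping_eqI simp: Poly_Mapping.lookup_add algebra_simps)

definition lin_ext :: "('a \<Rightarrow> 'b \<Rightarrow>\<^sub>0 rat) \<Rightarrow> ('a \<Rightarrow>\<^sub>0 rat) \<Rightarrow> ('b \<Rightarrow>\<^sub>0 rat)" where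
  "lin_ext f x = (\<Sum>k\<in>Poly_Mapping.keys x. scl (Poly_Mapping.lookup x k) (f k))"

definition bilin_ext :: "('a \<Rightarrow> 'b \<Rightarrow> rat) \<Rightarrow> ('a \<Rightarrow>\<^sub>0 rat) \<Rightarrow> ('b \<Rightarrow>\<^sub>0 rat) \<Rightarrow> rat" where
  "bilin_ext g x y =
     (\<Sum>k\<in>Poly_Mapping.keys x. \<Sum>l\<in>Poly_Mapping.keys y.
        Poly_Mapping.lookup x k * Poly_Mapping.lookup y l * g k l)"


section \<open>Based diagrams\<close>

text \<open>
  Cutting the circle inside the base arc turns a based diagram into the word of its
  endpoints, read along the orientation of the circle; the base arc joins the last letter
  to the first one. Arrows are labelled by natural numbers, \<open>Tail a\<close> and \<open>Head a\<close> being the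
  endpoints of the arrow \<open>a\<close>, and a second component assigns a decoration to every label.
  Labels are immaterial, hence the quotient by relabelling.
\<close>

datatype 'l endpoint = is_tail: Tail (arrow: 'l) | is_head: Head (arrow: 'l)

type_synonym word = "nat endpoint list"

definition gauss_word :: "word \<Rightarrow> bool" where
  "gauss_word w \<longleftrightarrow> distinct w \<and> (\<forall>a. Tail a \<in> set w \<longleftrightarrow> Head a \<in> set w)"

definition arrows :: "word \<Rightarrow> nat set" where
  "arrows w = arrow ` set w"

definition relabel_eq :: "word \<times> (nat \<Rightarrow> 'd) \<Rightarrow> word \<times> (nat \<Rightarrow> 'd) \<Rightarrow> bool" where
  "relabel_eq = (\<lambda>(w, \<delta>) (w', \<delta>').
     gauss_word w \<and> gauss_word w' \<and>
     (\<exists>f. inj_on f (arrows w) \<and> w' = map (map_endpoint f) w \<and> (\<forall>a\<in>arrows w. \<delta>' (f a) = \<delta> a)))"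

lemma arrow_map_endpoint [simp]: "arrow (map_endpoint f e) = f (arrow e)"
  by (cases e) auto

lemma arrows_map [simp]: "arrows (map (map_endpoint f) w) = f ` arrows w"
  by (auto simp: arrows_def image_image)

lemma finite_arrows [simp]: "finite (arrows w)"
  by (simp add: arrows_def)

lemma arrows_rotate [simp]: "arrows (rotate r w) = arrows w"
  by (simp add: arrows_def)

lemma gauss_word_rotate [simp]: "gauss_word (rotate r w) = gauss_word w"
  by (simp add: gauss_word_def)

lemma gauss_word_Nil [simp]: "gauss_word []"
  by (simp add: gauss_word_def)

lemma gauss_word_filter:
  "gauss_word w \<Longrightarrow> gauss_word (filter (\<lambda>e. arrow e \<in> T) w)"
  by (auto simp: gauss_word_def)

lemma relabel_eq_refl: "gauss_word w \<Longrightarrow> relabel_eq (w, \<delta>) (w, \<delta>)"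
  unfolding relabel_eq_def
  by (auto intro!: exI[of _ id] simp: endpoint.map_id0)

lemma relabel_eq_sym:
  assumes "relabel_eq x y" shows "relabel_eq y x"
proof -
  obtain w \<delta> w' \<delta>' where x: "x = (w, \<delta>)" "y = (w', \<delta>')" by (cases x, cases y)
  from assms x obtain f where f: "gauss_word w" "gauss_word w'" "inj_on f (arrows w)"
    "w' = map (map_endpoint f) w" "\<forall>a\<in>arrows w. \<delta>' (f a) = \<delta> a"
    by (auto simp: relabel_eq_def)
  let ?g = "the_inv_into (arrows w) f"
  have g: "?g (f a) = a" if "a \<in> arrows w" for a
    using f(3) that by (simp add: the_inv_into_f_f)
  have "map (map_endpoint ?g) w' = map (\<lambda>e. e) w"
    unfolding f(4) map_map o_def endpoint.map_comp
  proof (rule map_cong)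
    fix e assume "e \<in> set w"
    hence "arrow e \<in> arrows w" by (simp add: arrows_def)
    thus "map_endpoint (\<lambda>x. ?g (f x)) e = e" using g by (cases e) auto
  qed simp
  moreover have "inj_on ?g (arrows w')"
    using f(3,4) by (simp add: inj_on_the_inv_into)
  moreover have "\<forall>a\<in>arrows w'. \<delta> (?g a) = \<delta>' a"
    using f(4,5) g by auto
  ultimately show ?thesis
    using f(1,2) x by (auto simp: relabel_eq_def intro!: exI[of _ ?g])
qed

lemma relabel_eq_trans:
  assumes "relabel_eq x y" "relabel_eq y z" shows "relabel_eq x z"
proof -
  obtain w \<delta> w' \<delta>' w'' \<delta>'' where x: "x = (w, \<delta>)" "y = (w', \<delta>')" "z = (w'', \<delta>'')"
    by (cases x, cases y, cases z)
  from assms(1) x obtain f where f: "gauss_word w" "gauss_word w'" "inj_on f (arrows w)"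
    "w' = map (map_endpoint f) w" "\<forall>a\<in>arrows w. \<delta>' (f a) = \<delta> a"
    by (auto simp: relabel_eq_def)
  from assms(2) x obtain g where g: "gauss_word w''" "inj_on g (arrows w')"
    "w'' = map (map_endpoint g) w'" "\<forall>a\<in>arrows w'. \<delta>'' (g a) = \<delta>' a"
    by (auto simp: relabel_eq_def)
  have "inj_on (g \<circ> f) (arrows w)"
    using f(3,4) g(2) by (auto intro: comp_inj_on)
  moreover have "w'' = map (map_endpoint (g \<circ> f)) w"
    using f(4) g(3) by (simp add: endpoint.map_comp)
  moreover have "\<forall>a\<in>arrows w. \<delta>'' ((g \<circ> f) a) = \<delta> a"
    using f(4,5) g(4) by auto
  ultimately show ?thesis
    using f(1) g(1) x by (auto simp: relabel_eq_def intro!: exI[of _ "g \<circ> f"])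
qed

quotient_type 'd based_diagram = "word \<times> (nat \<Rightarrow> 'd)" / partial: relabel_eq
proof (rule part_equivpI)
  show "\<exists>x :: word \<times> (nat \<Rightarrow> 'd). relabel_eq x x"
    using relabel_eq_refl[of "[]"] by auto
  show "symp (relabel_eq :: word \<times> (nat \<Rightarrow> 'd) \<Rightarrow> _)"
    by (rule sympI) (rule relabel_eq_sym)
  show "transp (relabel_eq :: word \<times> (nat \<Rightarrow> 'd) \<Rightarrow> _)"
    by (rule transpI) (rule relabel_eq_trans)
qed

definition based :: "word \<Rightarrow> (nat \<Rightarrow> 'd) \<Rightarrow> 'd based_diagram" where
  "based w \<delta> = abs_based_diagram (w, \<delta>)"

lemma based_eqI: "relabel_eq (w, \<delta>) (w', \<delta>') \<Longrightarrow> based w \<delta> = based w' \<delta>'"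
  unfolding based_def using Quotient_rel_abs[OF Quotient_based_diagram] by blast

lemma based_cases:
  obtains w \<delta> where "B = based w \<delta>" "gauss_word w"
proof -
  have "\<exists>w \<delta>. B = based w \<delta> \<and> gauss_word w"
    by (induct B rule: based_diagram.abs_induct) (auto simp: based_def relabel_eq_def)
  thus ?thesis using that by blast
qed

lift_definition num_endpoints :: "'d based_diagram \<Rightarrow> nat" is "\<lambda>(w, \<delta>). length w"
  by (auto simp: relabel_eq_def)

lift_definition rotate_based :: "nat \<Rightarrow> 'd based_diagram \<Rightarrow> 'd based_diagram"
  is "\<lambda>r (w, \<delta>). (rotate r w, \<delta>)"
  by (fastforce simp: relabel_eq_def rotate_map simp flip: rotate_map)

lemma num_endpoints_based: "gauss_word w \<Longrightarrow> num_endpoints (based w \<delta>) = length w"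
  unfolding based_def by (simp add: num_endpoints.abs_eq relabel_eq_refl)

lemma rotate_based_based:
  "gauss_word w \<Longrightarrow> rotate_based r (based w \<delta>) = based (rotate r w) \<delta>"
  unfolding based_def by (simp add: rotate_based.abs_eq relabel_eq_refl)

lemma rotate_based_0 [simp]: "rotate_based 0 B = B"
  by (cases B rule: based_cases) (simp add: rotate_based_based)

lemma rotate_based_add: "rotate_based r (rotate_based s B) = rotate_based (r + s) B"
  by (cases B rule: based_cases) (simp add: rotate_based_based rotate_rotate)

lemma num_endpoints_rotate [simp]: "num_endpoints (rotate_based r B) = num_endpoints B"
  by (cases B rule: based_cases) (simp add: rotate_based_based num_endpoints_based)

lemma rotate_based_mod: "rotate_based (r mod num_endpoints B) B = rotate_based r B"
  by (cases B rule: based_cases)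
    (simp add: rotate_based_based num_endpoints_based rotate_conv_mod[symmetric])

lemma rotate_based_inverse: "\<exists>s. rotate_based s (rotate_based r B) = B"
proof (cases "num_endpoints B = 0")
  case True
  hence "rotate_based r B = B"
    by (cases B rule: based_cases) (simp add: rotate_based_based num_endpoints_based)
  thus ?thesis by (intro exI[of _ 0]) simp
next
  case False
  have "rotate_based (r * (num_endpoints B - 1)) (rotate_based r B)
      = rotate_based (r * num_endpoints B) B"
    using False by (simp add: rotate_based_add algebra_simps diff_mult_distrib2)
  also have "\<dots> = rotate_based 0 B"
    using rotate_based_mod[of "r * num_endpoints B" B] by simp
  finally show ?thesis by auto
qed


section \<open>Diagrams\<close>

text \<open>
  A diagram is a based diagram up to the choice of the base arc. The decoration of an arrow
  is its marking in an arrow diagram, its sign and its marking in a Gauss diagram. The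
  global marking \<open>K\<close> is fixed once and for all and is not stored in the diagrams.
\<close>

definition rotation_eq :: "'d based_diagram \<Rightarrow> 'd based_diagram \<Rightarrow> bool" where
  "rotation_eq B B' \<longleftrightarrow> (\<exists>r. B' = rotate_based r B)"

quotient_type 'd diagram = "'d based_diagram" / rotation_eq
proof (rule equivpI)
  show "reflp (rotation_eq :: 'd based_diagram \<Rightarrow> _)"
    by (rule reflpI) (metis rotation_eq_def rotate_based_0)
  show "symp (rotation_eq :: 'd based_diagram \<Rightarrow> _)"
    by (rule sympI) (metis rotation_eq_def rotate_based_inverse)
  show "transp (rotation_eq :: 'd based_diagram \<Rightarrow> _)"
    by (rule transpI) (metis rotation_eq_def rotate_based_add)
qed

datatype sign = Plus | Minus

fun sign_value :: "sign \<Rightarrow> rat" where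
  "sign_value Plus = 1"
| "sign_value Minus = - 1"

fun opposite :: "sign \<Rightarrow> sign" where
  "opposite Plus = Minus"
| "opposite Minus = Plus"

type_synonym gauss_diagram = "(sign \<times> int) diagram"
type_synonym arrow_diagram = "int diagram"

definition dgm :: "word \<Rightarrow> (nat \<Rightarrow> 'd) \<Rightarrow> 'd diagram" where
  "dgm w \<delta> = abs_diagram (based w \<delta>)"

lemma dgm_relabel: "relabel_eq (w, \<delta>) (w', \<delta>') \<Longrightarrow> dgm w \<delta> = dgm w' \<delta>'"
  unfolding dgm_def using based_eqI by metis

lemma dgm_rotate: "gauss_word w \<Longrightarrow> dgm (rotate r w) \<delta> = dgm w \<delta>"
  unfolding dgm_def
  by (subst eq_commute) (auto simp: diagram.abs_eq_iff rotation_eq_def rotate_based_based)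

lemma dgm_append_commute:
  assumes "gauss_word (u @ v)" shows "dgm (v @ u) \<delta> = dgm (u @ v) \<delta>"
  using dgm_rotate[OF assms, of "length u" \<delta>] by (simp add: rotate_append)


section \<open>Pairings\<close>

text \<open>
  \<open>aut_order D\<close> is the order of the group of rotations preserving \<open>D\<close>. The group of all
  rotations is cyclic of order \<open>2n\<close> when \<open>D\<close> has degree \<open>n > 0\<close>, and trivial when \<open>n = 0\<close>.
\<close>

lift_definition aut_order :: "'d diagram \<Rightarrow> nat"
  is "\<lambda>B. card {r. r < max 1 (num_endpoints B) \<and> rotate_based r B = B}"
proof -
  fix B B' :: "'d based_diagram"
  assume "rotation_eq B B'"
  then obtain s where s: "B' = rotate_based s B" by (auto simp: rotation_eq_def)
  obtain t where t: "rotate_based t B' = B" using rotate_based_inverse[of s B] s by auto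
  have comm: "rotate_based r (rotate_based q C) = rotate_based q (rotate_based r C)"
    for r q and C :: "'d based_diagram"
    by (simp add: rotate_based_add add.commute)
  have "rotate_based r B' = B' \<longleftrightarrow> rotate_based r B = B" for r
    using comm[of r s B] comm[of r t B'] s t by auto
  thus "card {r. r < max 1 (num_endpoints B) \<and> rotate_based r B = B}
      = card {r. r < max 1 (num_endpoints B') \<and> rotate_based r B' = B'}"
    by (simp add: s)
qed

definition scalar_product :: "('d diagram \<Rightarrow>\<^sub>0 rat) \<Rightarrow> ('d diagram \<Rightarrow>\<^sub>0 rat) \<Rightarrow> rat" where
  "scalar_product = bilin_ext (\<lambda>D D'. if D = D' then 1 else 0)"

definition pairing :: "('d diagram \<Rightarrow>\<^sub>0 rat) \<Rightarrow> ('d diagram \<Rightarrow>\<^sub>0 rat) \<Rightarrow> rat" where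
  "pairing = bilin_ext (\<lambda>D D'. of_nat (aut_order D) * scalar_product (gen D) (gen D'))"


section \<open>The maps \<open>I\<close> and \<open>S\<close>\<close>

lift_definition subdiagrams_based :: "'d based_diagram \<Rightarrow> ('d diagram \<Rightarrow>\<^sub>0 rat)"
  is "\<lambda>(w, \<delta>). \<Sum>T\<in>Pow (arrows w). gen (dgm (filter (\<lambda>e. arrow e \<in> T) w) \<delta>)"
proof -
  fix x y :: "word \<times> (nat \<Rightarrow> 'd)"
  assume xy: "relabel_eq x y"
  obtain w \<delta> w' \<delta>' where x: "x = (w, \<delta>)" "y = (w', \<delta>')" by (cases x, cases y)
  from xy x obtain f where f: "gauss_word w" "gauss_word w'" "inj_on f (arrows w)"
    "w' = map (map_endpoint f) w" "\<forall>a\<in>arrows w. \<delta>' (f a) = \<delta> a"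
    by (auto simp: relabel_eq_def)
  have eq: "dgm (filter (\<lambda>e. arrow e \<in> f ` T) w') \<delta>' = dgm (filter (\<lambda>e. arrow e \<in> T) w) \<delta>"
    if T: "T \<subseteq> arrows w" for T
  proof (rule sym, rule dgm_relabel)
    have "f (arrow e) \<in> f ` T \<longleftrightarrow> arrow e \<in> T" if "e \<in> set w" for e
      using f(3) T that by (auto simp: arrows_def dest: inj_onD)
    hence 1: "filter (\<lambda>e. arrow e \<in> f ` T) w' = map (map_endpoint f) (filter (\<lambda>e. arrow e \<in> T) w)"
      unfolding f(4) filter_map o_def arrow_map_endpoint by (intro arg_cong[of _ _ "map _"] filter_cong) auto
    have 2: "arrows (filter (\<lambda>e. arrow e \<in> T) w) \<subseteq> arrows w"
      by (auto simp: arrows_def)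
    show "relabel_eq (filter (\<lambda>e. arrow e \<in> T) w, \<delta>) (filter (\<lambda>e. arrow e \<in> f ` T) w', \<delta>')"
      unfolding relabel_eq_def prod.case
      using f 1 2 gauss_word_filter[OF f(1), of T] gauss_word_filter[OF f(2), of "f ` T"]
      by (auto intro!: exI[of _ f] intro: inj_on_subset)
  qed
  have "(\<Sum>T\<in>Pow (arrows w'). gen (dgm (filter (\<lambda>e. arrow e \<in> T) w') \<delta>'))
      = (\<Sum>T\<in>(`) f ` Pow (arrows w). gen (dgm (filter (\<lambda>e. arrow e \<in> T) w') \<delta>'))"
    using f(4) by (simp add: image_Pow_surj)
  also have "\<dots> = (\<Sum>T\<in>Pow (arrows w). gen (dgm (filter (\<lambda>e. arrow e \<in> f ` T) w') \<delta>'))"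
    by (rule sum.reindex_cong[OF inj_on_image_Pow[OF f(3)]]) auto
  also have "\<dots> = (\<Sum>T\<in>Pow (arrows w). gen (dgm (filter (\<lambda>e. arrow e \<in> T) w) \<delta>))"
    using eq by (intro sum.cong) auto
  finally show "(case x of (w, \<delta>) \<Rightarrow> \<Sum>T\<in>Pow (arrows w). gen (dgm (filter (\<lambda>e. arrow e \<in> T) w) \<delta>))
     = (case y of (w, \<delta>) \<Rightarrow> \<Sum>T\<in>Pow (arrows w). gen (dgm (filter (\<lambda>e. arrow e \<in> T) w) \<delta>))"
    by (simp add: x)
qed

lemma subdiagrams_based_based:
  "gauss_word w \<Longrightarrow> subdiagrams_based (based w \<delta>)
     = (\<Sum>T\<in>Pow (arrows w). gen (dgm (filter (\<lambda>e. arrow e \<in> T) w) \<delta>))"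
  unfolding based_def by (simp add: subdiagrams_based.abs_eq relabel_eq_refl)

lift_definition subdiagrams :: "'d diagram \<Rightarrow> ('d diagram \<Rightarrow>\<^sub>0 rat)" is subdiagrams_based
proof -
  fix B B' :: "'d based_diagram"
  assume "rotation_eq B B'"
  then obtain r where r: "B' = rotate_based r B" by (auto simp: rotation_eq_def)
  obtain w \<delta> where B: "B = based w \<delta>" "gauss_word w" by (rule based_cases)
  have "dgm (filter P (rotate r w)) \<delta> = dgm (filter P w) \<delta>" if P: "P = (\<lambda>e. arrow e \<in> T)" for P T
  proof -
    let ?u = "take (r mod length w) w" and ?v = "drop (r mod length w) w"
    have "gauss_word (filter P (?u @ ?v))"
      unfolding P using B(2) by (simp only: append_take_drop_id gauss_word_filter)
    from dgm_append_commute[of "filter P ?u" "filter P ?v" \<delta>] this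
    have "dgm (filter P (?v @ ?u)) \<delta> = dgm (filter P (?u @ ?v)) \<delta>"
      by (simp only: filter_append)
    thus ?thesis by (simp only: rotate_drop_take append_take_drop_id)
  qed
  thus "subdiagrams_based B = subdiagrams_based B'"
    unfolding r B(1) rotate_based_based[OF B(2)] using B(2)
    by (simp add: subdiagrams_based_based)
qed

definition I_map :: "(gauss_diagram \<Rightarrow>\<^sub>0 rat) \<Rightarrow> (gauss_diagram \<Rightarrow>\<^sub>0 rat)" where
  "I_map = lin_ext subdiagrams"

lift_definition signed_sum_based :: "int based_diagram \<Rightarrow> (gauss_diagram \<Rightarrow>\<^sub>0 rat)"
  is "\<lambda>(w, \<mu>). \<Sum>\<sigma>\<in>arrows w \<rightarrow>\<^sub>E UNIV.
        scl (\<Prod>a\<in>arrows w. sign_value (\<sigma> a)) (gen (dgm w (\<lambda>a. (\<sigma> a, \<mu> a))))"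
proof -
  fix x y :: "word \<times> (nat \<Rightarrow> int)"
  assume xy: "relabel_eq x y"
  obtain w \<delta> w' \<delta>' where x: "x = (w, \<delta>)" "y = (w', \<delta>')" by (cases x, cases y)
  from xy x obtain f where f: "gauss_word w" "gauss_word w'" "inj_on f (arrows w)"
    "w' = map (map_endpoint f) w" "\<forall>a\<in>arrows w. \<delta>' (f a) = \<delta> a"
    by (auto simp: relabel_eq_def)
  let ?g = "the_inv_into (arrows w) f"
  have g: "?g (f a) = a" if "a \<in> arrows w" for a
    using f(3) that by (simp add: the_inv_into_f_f)
  have aw: "arrows w' = f ` arrows w" by (simp add: f(4))
  let ?F = "\<lambda>w \<delta> \<sigma>. scl (\<Prod>a\<in>arrows w. sign_value (\<sigma> a)) (gen (dgm w (\<lambda>a. (\<sigma> a, \<delta> a :: int))))"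
  have "(\<Sum>\<sigma>\<in>arrows w \<rightarrow>\<^sub>E UNIV. ?F w \<delta> \<sigma>) = (\<Sum>\<sigma>\<in>arrows w' \<rightarrow>\<^sub>E UNIV. ?F w' \<delta>' \<sigma>)"
  proof (rule sum.reindex_bij_witness[where
        i = "\<lambda>\<sigma>. restrict (\<sigma> \<circ> f) (arrows w)" and j = "\<lambda>\<sigma>. restrict (\<sigma> \<circ> ?g) (arrows w')"])
    fix \<sigma> :: "nat \<Rightarrow> sign" assume \<sigma>: "\<sigma> \<in> arrows w \<rightarrow>\<^sub>E UNIV"
    let ?\<sigma>' = "restrict (\<sigma> \<circ> ?g) (arrows w')"
    show "restrict (?\<sigma>' \<circ> f) (arrows w) = \<sigma>"
      using \<sigma> g aw by (auto simp: fun_eq_iff PiE_def extensional_def restrict_def)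
    show "?\<sigma>' \<in> arrows w' \<rightarrow>\<^sub>E UNIV" by auto
    have val: "?\<sigma>' (f a) = \<sigma> a" if "a \<in> arrows w" for a
      using that g aw by simp
    have "(\<Prod>a\<in>arrows w'. sign_value (?\<sigma>' a)) = (\<Prod>a\<in>arrows w. sign_value (\<sigma> a))"
      using f(3) aw val by (simp add: prod.reindex cong: prod.cong)
    moreover have "dgm w (\<lambda>a. (\<sigma> a, \<delta> a)) = dgm w' (\<lambda>a. (?\<sigma>' a, \<delta>' a))"
      by (rule dgm_relabel) (use f val in \<open>auto simp: relabel_eq_def intro!: exI[of _ f]\<close>)
    ultimately show "?F w' \<delta>' ?\<sigma>' = ?F w \<delta> \<sigma>" by simp
  next
    fix \<sigma> :: "nat \<Rightarrow> sign" assume \<sigma>: "\<sigma> \<in> arrows w' \<rightarrow>\<^sub>E UNIV"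
    show "restrict (restrict (\<sigma> \<circ> f) (arrows w) \<circ> ?g) (arrows w') = \<sigma>"
      using \<sigma> g aw by (auto simp: fun_eq_iff PiE_def extensional_def restrict_def)
    show "restrict (\<sigma> \<circ> f) (arrows w) \<in> arrows w \<rightarrow>\<^sub>E UNIV" by auto
  qed
  thus "(case x of (w, \<delta>) \<Rightarrow> \<Sum>\<sigma>\<in>arrows w \<rightarrow>\<^sub>E UNIV. ?F w \<delta> \<sigma>)
     = (case y of (w, \<delta>) \<Rightarrow> \<Sum>\<sigma>\<in>arrows w \<rightarrow>\<^sub>E UNIV. ?F w \<delta> \<sigma>)"
    by (simp add: x)
qed

lemma signed_sum_based_based:
  "gauss_word w \<Longrightarrow> signed_sum_based (based w \<mu>) = (\<Sum>\<sigma>\<in>arrows w \<rightarrow>\<^sub>E UNIV.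
        scl (\<Prod>a\<in>arrows w. sign_value (\<sigma> a)) (gen (dgm w (\<lambda>a. (\<sigma> a, \<mu> a)))))"
  unfolding based_def by (simp add: signed_sum_based.abs_eq relabel_eq_refl)

lift_definition signed_sum :: "arrow_diagram \<Rightarrow> (gauss_diagram \<Rightarrow>\<^sub>0 rat)" is signed_sum_based
proof -
  fix B B' :: "int based_diagram"
  assume "rotation_eq B B'"
  then obtain r where r: "B' = rotate_based r B" by (auto simp: rotation_eq_def)
  obtain w \<delta> where B: "B = based w \<delta>" "gauss_word w" by (rule based_cases)
  show "signed_sum_based B = signed_sum_based B'"
    unfolding r B(1) rotate_based_based[OF B(2)] using B(2)
    by (simp add: signed_sum_based_based dgm_rotate)
qed

definition S_map :: "(arrow_diagram \<Rightarrow>\<^sub>0 rat) \<Rightarrow> (gauss_diagram \<Rightarrow>\<^sub>0 rat)" where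
  "S_map = lin_ext signed_sum"


section \<open>The triangle condition\<close>

text \<open>
  \<open>Order123\<close> and \<open>Order132\<close> are the two cyclic orders in which three points or intervals
  \<open>1, 2, 3\<close> can be met along the oriented circle. \<open>place c u v w I1 I2 I3\<close> puts the words
  \<open>I1\<close>, \<open>I2\<close>, \<open>I3\<close> on these intervals, and \<open>u\<close>, \<open>v\<close>, \<open>w\<close> on the three complementary arcs.
\<close>

datatype cyclic_order = Order123 | Order132

fun place :: "cyclic_order \<Rightarrow> word \<Rightarrow> word \<Rightarrow> word \<Rightarrow> word \<Rightarrow> word \<Rightarrow> word \<Rightarrow> word" where
  "place Order123 u v w I1 I2 I3 = I1 @ u @ I2 @ v @ I3 @ w"
| "place Order132 u v w I1 I2 I3 = I1 @ u @ I3 @ v @ I2 @ w"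

fun triangle :: "int \<Rightarrow> cyclic_order \<Rightarrow> int \<Rightarrow> int \<Rightarrow> int \<Rightarrow> bool" where
  "triangle K Order123 m12 m13 m23 \<longleftrightarrow> m13 = m12 + m23 - K"
| "triangle K Order132 m12 m13 m23 \<longleftrightarrow> m13 = m12 + m23"

text \<open>
  \<open>unseen u v w ls\<close>: the complementary words carry complete arrows only, and \<open>ls\<close> are
  distinct labels available for additional arrows.
\<close>

definition unseen :: "word \<Rightarrow> word \<Rightarrow> word \<Rightarrow> nat list \<Rightarrow> bool" where
  "unseen u v w ls \<longleftrightarrow>
     gauss_word (u @ v @ w) \<and> distinct ls \<and> set ls \<inter> arrows (u @ v @ w) = {}"


section \<open>R-moves on Gauss diagrams\<close>

text \<open>
  Each move is given in one direction. Since words are read up to rotation, the local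
  configuration may be put at the beginning of the word.
\<close>

inductive R1_move :: "int \<Rightarrow> gauss_diagram \<Rightarrow> gauss_diagram \<Rightarrow> bool" for K where
  "gauss_word (Head a # Tail a # w) \<Longrightarrow> snd (\<delta> a) = 0 \<Longrightarrow>
     R1_move K (dgm w \<delta>) (dgm (Head a # Tail a # w) \<delta>)"
| "gauss_word (Tail a # Head a # w) \<Longrightarrow> snd (\<delta> a) = K \<Longrightarrow>
     R1_move K (dgm w \<delta>) (dgm (Tail a # Head a # w) \<delta>)"

inductive R2_move :: "gauss_diagram \<Rightarrow> gauss_diagram \<Rightarrow> bool" where
  "gauss_word ([Tail a, Tail b] @ u @ H @ v) \<Longrightarrow> a \<noteq> b \<Longrightarrow>
     H = [Head a, Head b] \<or> H = [Head b, Head a] \<Longrightarrow>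
     fst (\<delta> b) = opposite (fst (\<delta> a)) \<Longrightarrow> snd (\<delta> a) = snd (\<delta> b) \<Longrightarrow>
     R2_move (dgm (u @ v) \<delta>) (dgm ([Tail a, Tail b] @ u @ H @ v) \<delta>)"

text \<open>Here \<open>a\<close>, \<open>b\<close>, \<open>c\<close> are the arrows \<open>1 \<rightarrow> 2\<close>, \<open>1 \<rightarrow> 3\<close>, \<open>2 \<rightarrow> 3\<close>.\<close>

inductive R3_move :: "int \<Rightarrow> gauss_diagram \<Rightarrow> gauss_diagram \<Rightarrow> bool" for K where
  "unseen u v w [a, b, c] \<Longrightarrow>
     triangle K cyc (snd (\<delta> a)) (snd (\<delta> b)) (snd (\<delta> c)) \<Longrightarrow>
     fst (\<delta> a) = \<epsilon> \<Longrightarrow> fst (\<delta> b) = opposite \<epsilon> \<Longrightarrow> fst (\<delta> c) = \<epsilon> \<Longrightarrow>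
     R3_move K
       (dgm (place cyc u v w [Tail a, Tail b] [Tail c, Head a] [Head b, Head c]) \<delta>)
       (dgm (place cyc u v w [Tail b, Tail a] [Head a, Tail c] [Head c, Head b]) \<delta>)"

definition arrow_diagram_formula :: "int \<Rightarrow> (arrow_diagram \<Rightarrow>\<^sub>0 rat) \<Rightarrow> bool" where
  "arrow_diagram_formula K A \<longleftrightarrow>
     (\<forall>G G'. R1_move K G G' \<or> R2_move G G' \<or> R3_move K G G' \<longrightarrow>
        pairing (S_map A) (I_map (gen G)) = pairing (S_map A) (I_map (gen G')))"


section \<open>Homogeneous arrow relators\<close>

definition AP1 :: "int \<Rightarrow> (arrow_diagram \<Rightarrow>\<^sub>0 rat) set" where
  "AP1 K =
     {gen (dgm (Head a # Tail a # w) \<mu>) | a w \<mu>. gauss_word (Head a # Tail a # w) \<and> \<mu> a = 0} \<union>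
     {gen (dgm (Tail a # Head a # w) \<mu>) | a w \<mu>. gauss_word (Tail a # Head a # w) \<and> \<mu> a = K}"

definition AP2 :: "(arrow_diagram \<Rightarrow>\<^sub>0 rat) set" where
  "AP2 =
     {gen (dgm ([Tail a, Tail b] @ u @ H @ v) \<mu>) | a b u H v \<mu>.
        gauss_word ([Tail a, Tail b] @ u @ H @ v) \<and> a \<noteq> b \<and>
        (H = [Head a, Head b] \<or> H = [Head b, Head a]) \<and> \<mu> a = \<mu> b}"

text \<open>Again \<open>a\<close>, \<open>b\<close>, \<open>c\<close> are the arrows \<open>1 \<rightarrow> 2\<close>, \<open>1 \<rightarrow> 3\<close>, \<open>2 \<rightarrow> 3\<close>.\<close>

definition relator_6T ::
  "cyclic_order \<Rightarrow> word \<Rightarrow> word \<Rightarrow> word \<Rightarrow> nat \<Rightarrow> nat \<Rightarrow> nat \<Rightarrow> (nat \<Rightarrow> int) \<Rightarrow>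
   (arrow_diagram \<Rightarrow>\<^sub>0 rat)" where
  "relator_6T cyc u v w a b c \<mu> =
     (let X = (\<lambda>I1 I2 I3. gen (dgm (place cyc u v w I1 I2 I3) \<mu>)) in
       (X [Tail a, Tail b] [Head a] [Head b] - X [Tail b, Tail a] [Head a] [Head b])
     + (X [Tail a] [Head a, Tail c] [Head c] - X [Tail a] [Tail c, Head a] [Head c])
     + (X [Tail b] [Tail c] [Head b, Head c] - X [Tail b] [Tail c] [Head c, Head b]))"

definition A6T :: "int \<Rightarrow> (arrow_diagram \<Rightarrow>\<^sub>0 rat) set" where
  "A6T K = {relator_6T cyc u v w a b c \<mu> | cyc u v w a b c \<mu>.
     unseen u v w [a, b, c] \<and> triangle K cyc (\<mu> a) (\<mu> b) (\<mu> c)}"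


section \<open>Degenerate diagrams and triangle relations\<close>

text \<open>
  Shrinking the base arc of a based diagram forgets the order of the two endpoints of that
  arc, except when they belong to the same arrow. Two based diagrams therefore shrink to
  the same degenerate diagram iff they are equal or are exchanged by transposing the first
  and the last letter, these belonging to different arrows. (The empty based diagram has no
  arc to shrink; it yields one additional generator, on which nothing below depends.)
\<close>

definition swap_ends :: "'a list \<Rightarrow> 'a list" where
  "swap_ends w = (if length w < 2 then w else last w # butlast (tl w) @ [hd w])"

definition nice_word :: "word \<Rightarrow> bool" where
  "nice_word w \<longleftrightarrow> w \<noteq> [] \<and> arrow (hd w) \<noteq> arrow (last w)"

lift_definition nice :: "'d based_diagram \<Rightarrow> bool" is "\<lambda>(w, \<delta>). nice_word w"
  by (auto simp: relabel_eq_def nice_word_def hd_map last_map arrows_def inj_on_eq_iff)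

lemma swap_ends_Cons_snoc [simp]: "swap_ends (x # p @ [y]) = y # p @ [x]"
  by (simp add: swap_ends_def)

lemma swap_ends_cases:
  obtains "length w < 2" "swap_ends w = w" | x p y where "w = x # p @ [y]"
proof (cases "length w < 2")
  case False
  then obtain x w' where "w = x # w'" "w' \<noteq> []" by (cases w) auto
  thus ?thesis using that(2)[of x "butlast w'" "last w'"] by simp
qed (use that in \<open>simp add: swap_ends_def\<close>)

lemma set_swap_ends [simp]: "set (swap_ends w) = set w"
  by (cases w rule: swap_ends_cases) auto

lemma distinct_swap_ends [simp]: "distinct (swap_ends w) = distinct w"
  by (cases w rule: swap_ends_cases) auto

lemma gauss_word_swap_ends [simp]: "gauss_word (swap_ends w) = gauss_word w"
  by (simp add: gauss_word_def)

lemma swap_ends_swap_ends [simp]: "swap_ends (swap_ends w) = w"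
  by (cases w rule: swap_ends_cases) auto

lemma swap_ends_map: "swap_ends (map f w) = map f (swap_ends w)"
  by (cases w rule: swap_ends_cases) (auto simp: swap_ends_def)

lemma nice_word_swap_ends [simp]: "nice_word (swap_ends w) = nice_word w"
  by (cases w rule: swap_ends_cases) (auto simp: nice_word_def)

lift_definition swap_base :: "'d based_diagram \<Rightarrow> 'd based_diagram"
  is "\<lambda>(w, \<delta>). (swap_ends w, \<delta>)"
  by (fastforce simp: relabel_eq_def arrows_def simp flip: swap_ends_map)

lemma swap_base_based: "gauss_word w \<Longrightarrow> swap_base (based w \<delta>) = based (swap_ends w) \<delta>"
  unfolding based_def by (simp add: swap_base.abs_eq relabel_eq_refl)

lemma nice_based: "gauss_word w \<Longrightarrow> nice (based w \<delta>) = nice_word w"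
  unfolding based_def by (simp add: nice.abs_eq relabel_eq_refl)

lemma swap_base_swap_base [simp]: "swap_base (swap_base B) = B"
  by (cases B rule: based_cases) (simp add: swap_base_based)

lemma nice_swap_base [simp]: "nice (swap_base B) = nice B"
  by (cases B rule: based_cases) (simp add: swap_base_based nice_based)

definition shrink_eq :: "int based_diagram \<Rightarrow> int based_diagram \<Rightarrow> bool" where
  "shrink_eq B B' \<longleftrightarrow> B' = B \<or> (nice B \<and> B' = swap_base B)"

quotient_type degenerate_diagram = "int based_diagram" / shrink_eq
  by (rule equivpI; rule reflpI sympI transpI) (auto simp: shrink_eq_def)

definition shrink :: "int based_diagram \<Rightarrow> degenerate_diagram" where
  "shrink B = abs_degenerate_diagram B"

text \<open>
  \<open>degen e w \<mu>\<close> is obtained from the diagram of the cyclic word \<open>w\<close> by shrinking the arc that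
  arrives at the endpoint \<open>e\<close>: cut \<open>w\<close> so that it starts with \<open>e\<close>, then shrink the base arc.
\<close>

definition degen :: "nat endpoint \<Rightarrow> word \<Rightarrow> (nat \<Rightarrow> int) \<Rightarrow> (degenerate_diagram \<Rightarrow>\<^sub>0 rat)" where
  "degen e w \<mu> =
     gen (shrink (based (dropWhile (\<lambda>x. x \<noteq> e) w @ takeWhile (\<lambda>x. x \<noteq> e) w) \<mu>))"

text \<open>
  In both families the points \<open>P, Q, R\<close> are the intervals \<open>1, 2, 3\<close> of \<open>place\<close>. In the
  first family \<open>a\<close>, \<open>b\<close>, \<open>c\<close>, \<open>d\<close> are the arrows \<open>P \<rightarrow> Q\<close>, \<open>P \<rightarrow> R\<close>, \<open>Q \<rightarrow> R\<close>, \<open>R \<rightarrow> Q\<close>.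
  In the second one they are \<open>Q \<rightarrow> P\<close>, \<open>R \<rightarrow> P\<close>, \<open>Q \<rightarrow> R\<close>, \<open>R \<rightarrow> Q\<close>, and the triangle condition
  is applied to \<open>Q, R, P\<close>, which is in the same cyclic order as \<open>P, Q, R\<close>. The order of the
  two letters put on the degenerate point does not matter.
\<close>

definition triangle_relations :: "int \<Rightarrow> (degenerate_diagram \<Rightarrow>\<^sub>0 rat) set" where
  "triangle_relations K =
     {degen (Tail b) (place cyc u v w [Tail a, Tail b] [Head a] [Head b]) \<mu>
      - (degen (Tail c) (place cyc u v w [Tail a] [Head a, Tail c] [Head c]) \<mu>
       + degen (Tail d) (place cyc u v w [Tail b] [Head d] [Head b, Tail d]) \<mu>)
      | cyc u v w a b c d \<mu>.
        unseen u v w [a, b, c, d] \<and> \<mu> c + \<mu> d = K \<and> triangle K cyc (\<mu> a) (\<mu> b) (\<mu> c)} \<union>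
     {degen (Head b) (place cyc u v w [Head a, Head b] [Tail a] [Tail b]) \<mu>
      - (degen (Tail b) (place cyc u v w [Head b] [Tail c] [Head c, Tail b]) \<mu>
       + degen (Tail a) (place cyc u v w [Head a] [Head d, Tail a] [Tail d]) \<mu>)
      | cyc u v w a b c d \<mu>.
        unseen u v w [a, b, c, d] \<and> \<mu> c + \<mu> d = K \<and> triangle K cyc (\<mu> c) (\<mu> a) (\<mu> b)}"

text \<open>Equality of the classes of \<open>x\<close> and \<open>y\<close> in the quotient by the triangle relations.\<close>

definition eq_mod_triangle ::
  "int \<Rightarrow> (degenerate_diagram \<Rightarrow>\<^sub>0 rat) \<Rightarrow> (degenerate_diagram \<Rightarrow>\<^sub>0 rat) \<Rightarrow> bool" where
  "eq_mod_triangle K x y \<longleftrightarrow> x - y \<in> free_vs.span (triangle_relations K)"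


section \<open>The map \<open>d\<close>\<close>

definition crosses :: "word \<Rightarrow> nat \<Rightarrow> nat \<Rightarrow> bool" where
  "crosses w a b \<longleftrightarrow>
     map arrow (filter (\<lambda>e. arrow e \<in> {a, b}) w) \<in> {[a, b, a, b], [b, a, b, a]}"

definition epsilon_word :: "word \<Rightarrow> rat" where
  "epsilon_word w =
     (if crosses w (arrow (hd w)) (arrow (last w)) then 1 else - 1) *
     (- 1) ^ (of_bool (is_head (hd w)) + of_bool (is_head (last w)))"

text \<open>Only the values of \<open>epsilon\<close> at nice diagrams are relevant.\<close>

lift_definition epsilon :: "'d based_diagram \<Rightarrow> rat"
  is "\<lambda>(w, \<delta>). if w = [] then 0 else epsilon_word w"
proof -
  fix x y :: "word \<times> (nat \<Rightarrow> 'd)"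
  assume xy: "relabel_eq x y"
  obtain w \<delta> w' \<delta>' where x: "x = (w, \<delta>)" "y = (w', \<delta>')" by (cases x, cases y)
  from xy x obtain f where f: "inj_on f (arrows w)" "w' = map (map_endpoint f) w"
    by (auto simp: relabel_eq_def)
  have cr: "crosses w' (f a) (f b) = crosses w a b" if "a \<in> arrows w" "b \<in> arrows w" for a b
  proof -
    have "f (arrow e) \<in> {f a, f b} \<longleftrightarrow> arrow e \<in> {a, b}" if "e \<in> set w" for e
      using f(1) \<open>a \<in> arrows w\<close> \<open>b \<in> arrows w\<close> that by (auto simp: arrows_def dest: inj_onD)
    hence "filter (\<lambda>e. arrow e \<in> {f a, f b}) w'
        = map (map_endpoint f) (filter (\<lambda>e. arrow e \<in> {a, b}) w)"
      unfolding f(2) filter_map o_def arrow_map_endpoint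
      by (intro arg_cong[of _ _ "map _"] filter_cong) auto
    hence eq: "map arrow (filter (\<lambda>e. arrow e \<in> {f a, f b}) w')
        = map f (map arrow (filter (\<lambda>e. arrow e \<in> {a, b}) w))" by simp
    have iff: "map f (map arrow (filter (\<lambda>e. arrow e \<in> {a, b}) w)) = map f l \<longleftrightarrow>
        map arrow (filter (\<lambda>e. arrow e \<in> {a, b}) w) = l" if "set l \<subseteq> arrows w" for l
      by (rule inj_on_map_eq_map, rule inj_on_subset[OF f(1)])
        (use that in \<open>auto simp: arrows_def\<close>)
    show ?thesis
      unfolding crosses_def eq using iff[of "[a, b, a, b]"] iff[of "[b, a, b, a]"] that
      by (simp del: map_map)
  qed
  have "epsilon_word w' = epsilon_word w" if "w \<noteq> []"
  proof -
    have "arrow (hd w) \<in> arrows w" "arrow (last w) \<in> arrows w"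
      using that by (auto simp: arrows_def)
    hence "crosses w' (arrow (hd w')) (arrow (last w')) = crosses w (arrow (hd w)) (arrow (last w))"
      using that cr by (simp add: f(2) hd_map last_map)
    moreover have "is_head (map_endpoint f e) = is_head e" for e by (cases e) auto
    ultimately show ?thesis
      using that by (simp add: epsilon_word_def f(2) hd_map last_map)
  qed
  thus "(case x of (w, \<delta>) \<Rightarrow> if w = [] then 0 else epsilon_word w)
     = (case y of (w, \<delta>) \<Rightarrow> if w = [] then 0 else epsilon_word w)"
    by (simp add: x f(2))
qed

definition d_based :: "int based_diagram \<Rightarrow> (degenerate_diagram \<Rightarrow>\<^sub>0 rat)" where
  "d_based B = (if nice B then scl (epsilon B) (gen (shrink B)) else 0)"

lift_definition basings :: "'d diagram \<Rightarrow> ('d based_diagram \<Rightarrow>\<^sub>0 rat)"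
  is "\<lambda>B. \<Sum>r<num_endpoints B. gen (rotate_based r B)"
proof -
  fix B B' :: "'d based_diagram"
  assume "rotation_eq B B'"
  then obtain s where s: "B' = rotate_based s B" by (auto simp: rotation_eq_def)
  have step: "(\<Sum>r<num_endpoints C. gen (rotate_based r (rotate_based 1 C)))
      = (\<Sum>r<num_endpoints C. gen (rotate_based r C))" for C :: "'d based_diagram"
  proof -
    let ?f = "\<lambda>r. gen (rotate_based r C)"
    have "rotate_based (num_endpoints C) C = C"
      using rotate_based_mod[of "num_endpoints C" C] by simp
    hence "?f (num_endpoints C) = ?f 0" by simp
    moreover have "?f 0 + (\<Sum>r<num_endpoints C. ?f (Suc r))
        = (\<Sum>r<num_endpoints C. ?f r) + ?f (num_endpoints C)"
      using sum.lessThan_Suc_shift[of ?f "num_endpoints C"] sum.lessThan_Suc[of ?f "num_endpoints C"]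
      by simp
    ultimately have "(\<Sum>r<num_endpoints C. ?f (Suc r)) = (\<Sum>r<num_endpoints C. ?f r)"
      by (simp add: add.commute)
    thus ?thesis by (simp add: rotate_based_add)
  qed
  have "(\<Sum>r<num_endpoints B. gen (rotate_based r (rotate_based s B)))
      = (\<Sum>r<num_endpoints B. gen (rotate_based r B))"
  proof (induction s)
    case (Suc s)
    have "(\<Sum>r<num_endpoints B. gen (rotate_based r (rotate_based (Suc s) B)))
        = (\<Sum>r<num_endpoints B. gen (rotate_based r (rotate_based 1 (rotate_based s B))))"
      by (simp add: rotate_based_add)
    thus ?case using step[of "rotate_based s B"] Suc by simp
  qed simp
  thus "(\<Sum>r<num_endpoints B. gen (rotate_based r B)) =
        (\<Sum>r<num_endpoints B'. gen (rotate_based r B'))"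
    by (simp add: s)
qed

definition bullet :: "(arrow_diagram \<Rightarrow>\<^sub>0 rat) \<Rightarrow> (int based_diagram \<Rightarrow>\<^sub>0 rat)" where
  "bullet = lin_ext basings"

definition d_map :: "(arrow_diagram \<Rightarrow>\<^sub>0 rat) \<Rightarrow> (degenerate_diagram \<Rightarrow>\<^sub>0 rat)" where
  "d_map A = lin_ext d_based (bullet A)"

end

theory Submission
  imports Defs "HOL-Library.Multiset"
begin

text \<open>
  Write \<open>f D\<close> for \<open>\<langle>A, D\<rangle>\<close>. The first two conditions are each compared with the third one, which
  says that \<open>f\<close> vanishes on six-term combinations.

  \<^emph>\<open>Formulas.\<close> Forgetting the signs of a Gauss diagram \<open>G\<close> gives an arrow diagram \<open>|G|\<close>, and
  \<open>\<langle>S(A), G\<rangle>\<close> is the product of the signs of \<open>G\<close> times \<open>f |G|\<close>: the factors \<open>|Aut|\<close> in the two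
  pairings absorb the number of choices of signs on \<open>|G|\<close> that yield \<open>G\<close>
  (\<open>aut_order_signed_sum\<close>). Hence the candidate invariant is a signed sum of values of \<open>f\<close> over
  subdiagrams. Under \<open>R\<^sub>1\<close> and \<open>R\<^sub>2\<close> it changes by values of \<open>f\<close> on \<open>AP\<^sub>1\<close> and \<open>AP\<^sub>2\<close> diagrams.
  Under \<open>R\<^sub>3\<close> it changes by a sum, over the sets \<open>T\<close> of unseen arrows, of a six-term combination plus
  \<open>\<epsilon>\<close> times the difference of the two sides of the move with all three arrows present. As the move
  exists for both values of \<open>\<epsilon>\<close>, an invariant makes the sum of the six-term combinations vanish, and
  induction on the number of unseen arrows isolates the term in which all of them are present
  (\<open>formula_imp_6T\<close>). Conversely one must show that \<open>f\<close> takes the same value on the two sides of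
  the move, which have one arrow more than the diagrams of the six-term combination
  (\<open>triple_point_sides_agree\<close>). This is a variant of the fact that \<open>abc = cba\<close> follows over the
  rationals from \<open>[a, b] + [a, c] + [b, c] = 0\<close> and \<open>a\<^sup>2 = b\<^sup>2 = c\<^sup>2 = 0\<close>.

  \<^emph>\<open>The map \<open>d\<close>.\<close> A degenerate diagram at whose degenerate point two arrows meet is obtained from
  two arrow diagrams, which differ by the order of two neighbouring endpoints, and its coefficient in \<open>d(A)\<close> is, up to sign, the difference of
  the values of \<open>f\<close> (\<open>lookup_d_map\<close>). A six-term relator consists of three such differences. They
  belong to the corners of a transitive triangle \<open>1 \<rightarrow> 2 \<rightarrow> 3\<close>, \<open>1 \<rightarrow> 3\<close>, two sides of which are present
  at a time and meet at the source \<open>1\<close>, at the middle vertex \<open>2\<close> or at the sink \<open>3\<close>, and the sign is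
  the same at the three corners. So the six-term condition says that the coefficients of \<open>d(A)\<close> at
  the three corners of every transitive triangle add up to zero (\<open>corner_sum_d_map\<close>). A triangle
  relation expresses a source corner, or a sink corner, as the sum of the two middle corners of the
  two transitive triangles that it belongs to; therefore corner sums vanish on triangle relations.
  Conversely, let all corner sums of an element vanish. Subtracting triangle relations removes all
  its source and sink corners and preserves this property; what is left has zero coefficients, since
  each of them is a corner sum (\<open>in_span_triangle_relations\<close>).
\<close>

section \<open>Pairing with a diagram\<close>

lemma lookup_gen: "Poly_Mapping.lookup (gen x) k = (if k = x then 1 else 0)"
  by (auto simp: gen_def lookup_single when_def)

lemma keys_gen: "Poly_Mapping.keys (gen x) = {x}"
  by (simp add: gen_def)

lemma lookup_sum: "Poly_Mapping.lookup (sum g S) k = (\<Sum>i\<in>S. Poly_Mapping.lookup (g i) k)"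
  by (induction S rule: infinite_finite_induct) (auto simp: lookup_add)

lemma lookup_lin_ext:
  "Poly_Mapping.lookup (lin_ext g x) k =
     (\<Sum>i\<in>Poly_Mapping.keys x. Poly_Mapping.lookup x i * Poly_Mapping.lookup (g i) k)"
  by (simp add: lin_ext_def lookup_sum)

lemma lin_ext_gen: "lin_ext g (gen x) = g x"
  by (rule poly_mapping_eqI) (simp add: lookup_lin_ext keys_gen lookup_gen)

lemma pairing_superset:
  assumes "finite S" "Poly_Mapping.keys y \<subseteq> S"
  shows "pairing x y =
    (\<Sum>D\<in>S. Poly_Mapping.lookup y D * (of_nat (aut_order D) * Poly_Mapping.lookup x D))"
proof -
  have sc: "scalar_product (gen D) (gen D') = (if D = D' then 1 else 0)" for D D' :: "'a diagram"
    by (simp add: scalar_product_def bilin_ext_def keys_gen lookup_gen)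
  have "pairing x y = (\<Sum>l\<in>Poly_Mapping.keys y. \<Sum>k\<in>Poly_Mapping.keys x.
      Poly_Mapping.lookup x k * Poly_Mapping.lookup y l * (of_nat (aut_order k) * (if k = l then 1 else 0)))"
    unfolding pairing_def bilin_ext_def sc by (rule sum.swap)
  also have "\<dots> = (\<Sum>l\<in>Poly_Mapping.keys y.
      Poly_Mapping.lookup y l * (of_nat (aut_order l) * Poly_Mapping.lookup x l))"
  proof (rule sum.cong[OF refl])
    fix l
    have "(\<Sum>k\<in>Poly_Mapping.keys x. Poly_Mapping.lookup x k * Poly_Mapping.lookup y l *
        (of_nat (aut_order k) * (if k = l then 1 else 0)))
      = (\<Sum>k\<in>Poly_Mapping.keys x. if k = l then Poly_Mapping.lookup x l * Poly_Mapping.lookup y l *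
        of_nat (aut_order l) else 0)"
      by (rule sum.cong) auto
    also have "\<dots> = Poly_Mapping.lookup y l * (of_nat (aut_order l) * Poly_Mapping.lookup x l)"
      by (simp add: in_keys_iff)
    finally show "(\<Sum>k\<in>Poly_Mapping.keys x. Poly_Mapping.lookup x k * Poly_Mapping.lookup y l *
        (of_nat (aut_order k) * (if k = l then 1 else 0)))
      = Poly_Mapping.lookup y l * (of_nat (aut_order l) * Poly_Mapping.lookup x l)" .
  qed
  also have "\<dots> = (\<Sum>D\<in>S. Poly_Mapping.lookup y D * (of_nat (aut_order D) * Poly_Mapping.lookup x D))"
    using assms by (intro sum.mono_neutral_left) (auto simp: in_keys_iff)
  finally show ?thesis .
qed

lemma pairing_gen: "pairing x (gen D) = of_nat (aut_order D) * Poly_Mapping.lookup x D"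
  by (simp add: pairing_superset[of "{D}"] keys_gen lookup_gen)

lemma pairing_add: "pairing x (y + z) = pairing x y + pairing x z"
proof -
  let ?S = "Poly_Mapping.keys y \<union> Poly_Mapping.keys z"
  show ?thesis
    using keys_add[of y z] 
    by (simp add: pairing_superset[of ?S] lookup_add sum.distrib distrib_right)
qed

lemma pairing_diff: "pairing x (y - z) = pairing x y - pairing x z"
  using pairing_add[of x "y - z" z] by simp

lemma pairing_sum: "pairing x (sum g S) = (\<Sum>i\<in>S. pairing x (g i))"
proof (induction S rule: infinite_finite_induct)
  case (insert i S)
  thus ?case by (simp add: pairing_add)
qed (simp_all add: pairing_superset[of "{}"])

section \<open>Counting rotations\<close>

text \<open>
  The rotations carrying \<open>B\<close> to \<open>B'\<close> form a coset of the stabiliser of \<open>B\<close>, hence are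
  equally many.
\<close>

lemma card_rotations:
  "card {r. r < max 1 (num_endpoints B) \<and> rotate_based r B = B'} =
     (if rotation_eq B B' then aut_order (abs_diagram B') else 0)"
proof (cases "rotation_eq B B'")
  case True
  define N where "N = max 1 (num_endpoints B)"
  have N: "N > 0" by (simp add: N_def)
  have md: "rotate_based (r mod N) C = rotate_based r C"
    if "num_endpoints C = num_endpoints B" for r and C :: "'a based_diagram"
  proof (cases "num_endpoints B = 0")
    case True
    hence "rotate_based s C = C" for s
      using that by (cases C rule: based_cases) (simp add: rotate_based_based num_endpoints_based)
    thus ?thesis by simp
  next
    case False
    thus ?thesis using that rotate_based_mod[of r C] by (simp add: N_def max_def)
  qed
  obtain s where s: "B' = rotate_based s B" using True by (auto simp: rotation_eq_def)
  obtain t where t: "rotate_based t B' = B" using rotate_based_inverse s by blast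
  have le: "card {r. r < N \<and> rotate_based r C = D} \<le> card {r. r < N \<and> rotate_based r C' = D'}"
    if "num_endpoints C = num_endpoints B" "rotate_based k C' = C" "rotate_based l D = D'"
    for C C' D D' :: "'a based_diagram" and k l
  proof (rule card_inj_on_le)
    have "num_endpoints C' = num_endpoints B" using that(1,2) num_endpoints_rotate by metis
    thus "(\<lambda>r. (r + (k + l)) mod N) ` {r. r < N \<and> rotate_based r C = D} \<subseteq>
        {r. r < N \<and> rotate_based r C' = D'}"
      using N md that(2,3) by (auto simp: rotate_based_add add_ac)
    show "inj_on (\<lambda>r. (r + (k + l)) mod N) {r. r < N \<and> rotate_based r C = D}"
    proof (rule inj_onI)
      fix r r' assume *: "r \<in> {r. r < N \<and> rotate_based r C = D}"
        "r' \<in> {r. r < N \<and> rotate_based r C = D}" "(r + (k + l)) mod N = (r' + (k + l)) mod N"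
      have cancel: "x = y" if "x \<le> y" "y < N" "(x + m) mod N = (y + m) mod N" for x y m
        using that mod_eq_dvd_iff_nat[of "x + m" "y + m" N] by (auto dest!: dvd_imp_le)
      show "r = r'"
        using * cancel[of r r' "k + l"] cancel[of r' r "k + l"] by (cases "r \<le> r'") auto
    qed
  qed simp
  have "card {r. r < N \<and> rotate_based r B = B'} = card {r. r < N \<and> rotate_based r B' = B'}"
  proof (rule le_antisym)
    show "card {r. r < N \<and> rotate_based r B = B'} \<le> card {r. r < N \<and> rotate_based r B' = B'}"
      by (rule le[OF refl t rotate_based_0])
    have "num_endpoints B' = num_endpoints B" by (simp add: s)
    thus "card {r. r < N \<and> rotate_based r B' = B'} \<le> card {r. r < N \<and> rotate_based r B = B'}"
      by (rule le[OF _ s[symmetric] rotate_based_0])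
  qed
  thus ?thesis using True s by (simp add: N_def aut_order.abs_eq)
next
  case False
  thus ?thesis by (auto simp: rotation_eq_def)
qed

section \<open>The pairing of a signed sum\<close>

definition sgn_prod :: "nat set \<Rightarrow> (nat \<Rightarrow> sign \<times> int) \<Rightarrow> rat" where
  "sgn_prod T \<delta> = (\<Prod>a\<in>T. sign_value (fst (\<delta> a)))"

lemma rotation_eq_commute: "rotation_eq B B' \<longleftrightarrow> rotation_eq B' B"
  by (metis rotation_eq_def rotate_based_inverse)

lemma dgm_eq_iff:
  "dgm w \<delta> = dgm w' \<delta>' \<longleftrightarrow> rotation_eq (based w \<delta>) (based w' \<delta>')"
  by (simp add: dgm_def diagram.abs_eq_iff)

lemma based_eq_iff:
  assumes "gauss_word w" "gauss_word w'"
  shows "based w \<delta> = based w' \<delta>' \<longleftrightarrow> relabel_eq (w, \<delta>) (w', \<delta>')"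
  using assms Quotient_rel[OF Quotient_based_diagram, of "(w, \<delta>)" "(w', \<delta>')"]
  by (auto simp: based_def relabel_eq_refl)

lemma dgm_cases:
  obtains w \<delta> where "D = dgm w \<delta>" "gauss_word w"
proof -
  have "\<exists>B. D = abs_diagram B" by (induct D rule: diagram.abs_induct) auto
  then obtain B where B: "D = abs_diagram B" ..
  obtain w \<delta> where "B = based w \<delta>" "gauss_word w" by (rule based_cases)
  thus ?thesis using that B by (auto simp: dgm_def)
qed

lemma map_endpoint_eq_iff:
  "map (map_endpoint f) w = map (map_endpoint g) w \<longleftrightarrow> (\<forall>a\<in>arrows w. f a = g a)"
proof -
  have "map_endpoint f e = map_endpoint g e \<longleftrightarrow> f (arrow e) = g (arrow e)" for e
    by (cases e) auto
  thus ?thesis by (auto simp: arrows_def)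
qed

lemma rotate_gauss_eq_iff:
  "gauss_word w \<Longrightarrow> gauss_word w' \<Longrightarrow>
   rotate_based r (based w \<delta>) = based w' \<delta>' \<longleftrightarrow> relabel_eq (rotate r w, \<delta>) (w', \<delta>')"
  by (simp add: rotate_based_based based_eq_iff)

text \<open>
  A rotation \<open>r\<close> that carries \<open>w\<close> with signs \<open>\<sigma>\<close> to \<open>w\<close> with signs \<open>\<sigma>\<^sub>0\<close> is a symmetry of
  the underlying arrow diagram, and conversely such a symmetry carries exactly one choice
  of signs to \<open>\<sigma>\<^sub>0\<close>.
\<close>

lemma card_signs:
  assumes w: "gauss_word w"
  shows "card {\<sigma> \<in> arrows w \<rightarrow>\<^sub>E UNIV.
      rotate_based r (based w (\<lambda>a. (\<sigma> a, \<mu> a :: int))) = based w (\<lambda>a. (\<sigma>0 a :: sign, \<mu> a))}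
    = (if rotate_based r (based w \<mu>) = based w \<mu> then 1 else 0)"
proof (cases "rotate_based r (based w \<mu>) = based w \<mu>")
  case True
  then obtain f where f: "inj_on f (arrows w)" "w = map (map_endpoint f) (rotate r w)"
      "\<forall>a\<in>arrows w. \<mu> (f a) = \<mu> a"
    using w by (auto simp: rotate_gauss_eq_iff relabel_eq_def)
  have "{\<sigma> \<in> arrows w \<rightarrow>\<^sub>E UNIV.
      rotate_based r (based w (\<lambda>a. (\<sigma> a, \<mu> a))) = based w (\<lambda>a. (\<sigma>0 a, \<mu> a))}
    = {restrict (\<sigma>0 \<circ> f) (arrows w)}" (is "?L = ?R")
  proof (intro equalityI subsetI)
    fix \<sigma> assume \<sigma>: "\<sigma> \<in> ?L"
    then obtain g where g: "w = map (map_endpoint g) (rotate r w)" "\<forall>a\<in>arrows w. \<sigma>0 (g a) = \<sigma> a"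
      using w by (auto simp: rotate_gauss_eq_iff relabel_eq_def)
    have "\<forall>a\<in>arrows (rotate r w). f a = g a"
      using f(2) g(1) map_endpoint_eq_iff by metis
    thus "\<sigma> \<in> ?R" using \<sigma> g(2) by (auto simp: fun_eq_iff PiE_def extensional_def restrict_def)
  next
    fix \<sigma> assume "\<sigma> \<in> ?R"
    thus "\<sigma> \<in> ?L" using w f by (auto simp: rotate_gauss_eq_iff relabel_eq_def intro!: exI[of _ f])
  qed
  thus ?thesis using True by simp
next
  case False
  have "rotate_based r (based w (\<lambda>a. (\<sigma> a, \<mu> a))) \<noteq> based w (\<lambda>a. (\<sigma>0 a, \<mu> a))" for \<sigma> :: "nat \<Rightarrow> sign"
    using False w by (auto simp: rotate_gauss_eq_iff relabel_eq_def)
  thus ?thesis using False by simp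
qed

lemma sgn_prod_relabel:
  assumes "dgm w \<delta> = dgm w' \<delta>'" "gauss_word w" "gauss_word w'"
  shows "sgn_prod (arrows w) \<delta> = sgn_prod (arrows w') \<delta>'"
proof -
  obtain r f where f: "inj_on f (arrows w)" "w' = map (map_endpoint f) (rotate r w)"
      "\<forall>a\<in>arrows w. \<delta>' (f a) = \<delta> a"
    using assms by (auto simp: dgm_eq_iff rotation_eq_def eq_commute[of "based w' _"]
        rotate_gauss_eq_iff relabel_eq_def)
  thus ?thesis by (simp add: sgn_prod_def prod.reindex)
qed

text \<open>
  Decorations may be simplified without affecting the isomorphism; below, \<open>h\<close> forgets the signs.
\<close>

lemma dgm_forget:
  assumes "dgm w \<delta> = dgm w' \<delta>'" "gauss_word w" "gauss_word w'"
  shows "dgm w (h \<circ> \<delta>) = dgm w' (h \<circ> \<delta>')"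
proof -
  obtain r where r: "relabel_eq (rotate r w, \<delta>) (w', \<delta>')"
    using assms by (auto simp: dgm_eq_iff rotation_eq_def eq_commute[of "based w' _"]
        rotate_gauss_eq_iff)
  hence "relabel_eq (rotate r w, h \<circ> \<delta>) (w', h \<circ> \<delta>')" by (auto simp: relabel_eq_def)
  thus ?thesis using dgm_relabel dgm_rotate[OF assms(2)] by metis
qed

lemma signed_sum_dgm:
  "gauss_word w \<Longrightarrow> signed_sum (dgm w \<mu>) = (\<Sum>\<sigma>\<in>arrows w \<rightarrow>\<^sub>E UNIV.
     scl (\<Prod>a\<in>arrows w. sign_value (\<sigma> a)) (gen (dgm w (\<lambda>a. (\<sigma> a, \<mu> a)))))"
  by (simp add: dgm_def signed_sum.abs_eq signed_sum_based_based)

text \<open>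
  Count in two ways the pairs of a choice of signs \<open>\<sigma>\<close> on the underlying arrow diagram and a rotation
  that carries the diagram with signs \<open>\<sigma>\<close> to the given one: for fixed \<open>\<sigma>\<close> the rotations form a coset of
  the automorphism group of the Gauss diagram, and each automorphism of the arrow diagram admits
  exactly one \<open>\<sigma>\<close>.
\<close>

lemma aut_order_signed_sum:
  assumes w: "gauss_word w"
  shows "of_nat (aut_order (dgm w \<delta>)) * Poly_Mapping.lookup (signed_sum D) (dgm w \<delta>)
    = (if D = dgm w (snd \<circ> \<delta>) then sgn_prod (arrows w) \<delta> * of_nat (aut_order D) else 0)"
proof (cases "D = dgm w (snd \<circ> \<delta>)")
  case False
  obtain w' \<mu> where D: "D = dgm w' \<mu>" and w': "gauss_word w'" by (rule dgm_cases)
  have "dgm w \<delta> \<noteq> dgm w' (\<lambda>a. (\<sigma> a, \<mu> a))" for \<sigma>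
    using dgm_forget[of w' "\<lambda>a. (\<sigma> a, \<mu> a)" w \<delta> snd] w w' D False by (auto simp: o_def)
  hence "Poly_Mapping.lookup (signed_sum D) (dgm w \<delta>) = 0"
    using w' by (simp add: D signed_sum_dgm lookup_sum lookup_gen)
  thus ?thesis using False by simp
next
  case True
  define \<mu> where "\<mu> = snd \<circ> \<delta>"
  define \<sigma>0 where "\<sigma>0 = fst \<circ> \<delta>"
  have \<delta>: "\<delta> = (\<lambda>a. (\<sigma>0 a, \<mu> a))" by (simp add: \<sigma>0_def \<mu>_def)
  have D: "D = dgm w \<mu>" using True by (simp add: \<mu>_def)
  define N where "N = max 1 (length w)"
  let ?\<Sigma> = "arrows w \<rightarrow>\<^sub>E (UNIV :: sign set)"
  let ?B = "\<lambda>\<sigma>. based w (\<lambda>a. (\<sigma> a, \<mu> a))"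
  have "finite (UNIV :: sign set)"
    by (rule finite_subset[of _ "{Plus, Minus}"]) (use sign.exhaust in auto)
  hence fin: "finite ?\<Sigma>" by (intro finite_PiE) auto
  have count: "of_nat (aut_order (dgm w \<delta>)) * Poly_Mapping.lookup (gen (dgm w (\<lambda>a. (\<sigma> a, \<mu> a)))) (dgm w \<delta>)
      = (\<Sum>r<N. if rotate_based r (?B \<sigma>) = ?B \<sigma>0 then 1 else (0::rat))" for \<sigma>
  proof -
    have "(\<Sum>r<N. if rotate_based r (?B \<sigma>) = ?B \<sigma>0 then 1 else (0::rat))
        = of_nat (card {r. r < N \<and> rotate_based r (?B \<sigma>) = ?B \<sigma>0})"
      by (simp add: sum.If_cases Int_def)
    also have "\<dots> = of_nat (if rotation_eq (?B \<sigma>) (?B \<sigma>0) then aut_order (dgm w \<delta>) else 0)"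
      using card_rotations[of "?B \<sigma>" "?B \<sigma>0"] w by (simp add: N_def num_endpoints_based \<delta> dgm_def)
    finally show ?thesis
      using w by (auto simp: lookup_gen \<delta> dgm_eq_iff rotation_eq_commute[of "?B \<sigma>0"])
  qed
  have "of_nat (aut_order (dgm w \<delta>)) * Poly_Mapping.lookup (signed_sum D) (dgm w \<delta>)
      = (\<Sum>\<sigma>\<in>?\<Sigma>. (\<Prod>a\<in>arrows w. sign_value (\<sigma> a)) *
          (of_nat (aut_order (dgm w \<delta>)) * Poly_Mapping.lookup (gen (dgm w (\<lambda>a. (\<sigma> a, \<mu> a)))) (dgm w \<delta>)))"
    using w by (simp add: D signed_sum_dgm lookup_sum sum_distrib_left mult_ac)
  also have "\<dots> = (\<Sum>\<sigma>\<in>?\<Sigma>. \<Sum>r<N. sgn_prod (arrows w) \<delta> *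
      (if rotate_based r (?B \<sigma>) = ?B \<sigma>0 then 1 else 0))"
  proof (rule sum.cong[OF refl])
    fix \<sigma>
    have "(\<Prod>a\<in>arrows w. sign_value (\<sigma> a)) = sgn_prod (arrows w) \<delta>"
      if "rotate_based r (?B \<sigma>) = ?B \<sigma>0" for r
    proof -
      have "dgm w (\<lambda>a. (\<sigma> a, \<mu> a)) = dgm w \<delta>"
        using that w by (auto simp: dgm_eq_iff rotation_eq_def \<delta> intro!: exI[of _ r])
      from sgn_prod_relabel[OF this w w] show ?thesis by (simp add: sgn_prod_def)
    qed
    thus "(\<Prod>a\<in>arrows w. sign_value (\<sigma> a)) *
        (of_nat (aut_order (dgm w \<delta>)) * Poly_Mapping.lookup (gen (dgm w (\<lambda>a. (\<sigma> a, \<mu> a)))) (dgm w \<delta>))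
      = (\<Sum>r<N. sgn_prod (arrows w) \<delta> * (if rotate_based r (?B \<sigma>) = ?B \<sigma>0 then 1 else 0))"
      unfolding count sum_distrib_left by (intro sum.cong) auto
  qed
  also have "\<dots> = (\<Sum>r<N. sgn_prod (arrows w) \<delta> *
      of_nat (card {\<sigma> \<in> ?\<Sigma>. rotate_based r (?B \<sigma>) = ?B \<sigma>0}))"
    using fin by (subst sum.swap) (simp add: sum_distrib_left[symmetric] sum.If_cases Int_def)
  also have "\<dots> = sgn_prod (arrows w) \<delta> * of_nat (card {r. r < N \<and> rotate_based r (based w \<mu>) = based w \<mu>})"
    unfolding card_signs[OF w]
    by (simp add: sum_distrib_left[symmetric] if_distrib[of of_nat] sum.If_cases Int_def)
  also have "\<dots> = sgn_prod (arrows w) \<delta> * of_nat (aut_order D)"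
    using w by (simp add: D dgm_def aut_order.abs_eq N_def num_endpoints_based)
  finally show ?thesis using True by simp
qed

lemma pairing_S_map:
  assumes "gauss_word w"
  shows "pairing (S_map A) (gen (dgm w \<delta>))
    = sgn_prod (arrows w) \<delta> * pairing A (gen (dgm w (snd \<circ> \<delta>)))"
proof -
  let ?D = "dgm w (snd \<circ> \<delta>)"
  have "pairing (S_map A) (gen (dgm w \<delta>)) = (\<Sum>D\<in>Poly_Mapping.keys A. Poly_Mapping.lookup A D *
      (of_nat (aut_order (dgm w \<delta>)) * Poly_Mapping.lookup (signed_sum D) (dgm w \<delta>)))"
    by (simp add: pairing_gen S_map_def lookup_lin_ext sum_distrib_left mult_ac)
  also have "\<dots> = (\<Sum>D\<in>Poly_Mapping.keys A. if D = ?D then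
      Poly_Mapping.lookup A ?D * (sgn_prod (arrows w) \<delta> * of_nat (aut_order ?D)) else 0)"
    unfolding aut_order_signed_sum[OF assms] by (intro sum.cong) auto
  also have "\<dots> = sgn_prod (arrows w) \<delta> * pairing A (gen ?D)"
    by (simp add: pairing_gen in_keys_iff)
  finally show ?thesis .
qed

lemma arrows_filter: "arrows (filter (\<lambda>e. arrow e \<in> T) w) = arrows w \<inter> T"
  by (auto simp: arrows_def)

lemma pairing_S_map_I_map:
  assumes w: "gauss_word w"
  shows "pairing (S_map A) (I_map (gen (dgm w \<delta>)))
    = (\<Sum>T\<in>Pow (arrows w). sgn_prod T \<delta> *
         pairing A (gen (dgm (filter (\<lambda>e. arrow e \<in> T) w) (snd \<circ> \<delta>))))"
proof -
  have "pairing (S_map A) (I_map (gen (dgm w \<delta>)))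
      = (\<Sum>T\<in>Pow (arrows w). pairing (S_map A) (gen (dgm (filter (\<lambda>e. arrow e \<in> T) w) \<delta>)))"
    using w by (simp add: I_map_def lin_ext_gen dgm_def[of w \<delta>] subdiagrams.abs_eq
        subdiagrams_based_based pairing_sum)
  also have "\<dots> = (\<Sum>T\<in>Pow (arrows w). sgn_prod T \<delta> *
         pairing A (gen (dgm (filter (\<lambda>e. arrow e \<in> T) w) (snd \<circ> \<delta>))))"
    using w by (intro sum.cong) (auto simp: pairing_S_map gauss_word_filter arrows_filter Int_absorb1)
  finally show ?thesis .
qed

section \<open>Words on three intervals\<close>

fun mate :: "'l endpoint \<Rightarrow> 'l endpoint" where
  "mate (Tail a) = Head a"
| "mate (Head a) = Tail a"

lemma gauss_word_mate: "gauss_word w \<longleftrightarrow> distinct w \<and> (\<forall>e\<in>set w. mate e \<in> set w)"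
  unfolding gauss_word_def by (metis endpoint.exhaust mate.simps)

lemma mate_map_endpoint [simp]: "mate (map_endpoint f e) = map_endpoint f (mate e)"
  by (cases e) auto

lemma gauss_word_map:
  assumes "gauss_word w" "inj_on f (arrows w)"
  shows "gauss_word (map (map_endpoint f) w)"
proof -
  have "inj_on (map_endpoint f) (set w)"
  proof (rule inj_onI)
    fix e e' assume *: "e \<in> set w" "e' \<in> set w" "map_endpoint f e = map_endpoint f e'"
    hence "arrow e \<in> arrows w" "arrow e' \<in> arrows w" by (simp_all add: arrows_def)
    with * have "arrow e = arrow e'" using inj_onD[OF assms(2)] by (metis arrow_map_endpoint)
    thus "e = e'" using *(3) by (cases e; cases e') auto
  qed
  thus ?thesis using assms(1) by (auto simp: gauss_word_mate distinct_map)
qed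

text \<open>
  Being a Gauss word only depends on the multiset of letters. This replaces all computations with
  the order of the letters when words are cut and glued.
\<close>

lemma gauss_word_permute:
  assumes "gauss_word w" "mset w = mset w'"
  shows "gauss_word w'"
  using assms mset_eq_setD[OF assms(2)] mset_eq_imp_distinct_iff[OF assms(2)]
  by (simp add: gauss_word_def)

definition restrict_word :: "nat set \<Rightarrow> word \<Rightarrow> word" where
  "restrict_word T w = filter (\<lambda>e. arrow e \<in> T) w"

lemma restrict_word_simps [simp]:
  "restrict_word T [] = []"
  "restrict_word T (e # w) = (if arrow e \<in> T then e # restrict_word T w else restrict_word T w)"
  "restrict_word T (w @ w') = restrict_word T w @ restrict_word T w'"
  by (simp_all add: restrict_word_def)

lemma restrict_word_place [simp]:
  "restrict_word T (place cyc u v w I1 I2 I3) =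
     place cyc (restrict_word T u) (restrict_word T v) (restrict_word T w)
       (restrict_word T I1) (restrict_word T I2) (restrict_word T I3)"
  by (cases cyc) auto

lemma restrict_word_insert: "a \<notin> arrows w \<Longrightarrow> restrict_word (insert a T) w = restrict_word T w"
  unfolding restrict_word_def by (rule filter_cong) (auto simp: arrows_def)

lemma restrict_word_all: "arrows w \<subseteq> T \<Longrightarrow> restrict_word T w = w"
  unfolding restrict_word_def by (rule filter_True) (auto simp: arrows_def)

lemma gauss_word_restrict: "gauss_word w \<Longrightarrow> gauss_word (restrict_word T w)"
  unfolding restrict_word_def by (rule gauss_word_filter)

lemma arrows_restrict [simp]: "arrows (restrict_word T w) = arrows w \<inter> T"
  by (simp add: restrict_word_def arrows_filter)

lemma arrows_simps [simp]:
  "arrows [] = {}" "arrows (e # w) = insert (arrow e) (arrows w)"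
  "arrows (w @ w') = arrows w \<union> arrows w'"
  by (auto simp: arrows_def)

lemma arrows_place: "arrows (place cyc u v w I1 I2 I3) =
    arrows I1 \<union> arrows I2 \<union> arrows I3 \<union> arrows u \<union> arrows v \<union> arrows w"
  by (cases cyc) auto

lemma unseen_restrict:
  assumes "unseen u v w ls"
  shows "unseen (restrict_word T u) (restrict_word T v) (restrict_word T w) ls"
  using assms gauss_word_restrict[of "u @ v @ w" T] by (auto simp: unseen_def)

lemma gauss_word_append_disjoint:
  assumes "gauss_word x" "arrows y \<inter> arrows x = {}"
  shows "gauss_word (y @ x) \<longleftrightarrow> gauss_word y"
proof -
  have "e \<notin> set x" if "arrow e \<in> arrows y" for e using that assms(2) by (auto simp: arrows_def)
  hence "e \<notin> set x" if "e \<in> set y" for e using that by (auto simp: arrows_def)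
  moreover have "Tail a \<notin> set x \<and> Head a \<notin> set x" if "Tail a \<in> set y \<or> Head a \<in> set y" for a
    using that assms by (force simp: arrows_def)
  ultimately show ?thesis using assms(1) unfolding gauss_word_def by auto
qed

lemma gauss_word_place_iff:
  "gauss_word (place cyc u v w I1 I2 I3) \<longleftrightarrow> gauss_word (I1 @ I2 @ I3 @ u @ v @ w)"
  by (cases cyc; rule iffI; erule gauss_word_permute; simp add: union_ac)

lemma gauss_word_placeI:
  assumes "unseen u v w ls" "gauss_word (I1 @ I2 @ I3)" "arrows (I1 @ I2 @ I3) \<subseteq> set ls"
  shows "gauss_word (place cyc u v w I1 I2 I3)"
proof -
  have "arrows (I1 @ I2 @ I3) \<inter> arrows (u @ v @ w) = {}"
    using assms(1,3) unfolding unseen_def by blast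
  thus ?thesis
    using assms(1,2) gauss_word_append_disjoint[of "u @ v @ w" "I1 @ I2 @ I3"]
    by (simp add: gauss_word_place_iff unseen_def)
qed

lemma dgm_cong:
  assumes "gauss_word w" "\<And>a. a \<in> arrows w \<Longrightarrow> \<delta> a = \<delta>' a"
  shows "dgm w \<delta> = dgm w \<delta>'"
  by (rule dgm_relabel) (use assms in \<open>auto simp: relabel_eq_def endpoint.map_id0 intro!: exI[of _ id]\<close>)

text \<open>
  Exchanging the names of two arrows with the same marking: this identifies diagrams that only
  differ by which of two parallel arrows is which.
\<close>

definition swap_labels :: "nat \<Rightarrow> nat \<Rightarrow> word \<Rightarrow> word" where
  "swap_labels a d w = map (map_endpoint (id(a := d, d := a))) w"

lemma swap_labels_simps [simp]:
  "swap_labels a d [] = []"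
  "swap_labels a d (e # w) = map_endpoint (id(a := d, d := a)) e # swap_labels a d w"
  by (simp_all add: swap_labels_def)

lemma swap_labels_fresh:
  assumes "a \<notin> arrows w" "d \<notin> arrows w"
  shows "swap_labels a d w = w"
proof -
  have "map_endpoint (id(a := d, d := a)) e = e" if "e \<in> set w" for e
  proof -
    have "arrow e \<noteq> a" "arrow e \<noteq> d" using that assms by (auto simp: arrows_def)
    thus ?thesis by (cases e) auto
  qed
  thus ?thesis by (simp add: swap_labels_def map_idI)
qed

lemma dgm_swap_labels:
  assumes "gauss_word (place cyc u v w I1 I2 I3)" "unseen u v w ls" "a \<in> set ls" "d \<in> set ls" "\<mu> a = \<mu> d"
  shows "dgm (place cyc u v w (swap_labels a d I1) (swap_labels a d I2) (swap_labels a d I3)) \<mu> =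
         dgm (place cyc u v w I1 I2 I3) \<mu>"
proof -
  let ?f = "id(a := d, d := a)"
  have inj: "inj_on ?f X" for X by (auto simp: inj_on_def)
  have eq: "place cyc u v w (swap_labels a d I1) (swap_labels a d I2) (swap_labels a d I3)
      = map (map_endpoint ?f) (place cyc u v w I1 I2 I3)" (is "?w' = _")
  proof -
    have "swap_labels a d x = x" if "x \<in> {u, v, w}" for x
      using that assms(2-4) by (intro swap_labels_fresh) (auto simp: unseen_def)
    thus ?thesis by (cases cyc) (simp_all add: swap_labels_def)
  qed
  have "gauss_word ?w'" unfolding eq by (rule gauss_word_map[OF assms(1) inj])
  hence "relabel_eq (place cyc u v w I1 I2 I3, \<mu>) (?w', \<mu>)"
    using assms(1,5) inj unfolding relabel_eq_def prod.case
    by (intro conjI exI[of _ ?f]) (auto simp: eq)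
  thus ?thesis by (rule dgm_relabel[symmetric])
qed

section \<open>The six-term relation and triple points\<close>

definition six_term ::
  "(arrow_diagram \<Rightarrow> rat) \<Rightarrow> cyclic_order \<Rightarrow> word \<Rightarrow> word \<Rightarrow> word \<Rightarrow> nat \<Rightarrow> nat \<Rightarrow> nat \<Rightarrow> (nat \<Rightarrow> int) \<Rightarrow> rat"
where
  "six_term f cyc u v w a b c \<mu> =
     (let X = (\<lambda>I1 I2 I3. f (dgm (place cyc u v w I1 I2 I3) \<mu>)) in
       (X [Tail a, Tail b] [Head a] [Head b] - X [Tail b, Tail a] [Head a] [Head b])
     + (X [Tail a] [Head a, Tail c] [Head c] - X [Tail a] [Tail c, Head a] [Head c])
     + (X [Tail b] [Tail c] [Head b, Head c] - X [Tail b] [Tail c] [Head c, Head b]))"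

lemma pairing_relator_6T:
  "pairing A (relator_6T cyc u v w a b c \<mu>) = six_term (\<lambda>D. pairing A (gen D)) cyc u v w a b c \<mu>"
  by (simp add: relator_6T_def six_term_def pairing_add pairing_diff)

definition vanishes_on_6T :: "int \<Rightarrow> (arrow_diagram \<Rightarrow> rat) \<Rightarrow> bool" where
  "vanishes_on_6T K f \<longleftrightarrow> (\<forall>cyc u v w a b c \<mu>. unseen u v w [a, b, c] \<longrightarrow>
     triangle K cyc (\<mu> a) (\<mu> b) (\<mu> c) \<longrightarrow> six_term f cyc u v w a b c \<mu> = 0)"

definition vanishes_on_AP2 :: "(arrow_diagram \<Rightarrow> rat) \<Rightarrow> bool" where
  "vanishes_on_AP2 f \<longleftrightarrow> (\<forall>a b u H v \<mu>.
     gauss_word ([Tail a, Tail b] @ u @ H @ v) \<longrightarrow> a \<noteq> b \<longrightarrow>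
     H = [Head a, Head b] \<or> H = [Head b, Head a] \<longrightarrow> \<mu> a = \<mu> b \<longrightarrow>
     f (dgm ([Tail a, Tail b] @ u @ H @ v) \<mu>) = 0)"

text \<open>
  Unseen arrows may also have their endpoints on the three intervals, on either side of the
  visible ones: they are absorbed into the complementary arcs.
\<close>

lemma six_term_inside:
  assumes f: "vanishes_on_6T K f"
    and unseen: "unseen u v w ls"
    and tri: "triangle K cyc (\<mu> a) (\<mu> b) (\<mu> c)"
    and Z: "\<And>I1 I2 I3. Z I1 I2 I3 = f (dgm (place cyc u v w I1 I2 I3) \<mu>)"
    and extra: "gauss_word (L1 @ R1 @ L2 @ R2 @ L3 @ R3)" "arrows (L1 @ R1 @ L2 @ R2 @ L3 @ R3) \<subseteq> set ls"
    and abc: "distinct [a, b, c]" "{a, b, c} \<subseteq> set ls" "{a, b, c} \<inter> arrows (L1 @ R1 @ L2 @ R2 @ L3 @ R3) = {}"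
  shows "(Z (L1 @ [Tail a, Tail b] @ R1) (L2 @ [Head a] @ R2) (L3 @ [Head b] @ R3)
      - Z (L1 @ [Tail b, Tail a] @ R1) (L2 @ [Head a] @ R2) (L3 @ [Head b] @ R3))
     + (Z (L1 @ [Tail a] @ R1) (L2 @ [Head a, Tail c] @ R2) (L3 @ [Head c] @ R3)
      - Z (L1 @ [Tail a] @ R1) (L2 @ [Tail c, Head a] @ R2) (L3 @ [Head c] @ R3))
     + (Z (L1 @ [Tail b] @ R1) (L2 @ [Tail c] @ R2) (L3 @ [Head b, Head c] @ R3)
      - Z (L1 @ [Tail b] @ R1) (L2 @ [Tail c] @ R2) (L3 @ [Head c, Head b] @ R3)) = 0"
proof -
  define X where "X I1 I2 I3 = Z (L1 @ I1 @ R1) (L2 @ I2 @ R2) (L3 @ I3 @ R3)" for I1 I2 I3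
  have g: "gauss_word (place cyc u v w (L1 @ R1) (L2 @ R2) (L3 @ R3))"
    using gauss_word_placeI[OF unseen] extra by simp
  have fresh: "{a, b, c} \<inter> arrows (place cyc u v w (L1 @ R1) (L2 @ R2) (L3 @ R3)) = {}"
    using unseen abc unfolding arrows_place unseen_def by auto
  obtain u' v' w' where
    place': "\<And>I1 I2 I3. gauss_word (place cyc u' v' w' I1 I2 I3) \<Longrightarrow>
      dgm (place cyc u v w (L1 @ I1 @ R1) (L2 @ I2 @ R2) (L3 @ I3 @ R3)) \<mu> = dgm (place cyc u' v' w' I1 I2 I3) \<mu>"
    and unseen': "unseen u' v' w' [a, b, c]"
  proof (cases cyc)
    case Order123
    show ?thesis
    proof (rule that[of "R1 @ u @ L2" "R2 @ v @ L3" "R3 @ w @ L1"])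
      show "dgm (place cyc u v w (L1 @ I1 @ R1) (L2 @ I2 @ R2) (L3 @ I3 @ R3)) \<mu> =
          dgm (place cyc (R1 @ u @ L2) (R2 @ v @ L3) (R3 @ w @ L1) I1 I2 I3) \<mu>"
        if "gauss_word (place cyc (R1 @ u @ L2) (R2 @ v @ L3) (R3 @ w @ L1) I1 I2 I3)" for I1 I2 I3
        using dgm_append_commute[of "I1 @ R1 @ u @ L2 @ I2 @ R2 @ v @ L3 @ I3 @ R3 @ w" L1 \<mu>] that
        by (simp add: Order123)
      have "gauss_word ((R1 @ u @ L2) @ (R2 @ v @ L3) @ R3 @ w @ L1)"
        by (rule gauss_word_permute[OF g]) (simp add: Order123 union_ac)
      thus "unseen (R1 @ u @ L2) (R2 @ v @ L3) (R3 @ w @ L1) [a, b, c]"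
        using fresh abc(1) by (auto simp: unseen_def Order123)
    qed
  next
    case Order132
    show ?thesis
    proof (rule that[of "R1 @ u @ L3" "R3 @ v @ L2" "R2 @ w @ L1"])
      show "dgm (place cyc u v w (L1 @ I1 @ R1) (L2 @ I2 @ R2) (L3 @ I3 @ R3)) \<mu> =
          dgm (place cyc (R1 @ u @ L3) (R3 @ v @ L2) (R2 @ w @ L1) I1 I2 I3) \<mu>"
        if "gauss_word (place cyc (R1 @ u @ L3) (R3 @ v @ L2) (R2 @ w @ L1) I1 I2 I3)" for I1 I2 I3
        using dgm_append_commute[of "I1 @ R1 @ u @ L3 @ I3 @ R3 @ v @ L2 @ I2 @ R2 @ w" L1 \<mu>] that
        by (simp add: Order132)
      have "gauss_word ((R1 @ u @ L3) @ (R3 @ v @ L2) @ R2 @ w @ L1)"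
        by (rule gauss_word_permute[OF g]) (simp add: Order132 union_ac)
      thus "unseen (R1 @ u @ L3) (R3 @ v @ L2) (R2 @ w @ L1) [a, b, c]"
        using fresh abc(1) by (auto simp: unseen_def Order132)
    qed
  qed
  have gauss: "gauss_word (place cyc u' v' w' I1 I2 I3)"
    if "gauss_word (I1 @ I2 @ I3)" "arrows (I1 @ I2 @ I3) \<subseteq> {a, b, c}" for I1 I2 I3
    using gauss_word_placeI[OF unseen'] that by simp
  have X': "X I1 I2 I3 = f (dgm (place cyc u' v' w' I1 I2 I3) \<mu>)"
    if "gauss_word (I1 @ I2 @ I3)" "arrows (I1 @ I2 @ I3) \<subseteq> {a, b, c}" for I1 I2 I3
    unfolding X_def Z using place' gauss[OF that] by simp
  have "six_term f cyc u' v' w' a b c \<mu> = 0"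
    using f unseen' tri unfolding vanishes_on_6T_def by blast
  thus ?thesis
    unfolding X_def[symmetric] using abc(1) by (simp add: X' gauss_word_mate six_term_def)
qed

text \<open>
  Since words are read cyclically, it does not matter whether the tails or the heads come first.
\<close>

lemma AP2_word:
  assumes f: "vanishes_on_AP2 f" and ab: "a \<noteq> b" "\<mu> a = \<mu> b"
    and T: "T \<in> {[Tail a, Tail b], [Tail b, Tail a]}" and H: "H \<in> {[Head a, Head b], [Head b, Head a]}"
    and y: "y = p @ T @ q @ H @ r \<or> y = p @ H @ q @ T @ r" and g: "gauss_word y"
  shows "f (dgm y \<mu>) = 0"
proof -
  have first: "f (dgm (T @ q @ H @ r) \<mu>) = 0" if "gauss_word (T @ q @ H @ r)" for q r
  proof -
    obtain x x' where "T = [Tail x, Tail x']" "x \<noteq> x'" "\<mu> x = \<mu> x'"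
      "H = [Head x, Head x'] \<or> H = [Head x', Head x]"
      using T H ab by auto
    thus ?thesis using f that unfolding vanishes_on_AP2_def by blast
  qed
  from y show ?thesis
  proof
    assume y: "y = p @ T @ q @ H @ r"
    have "gauss_word (T @ q @ H @ r @ p)" by (rule gauss_word_permute[OF g]) (simp add: y union_ac)
    thus ?thesis using dgm_append_commute[of p "T @ q @ H @ r" \<mu>] first[of q "r @ p"] g y by simp
  next
    assume y: "y = p @ H @ q @ T @ r"
    have "gauss_word (T @ (r @ p) @ H @ q)" by (rule gauss_word_permute[OF g]) (simp add: y union_ac)
    thus ?thesis using dgm_append_commute[of "p @ H @ q" "T @ r" \<mu>] first[of "r @ p" q] g y by simp
  qed
qed

text \<open>
  A form of ``contains \<open>x\<close> and \<open>y\<close> next to each other'' that is decided by rewriting on the short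
  explicit words placed on the intervals.
\<close>

fun adjacent :: "'a \<Rightarrow> 'a \<Rightarrow> 'a list \<Rightarrow> bool" where
  "adjacent x y (e # e' # w) \<longleftrightarrow> e = x \<and> e' = y \<or> e = y \<and> e' = x \<or> adjacent x y (e' # w)"
| "adjacent x y w \<longleftrightarrow> False"

lemma adjacentE:
  assumes "adjacent x y w"
  obtains p q where "w = p @ [x, y] @ q" | p q where "w = p @ [y, x] @ q"
proof -
  have "adjacent x y w \<Longrightarrow> \<exists>p q. w = p @ [x, y] @ q \<or> w = p @ [y, x] @ q"
  proof (induction x y w rule: adjacent.induct)
    case (1 x y e e' w)
    show ?case
    proof (cases "adjacent x y (e' # w)")
      case True
      then obtain p q where "e' # w = p @ [x, y] @ q \<or> e' # w = p @ [y, x] @ q" using 1 by blast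
      thus ?thesis by (metis append_Cons)
    next
      case False
      with 1 have "e # e' # w = [] @ [x, y] @ w \<or> e # e' # w = [] @ [y, x] @ w" by auto
      thus ?thesis by blast
    qed
  qed auto
  thus ?thesis using assms that by blast
qed

lemma AP2_place:
  assumes f: "vanishes_on_AP2 f" and unseen: "unseen u v w ls"
    and ab: "a \<noteq> b" "\<mu> a = \<mu> b"
    and I: "gauss_word (I1 @ I2 @ I3)" "arrows (I1 @ I2 @ I3) \<subseteq> set ls"
    and adj: "adjacent (Tail a) (Tail b) I1 \<and> (adjacent (Head a) (Head b) I2 \<or> adjacent (Head a) (Head b) I3) \<or>
      adjacent (Tail a) (Tail b) I2 \<and> adjacent (Head a) (Head b) I3"
  shows "f (dgm (place cyc u v w I1 I2 I3) \<mu>) = 0"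
proof -
  define y where "y = place cyc u v w I1 I2 I3"
  have g: "gauss_word y" unfolding y_def by (rule gauss_word_placeI[OF unseen I])
  note main = AP2_word[OF f ab _ _ _ g]
  have split: "\<exists>p q T. I = p @ T @ q \<and> T \<in> {[x, y], [y, x]}" if "adjacent x y I" for x y :: "nat endpoint" and I
    using that by (elim adjacentE) blast+
  consider p T q p' H q' where "I1 = p @ T @ q" "I2 = p' @ H @ q'"
      "T \<in> {[Tail a, Tail b], [Tail b, Tail a]}" "H \<in> {[Head a, Head b], [Head b, Head a]}"
    | p T q p' H q' where "I1 = p @ T @ q" "I3 = p' @ H @ q'"
      "T \<in> {[Tail a, Tail b], [Tail b, Tail a]}" "H \<in> {[Head a, Head b], [Head b, Head a]}"
    | p T q p' H q' where "I2 = p @ T @ q" "I3 = p' @ H @ q'"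
      "T \<in> {[Tail a, Tail b], [Tail b, Tail a]}" "H \<in> {[Head a, Head b], [Head b, Head a]}"
    using adj split by meson
  hence "f (dgm y \<mu>) = 0"
  proof cases
    case 1
    show ?thesis
      using 1 main[of T H "p" "q @ u @ p'" "q' @ v @ I3 @ w"] main[of T H "p" "q @ u @ I3 @ v @ p'" "q' @ w"]
      by (cases cyc) (simp_all add: y_def)
  next
    case 2
    show ?thesis
      using 2 main[of T H "p" "q @ u @ I2 @ v @ p'" "q' @ w"] main[of T H "p" "q @ u @ p'" "q' @ v @ I2 @ w"]
      by (cases cyc) (simp_all add: y_def)
  next
    case 3
    show ?thesis
      using 3 main[of T H "I1 @ u @ p" "q @ v @ p'" "q' @ w"] main[of T H "I1 @ u @ p'" "q' @ v @ p" "q @ w"]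
      by (cases cyc) (simp_all add: y_def)
  qed
  thus ?thesis by (simp add: y_def)
qed

text \<open>
  All three arrows \<open>a\<close>, \<open>b\<close>, \<open>c\<close> of a triangle are present; \<open>s1\<close>, \<open>s2\<close>, \<open>s3\<close> tell, as the upper signs of
  the terms of the six-term relator do, whether the two endpoints on the interval \<open>1\<close>, \<open>2\<close>, \<open>3\<close> are in
  the standard order. The sides of the move \<open>R\<^sub>3\<close> are \<open>(+, -, +)\<close> and \<open>(-, +, -)\<close>.
\<close>

definition three_arrows ::
  "(arrow_diagram \<Rightarrow> rat) \<Rightarrow> cyclic_order \<Rightarrow> word \<Rightarrow> word \<Rightarrow> word \<Rightarrow> nat \<Rightarrow> nat \<Rightarrow> nat \<Rightarrow> (nat \<Rightarrow> int) \<Rightarrow>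
   bool \<Rightarrow> bool \<Rightarrow> bool \<Rightarrow> rat"
where
  "three_arrows f cyc u v w a b c \<mu> s1 s2 s3 = f (dgm (place cyc u v w
     (if s1 then [Tail a, Tail b] else [Tail b, Tail a])
     (if s2 then [Head a, Tail c] else [Tail c, Head a])
     (if s3 then [Head b, Head c] else [Head c, Head b])) \<mu>)"

text \<open>
  Put an additional arrow \<open>d\<close> parallel to \<open>a\<close> into the six-term relation, with \<open>d\<close> in the role of the arrow
  \<open>1 \<rightarrow> 2\<close> and \<open>a\<close> unseen, on the sides of the intervals \<open>1\<close> and \<open>2\<close> prescribed by \<open>s1\<close> and \<open>s2\<close>. The
  term without \<open>d\<close> is the difference of the two values of \<open>three_arrows\<close> for the two orders on interval \<open>3\<close>.
  Each of the two other terms has one diagram in which \<open>a\<close> and \<open>d\<close> are parallel, which \<open>AP\<^sub>2\<close> kills,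
  and one that is also met, with the opposite sign and \<open>a\<close> and \<open>d\<close> exchanged, when \<open>(s1, s2)\<close> is
  replaced by \<open>(-s1, -s2)\<close>. Hence the two differences on interval \<open>3\<close> for \<open>(s1, s2)\<close> and
  \<open>(-s1, -s2)\<close> are opposite. The two lemmas after this one double \<open>c\<close> and \<open>b\<close> in the same way.
\<close>

lemma flip_doubling_12:
  assumes f: "vanishes_on_6T K f" "vanishes_on_AP2 f"
    and uv: "unseen u v w [a, b, c, d]" "triangle K cyc (\<mu> a) (\<mu> b) (\<mu> c)" "\<mu> d = \<mu> a"
    and Y: "Y = three_arrows f cyc u v w a b c \<mu>"
  shows "Y True False True - Y True False False = Y False True False - Y False True True"
proof -
  \<comment> \<open>Keeps linear arithmetic from trying all orderings of the four distinct labels.\<close>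
  note [[linarith_neq_limit = 1]]
  define Z where "Z I1 I2 I3 = f (dgm (place cyc u v w I1 I2 I3) \<mu>)" for I1 I2 I3
  have ne: "distinct [a, b, c, d]" "distinct [d, c, b, a]" using uv(1) by (auto simp: unseen_def)
  have tri: "triangle K cyc (\<mu> d) (\<mu> b) (\<mu> c)" using uv(2,3) by simp
  note AP2 = AP2_place[OF f(2) uv(1), of d a \<mu> _ _ _ cyc, folded Z_def]
  note swap = dgm_swap_labels[OF gauss_word_placeI[OF uv(1)] uv(1),
      of _ _ _ a d \<mu> cyc, THEN arg_cong[of _ _ f], folded Z_def]
  have "- Z [Tail a, Tail b, Tail d] [Head d, Head a] [Head b]
      + Z [Tail a, Tail d] [Head d, Tail c, Head a] [Head c]
      + Z [Tail a, Tail b] [Tail c, Head a] [Head b, Head c]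
      - Z [Tail a, Tail b] [Tail c, Head a] [Head c, Head b] = 0"
    using six_term_inside[OF f(1) uv(1) tri Z_def, of "[Tail a]" "[]" "[]" "[Head a]" "[]" "[]"] ne uv(3)
    by (simp add: gauss_word_mate AP2 algebra_simps)
  moreover have "Z [Tail d, Tail b, Tail a] [Head a, Head d] [Head b]
      - Z [Tail d, Tail a] [Head a, Tail c, Head d] [Head c]
      + Z [Tail b, Tail a] [Head a, Tail c] [Head b, Head c]
      - Z [Tail b, Tail a] [Head a, Tail c] [Head c, Head b] = 0"
    using six_term_inside[OF f(1) uv(1) tri Z_def, of "[]" "[Tail a]" "[Head a]" "[]" "[]" "[]"] ne uv(3)
    by (simp add: gauss_word_mate AP2 algebra_simps)
  moreover have "Z [Tail d, Tail b, Tail a] [Head a, Head d] [Head b]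
      = Z [Tail a, Tail b, Tail d] [Head d, Head a] [Head b]"
    using swap[of "[Tail a, Tail b, Tail d]" "[Head d, Head a]" "[Head b]"] ne uv(3)
    by (simp add: gauss_word_mate)
  moreover have "Z [Tail d, Tail a] [Head a, Tail c, Head d] [Head c]
      = Z [Tail a, Tail d] [Head d, Tail c, Head a] [Head c]"
    using swap[of "[Tail a, Tail d]" "[Head d, Tail c, Head a]" "[Head c]"] ne uv(3)
    by (simp add: gauss_word_mate)
  ultimately show ?thesis
    unfolding Y three_arrows_def if_True if_False Z_def[symmetric] by linarith
qed

lemma flip_doubling_23:
  assumes f: "vanishes_on_6T K f" "vanishes_on_AP2 f"
    and uv: "unseen u v w [a, b, c, d]" "triangle K cyc (\<mu> a) (\<mu> b) (\<mu> c)" "\<mu> d = \<mu> c"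
    and Y: "Y = three_arrows f cyc u v w a b c \<mu>"
  shows "Y True False False - Y False False False = Y False True True - Y True True True"
proof -
  note [[linarith_neq_limit = 1]]
  define Z where "Z I1 I2 I3 = f (dgm (place cyc u v w I1 I2 I3) \<mu>)" for I1 I2 I3
  have ne: "distinct [a, b, c, d]" "distinct [d, c, b, a]" using uv(1) by (auto simp: unseen_def)
  have tri: "triangle K cyc (\<mu> a) (\<mu> b) (\<mu> d)" using uv(2,3) by simp
  note AP2 = AP2_place[OF f(2) uv(1), of d c \<mu> _ _ _ cyc, folded Z_def]
  note swap = dgm_swap_labels[OF gauss_word_placeI[OF uv(1)] uv(1),
      of _ _ _ c d \<mu> cyc, THEN arg_cong[of _ _ f], folded Z_def]
  have "Z [Tail a, Tail b] [Tail c, Head a] [Head c, Head b]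
      - Z [Tail b, Tail a] [Tail c, Head a] [Head c, Head b]
      + Z [Tail a] [Tail c, Head a, Tail d] [Head c, Head d]
      + Z [Tail b] [Tail c, Tail d] [Head c, Head b, Head d] = 0"
    using six_term_inside[OF f(1) uv(1) tri Z_def, of "[]" "[]" "[Tail c]" "[]" "[Head c]" "[]"] ne uv(3)
    by (simp add: gauss_word_mate AP2 algebra_simps)
  moreover have "Z [Tail a, Tail b] [Head a, Tail c] [Head b, Head c]
      - Z [Tail b, Tail a] [Head a, Tail c] [Head b, Head c]
      - Z [Tail a] [Tail d, Head a, Tail c] [Head d, Head c]
      - Z [Tail b] [Tail d, Tail c] [Head d, Head b, Head c] = 0"
    using six_term_inside[OF f(1) uv(1) tri Z_def, of "[]" "[]" "[]" "[Tail c]" "[]" "[Head c]"] ne uv(3)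
    by (simp add: gauss_word_mate AP2 algebra_simps)
  moreover have "Z [Tail a] [Tail d, Head a, Tail c] [Head d, Head c]
      = Z [Tail a] [Tail c, Head a, Tail d] [Head c, Head d]"
    using swap[of "[Tail a]" "[Tail c, Head a, Tail d]" "[Head c, Head d]"] ne uv(3)
    by (simp add: gauss_word_mate)
  moreover have "Z [Tail b] [Tail d, Tail c] [Head d, Head b, Head c]
      = Z [Tail b] [Tail c, Tail d] [Head c, Head b, Head d]"
    using swap[of "[Tail b]" "[Tail c, Tail d]" "[Head c, Head b, Head d]"] ne uv(3)
    by (simp add: gauss_word_mate)
  ultimately show ?thesis
    unfolding Y three_arrows_def if_True if_False Z_def[symmetric] by linarith
qed

lemma flip_doubling_13:
  assumes f: "vanishes_on_6T K f" "vanishes_on_AP2 f"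
    and uv: "unseen u v w [a, b, c, d]" "triangle K cyc (\<mu> a) (\<mu> b) (\<mu> c)" "\<mu> d = \<mu> b"
    and Y: "Y = three_arrows f cyc u v w a b c \<mu>"
  shows "Y False True False - Y False False False = Y True False True - Y True True True"
proof -
  note [[linarith_neq_limit = 1]]
  define Z where "Z I1 I2 I3 = f (dgm (place cyc u v w I1 I2 I3) \<mu>)" for I1 I2 I3
  have ne: "distinct [a, b, c, d]" "distinct [d, c, b, a]" using uv(1) by (auto simp: unseen_def)
  have tri: "triangle K cyc (\<mu> a) (\<mu> d) (\<mu> c)" using uv(2,3) by simp
  note AP2 = AP2_place[OF f(2) uv(1), of d b \<mu> _ _ _ cyc, folded Z_def]
  note swap = dgm_swap_labels[OF gauss_word_placeI[OF uv(1)] uv(1),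
      of _ _ _ b d \<mu> cyc, THEN arg_cong[of _ _ f], folded Z_def]
  have "Z [Tail b, Tail a, Tail d] [Head a] [Head d, Head b]
      + Z [Tail b, Tail a] [Head a, Tail c] [Head c, Head b]
      - Z [Tail b, Tail a] [Tail c, Head a] [Head c, Head b]
      + Z [Tail b, Tail d] [Tail c] [Head d, Head c, Head b] = 0"
    using six_term_inside[OF f(1) uv(1) tri Z_def, of "[Tail b]" "[]" "[]" "[]" "[]" "[Head b]"] ne uv(3)
    by (simp add: gauss_word_mate AP2 algebra_simps)
  moreover have "- Z [Tail d, Tail a, Tail b] [Head a] [Head b, Head d]
      + Z [Tail a, Tail b] [Head a, Tail c] [Head b, Head c]
      - Z [Tail a, Tail b] [Tail c, Head a] [Head b, Head c]
      - Z [Tail d, Tail b] [Tail c] [Head b, Head c, Head d] = 0"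
    using six_term_inside[OF f(1) uv(1) tri Z_def, of "[]" "[Tail b]" "[]" "[]" "[Head b]" "[]"] ne uv(3)
    by (simp add: gauss_word_mate AP2 algebra_simps)
  moreover have "Z [Tail d, Tail a, Tail b] [Head a] [Head b, Head d]
      = Z [Tail b, Tail a, Tail d] [Head a] [Head d, Head b]"
    using swap[of "[Tail b, Tail a, Tail d]" "[Head a]" "[Head d, Head b]"] ne uv(3)
    by (simp add: gauss_word_mate)
  moreover have "Z [Tail d, Tail b] [Tail c] [Head b, Head c, Head d]
      = Z [Tail b, Tail d] [Tail c] [Head d, Head c, Head b]"
    using swap[of "[Tail b, Tail d]" "[Tail c]" "[Head d, Head c, Head b]"] ne uv(3)
    by (simp add: gauss_word_mate)
  ultimately show ?thesis
    unfolding Y three_arrows_def if_True if_False Z_def[symmetric] by linarith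
qed

text \<open>
  Write \<open>Y(s)\<close> for the value of \<open>three_arrows\<close> and let \<open>Z(s) = Y(s) - Y(-s)\<close>. The preceding lemmas say that \<open>Z\<close> is unchanged along the path
  \<open>(+, -, +)\<close>, \<open>(+, -, -)\<close>, \<open>(-, -, -)\<close>, \<open>(-, +, -)\<close>, which flips one interval at a time. It ends at the
  negative of its starting point, where \<open>Z\<close> has the opposite value; so \<open>Z\<close> is zero there.
\<close>

lemma triple_point_sides_agree:
  assumes f: "vanishes_on_6T K f" "vanishes_on_AP2 f"
    and uv: "unseen u v w [a, b, c]" "triangle K cyc (\<mu> a) (\<mu> b) (\<mu> c)"
  shows "three_arrows f cyc u v w a b c \<mu> True False True = three_arrows f cyc u v w a b c \<mu> False True False"
proof -
  obtain d where d: "d \<notin> set [a, b, c] \<union> arrows (u @ v @ w)"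
    using ex_new_if_finite[OF infinite_UNIV_nat] finite_UnI[OF finite_set finite_arrows] by metis
  hence uvd: "unseen u v w [a, b, c, d]" using uv(1) by (auto simp: unseen_def)
  \<comment> \<open>The doubling arrow receives the marking of the doubled one, which does not affect \<open>Y\<close>.\<close>
  define Y where "Y x = three_arrows f cyc u v w a b c (\<mu>(d := \<mu> x))" for x
  have same: "Y x = three_arrows f cyc u v w a b c \<mu>" for x
  proof (intro ext)
    fix s1 s2 s3
    let ?y = "place cyc u v w (if s1 then [Tail a, Tail b] else [Tail b, Tail a])
     (if s2 then [Head a, Tail c] else [Tail c, Head a]) (if s3 then [Head b, Head c] else [Head c, Head b])"
    have "gauss_word ?y"
      by (rule gauss_word_placeI[OF uv(1)]) (use uv(1) in \<open>auto simp: gauss_word_mate unseen_def\<close>)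
    moreover have "d \<notin> arrows ?y" using d by (auto simp: arrows_place)
    ultimately show "Y x s1 s2 s3 = three_arrows f cyc u v w a b c \<mu> s1 s2 s3"
      unfolding Y_def three_arrows_def by (intro arg_cong[of _ _ f] dgm_cong) auto
  qed
  have ne: "d \<noteq> a" "d \<noteq> b" "d \<noteq> c" using d by auto
  show ?thesis
    using flip_doubling_12[where \<mu> = "\<mu>(d := \<mu> a)", OF f uvd _ _ Y_def]
      flip_doubling_23[where \<mu> = "\<mu>(d := \<mu> c)", OF f uvd _ _ Y_def]
      flip_doubling_13[where \<mu> = "\<mu>(d := \<mu> b)", OF f uvd _ _ Y_def] uv(2) ne
    by (simp add: same)
qed

section \<open>Invariance under Reidemeister moves\<close>

definition subdiagram_sum :: "(arrow_diagram \<Rightarrow> rat) \<Rightarrow> word \<Rightarrow> (nat \<Rightarrow> sign \<times> int) \<Rightarrow> rat" where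
  "subdiagram_sum f w \<delta> =
     (\<Sum>T\<in>Pow (arrows w). sgn_prod T \<delta> * f (dgm (restrict_word T w) (snd \<circ> \<delta>)))"

lemma pairing_eq_subdiagram_sum:
  "gauss_word w \<Longrightarrow> pairing (S_map A) (I_map (gen (dgm w \<delta>)))
     = subdiagram_sum (\<lambda>D. pairing A (gen D)) w \<delta>"
  by (simp add: pairing_S_map_I_map subdiagram_sum_def restrict_word_def)

lemma sum_Pow_insert:
  fixes h :: "'a set \<Rightarrow> 'b :: comm_monoid_add"
  assumes "finite S" "a \<notin> S"
  shows "sum h (Pow (insert a S)) = (\<Sum>T\<in>Pow S. h T + h (insert a T))"
proof -
  have "inj_on (insert a) (Pow S)" using assms(2) by (auto simp: inj_on_def)
  moreover have "Pow S \<inter> insert a ` Pow S = {}" using assms(2) by auto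
  ultimately show ?thesis
    using assms(1) by (simp add: Pow_insert sum.union_disjoint sum.reindex sum.distrib)
qed

lemma sgn_prod_insert:
  "finite T \<Longrightarrow> a \<notin> T \<Longrightarrow> sgn_prod (insert a T) \<delta> = sign_value (fst (\<delta> a)) * sgn_prod T \<delta>"
  by (simp add: sgn_prod_def)

lemma gauss_word_appendD:
  assumes "gauss_word (x @ y)" "gauss_word x"
  shows "gauss_word y" "arrows x \<inter> arrows y = {}"
proof -
  have disj: "e \<notin> set y" if "e \<in> set x" for e
    using assms(1) that by (auto simp: gauss_word_mate)
  show "gauss_word y"
    unfolding gauss_word_mate
  proof (intro conjI ballI)
    show "distinct y" using assms(1) by (simp add: gauss_word_mate)
    fix e assume e: "e \<in> set y"
    hence "mate e \<in> set x \<or> mate e \<in> set y" using assms(1) by (simp add: gauss_word_mate)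
    moreover have "mate (mate e) = e" by (cases e) auto
    hence "mate e \<notin> set x" using assms(2) disj[of e] e by (auto simp: gauss_word_mate)
    ultimately show "mate e \<in> set y" by blast
  qed
  have "arrow e' \<noteq> arrow e" if "e \<in> set x" "e' \<in> set y" for e e'
  proof
    assume "arrow e' = arrow e"
    hence "e' = e \<or> e' = mate e" by (cases e; cases e') auto
    thus False using that disj assms(2) by (auto simp: gauss_word_mate)
  qed
  thus "arrows x \<inter> arrows y = {}" unfolding arrows_def by fastforce
qed

text \<open>
  The subdiagrams that contain the new arrow \<open>a\<close> contribute nothing, the others are those of \<open>w\<close>.
\<close>

lemma subdiagram_sum_R1:
  assumes g: "gauss_word (x @ w)" and x: "x = [Head a, Tail a] \<or> x = [Tail a, Head a]"
    and zero: "\<And>T. gauss_word (x @ restrict_word T w) \<Longrightarrow> f (dgm (x @ restrict_word T w) (snd \<circ> \<delta>)) = 0"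
  shows "subdiagram_sum f (x @ w) \<delta> = subdiagram_sum f w \<delta>"
proof -
  have gx: "gauss_word x" using x by (auto simp: gauss_word_mate)
  have a: "a \<notin> arrows w" using gauss_word_appendD(2)[OF g gx] x by auto
  have "f (dgm (restrict_word (insert a T) (x @ w)) (snd \<circ> \<delta>)) = 0" for T
  proof -
    have eq: "restrict_word (insert a T) (x @ w) = x @ restrict_word T w"
      using x restrict_word_insert[OF a] by auto
    have "gauss_word (x @ restrict_word T w)"
      using gauss_word_restrict[OF g, of "insert a T"] unfolding eq .
    thus ?thesis unfolding eq by (rule zero)
  qed
  moreover have "restrict_word T (x @ w) = restrict_word T w" if "T \<subseteq> arrows w" for T
    using that a x by auto
  moreover have "arrows (x @ w) = insert a (arrows w)" using x by auto
  ultimately show ?thesis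
    using a by (simp add: subdiagram_sum_def sum_Pow_insert del: restrict_word_simps arrows_simps)
qed

text \<open>
  The subdiagrams that contain exactly one of the new arrows cancel in pairs, as these arrows have
  opposite signs and become indistinguishable once the other one is deleted; those that contain both
  are \<open>AP\<^sub>2\<close> diagrams.
\<close>

lemma subdiagram_sum_R2:
  assumes g: "gauss_word ([Tail a, Tail b] @ u @ H @ v)" and ab: "a \<noteq> b"
    and H: "H = [Head a, Head b] \<or> H = [Head b, Head a]"
    and \<delta>: "fst (\<delta> b) = opposite (fst (\<delta> a))" "snd (\<delta> a) = snd (\<delta> b)"
    and f: "vanishes_on_AP2 f"
  shows "subdiagram_sum f ([Tail a, Tail b] @ u @ H @ v) \<delta> = subdiagram_sum f (u @ v) \<delta>" (is "subdiagram_sum f ?w \<delta> = _")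
    and "gauss_word (u @ v)"
proof -
  let ?\<mu> = "snd \<circ> \<delta>"
  have "gauss_word (([Tail a, Tail b] @ H) @ (u @ v))"
    by (rule gauss_word_permute[OF g]) (simp add: union_ac)
  moreover have "gauss_word ([Tail a, Tail b] @ H)" using H ab by (auto simp: gauss_word_mate)
  ultimately have uv: "gauss_word (u @ v)" and disj: "arrows ([Tail a, Tail b] @ H) \<inter> arrows (u @ v) = {}"
    by (rule gauss_word_appendD)+
  show "gauss_word (u @ v)" by (rule uv)
  have unseen: "unseen u v [] [a, b]" using uv disj ab by (auto simp: unseen_def)
  have na: "a \<notin> arrows (u @ v)" "b \<notin> arrows (u @ v)" "a \<notin> insert b (arrows (u @ v))"
    using disj ab by auto
  have arrows_w: "arrows ?w = insert a (insert b (arrows (u @ v)))" using H by auto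
  have "sgn_prod T \<delta> * f (dgm (restrict_word T ?w) ?\<mu>)
      + sgn_prod (insert a T) \<delta> * f (dgm (restrict_word (insert a T) ?w) ?\<mu>)
      + (sgn_prod (insert b T) \<delta> * f (dgm (restrict_word (insert b T) ?w) ?\<mu>)
      + sgn_prod (insert a (insert b T)) \<delta> * f (dgm (restrict_word (insert a (insert b T)) ?w) ?\<mu>))
    = sgn_prod T \<delta> * f (dgm (restrict_word T (u @ v)) ?\<mu>)" if T: "T \<subseteq> arrows (u @ v)" for T
  proof -
    let ?u = "restrict_word T u" and ?v = "restrict_word T v"
    have nT: "a \<notin> T" "b \<notin> T" and fin: "finite T" using T na finite_subset[OF T] by auto
    have ins: "restrict_word (insert a X) u = restrict_word X u" "restrict_word (insert a X) v = restrict_word X v"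
      "restrict_word (insert b X) u = restrict_word X u" "restrict_word (insert b X) v = restrict_word X v" for X
      using na by (auto intro!: restrict_word_insert)
    have r0: "restrict_word T ?w = ?u @ ?v" using nT H by auto
    have r1: "restrict_word (insert a T) ?w = [Tail a] @ ?u @ [Head a] @ ?v"
      using nT H ab by (auto simp: ins)
    have r2: "restrict_word (insert b T) ?w = [Tail b] @ ?u @ [Head b] @ ?v"
      using nT H ab by (auto simp: ins)
    have r3: "restrict_word (insert a (insert b T)) ?w = [Tail a, Tail b] @ ?u @ H @ ?v"
      using nT H ab by (auto simp: ins)
    have "f (dgm ([Tail a, Tail b] @ ?u @ H @ ?v) ?\<mu>) = 0"
      using AP2_word[OF f ab, of ?\<mu> "[Tail a, Tail b]" H _ "[]" ?u ?v]
        gauss_word_restrict[OF g, of "insert a (insert b T)"] H \<delta>(2) unfolding r3 by simp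
    moreover have "dgm ([Tail b] @ ?u @ [Head b] @ ?v) ?\<mu> = dgm ([Tail a] @ ?u @ [Head a] @ ?v) ?\<mu>"
      using dgm_swap_labels[where cyc = Order123 and a = a and d = b and \<mu> = ?\<mu> and ?I1.0 = "[Tail a]"
          and ?I2.0 = "[Head a]" and ?I3.0 = "[]", OF _ unseen_restrict[OF unseen, of T]]
        gauss_word_restrict[OF g, of "insert a T"] \<delta>(2) ab unfolding r1 by simp
    moreover have "sign_value (fst (\<delta> b)) = - sign_value (fst (\<delta> a))"
      unfolding \<delta>(1) by (cases "fst (\<delta> a)") auto
    ultimately show ?thesis
      unfolding r0 r1 r2 r3 using nT fin by (simp add: sgn_prod_insert)
  qed
  thus "subdiagram_sum f ?w \<delta> = subdiagram_sum f (u @ v) \<delta>"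
    using na unfolding subdiagram_sum_def arrows_w
    by (simp add: sum_Pow_insert del: restrict_word_simps arrows_simps append.simps)
qed

text \<open>
  For a fixed set \<open>T\<close> of unseen arrows there are eight choices of visible ones. With at most one of them
  the two sides of the move coincide. The three choices of two arrows give the six-term combination,
  the products of signs being \<open>-1\<close>, \<open>1\<close>, \<open>-1\<close> as the orders on the three intervals require, and all
  three arrows together have sign \<open>-\<epsilon>\<close>.
\<close>

lemma subdiagram_sum_R3:
  assumes uv: "unseen u v w [a, b, c]"
    and \<epsilon>: "fst (\<delta> a) = \<epsilon>" "fst (\<delta> b) = opposite \<epsilon>" "fst (\<delta> c) = \<epsilon>"
    and Y: "\<And>T s1 s2 s3. Y T s1 s2 s3 = three_arrows f cyc (restrict_word T u) (restrict_word T v) (restrict_word T w)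
        a b c (snd \<circ> \<delta>) s1 s2 s3"
  shows "subdiagram_sum f (place cyc u v w [Tail b, Tail a] [Head a, Tail c] [Head c, Head b]) \<delta>
      - subdiagram_sum f (place cyc u v w [Tail a, Tail b] [Tail c, Head a] [Head b, Head c]) \<delta>
    = (\<Sum>T\<in>Pow (arrows (u @ v @ w)). sgn_prod T \<delta> *
        (six_term f cyc (restrict_word T u) (restrict_word T v) (restrict_word T w) a b c (snd \<circ> \<delta>)
         + sign_value \<epsilon> * (Y T True False True - Y T False True False)))"
    (is "subdiagram_sum f ?w' \<delta> - subdiagram_sum f ?w \<delta> = _")
proof -
  let ?\<mu> = "snd \<circ> \<delta>" and ?S = "arrows (u @ v @ w)"
  have abc: "a \<noteq> b" "a \<noteq> c" "b \<noteq> c" "b \<noteq> a" "c \<noteq> a" "c \<noteq> b" "a \<notin> ?S" "b \<notin> ?S" "c \<notin> ?S"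
    "a \<notin> insert b (insert c ?S)" "b \<notin> insert c ?S" using uv by (auto simp: unseen_def)
  have arr: "arrows ?w = insert a (insert b (insert c ?S))" "arrows ?w' = insert a (insert b (insert c ?S))"
    by (auto simp: arrows_place)
  define F where "F x T = sgn_prod T \<delta> * f (dgm (restrict_word T x) ?\<mu>)" for x T
  \<comment> \<open>The terms are grouped as repeated use of \<open>sum_Pow_insert\<close> produces them.\<close>
  define E where "E x T = F x T + F x (insert a T) + (F x (insert b T) + F x (insert a (insert b T)))
      + (F x (insert c T) + F x (insert a (insert c T))
        + (F x (insert b (insert c T)) + F x (insert a (insert b (insert c T)))))"
    for x T
  have expand: "subdiagram_sum f x \<delta> = (\<Sum>T\<in>Pow ?S. E x T)" if "x \<in> {?w, ?w'}" for x
  proof -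
    have "arrows x = insert a (insert b (insert c ?S))" using that arr by auto
    thus ?thesis
      unfolding subdiagram_sum_def F_def[symmetric] E_def
      using abc by (simp add: sum_Pow_insert del: arrows_simps)
  qed
  have "E ?w' T - E ?w T = sgn_prod T \<delta> *
      (six_term f cyc (restrict_word T u) (restrict_word T v) (restrict_word T w) a b c ?\<mu>
         + sign_value \<epsilon> * (Y T True False True - Y T False True False))" if T: "T \<subseteq> ?S" for T
  proof -
    have nT: "a \<notin> T" "b \<notin> T" "c \<notin> T" and fin: "finite T" using T abc finite_subset[OF T] by auto
    have ins: "restrict_word (insert e X) x = restrict_word X x" if "e \<in> {a, b, c}" "x \<in> {u, v, w}" for e X x
      using that abc by (intro restrict_word_insert) auto
    have sg: "sgn_prod (insert c T) \<delta> = sign_value \<epsilon> * sgn_prod T \<delta>"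
      "sgn_prod (insert b T) \<delta> = - sign_value \<epsilon> * sgn_prod T \<delta>"
      "sgn_prod (insert a T) \<delta> = sign_value \<epsilon> * sgn_prod T \<delta>"
      "sgn_prod (insert b (insert c T)) \<delta> = - sgn_prod T \<delta>"
      "sgn_prod (insert a (insert c T)) \<delta> = sgn_prod T \<delta>"
      "sgn_prod (insert a (insert b T)) \<delta> = - sgn_prod T \<delta>"
      "sgn_prod (insert a (insert b (insert c T))) \<delta> = - sign_value \<epsilon> * sgn_prod T \<delta>"
      using nT fin abc \<epsilon> by (cases \<epsilon>; simp add: sgn_prod_insert)+
    show ?thesis
      unfolding E_def F_def sg Y three_arrows_def six_term_def
      using nT abc by (simp add: ins algebra_simps)
  qed
  thus ?thesis unfolding expand[of ?w, simplified] expand[of ?w', simplified]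
    by (simp add: sum_subtractf[symmetric])
qed

lemma vanishes_on_6T_iff:
  "(\<forall>r\<in>A6T K. pairing A r = 0) \<longleftrightarrow> vanishes_on_6T K (\<lambda>D. pairing A (gen D))"
  unfolding A6T_def vanishes_on_6T_def pairing_relator_6T[symmetric] by blast

text \<open>
  Choose positive signs on all unseen arrows. Adding the identities obtained from \<open>R\<^sub>3\<close> moves with
  \<open>\<epsilon> = 1\<close> and \<open>\<epsilon> = -1\<close> removes the diagrams that contain all three arrows, and by induction all
  six-term combinations with fewer unseen arrows vanish.
\<close>

lemma formula_imp_6T:
  assumes formula: "arrow_diagram_formula K A"
  shows "vanishes_on_6T K (\<lambda>D. pairing A (gen D))" (is "vanishes_on_6T K ?f")
  unfolding vanishes_on_6T_def
proof (intro allI impI)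
  fix cyc u v w a b c and \<mu> :: "nat \<Rightarrow> int"
  assume uv: "unseen u v w [a, b, c]" and tri: "triangle K cyc (\<mu> a) (\<mu> b) (\<mu> c)"
  thus "six_term ?f cyc u v w a b c \<mu> = 0"
  proof (induction "card (arrows (u @ v @ w))" arbitrary: u v w rule: less_induct)
    case less
    let ?S = "arrows (u @ v @ w)"
    define six where "six T =
      six_term ?f cyc (restrict_word T u) (restrict_word T v) (restrict_word T w) a b c \<mu>" for T
    define Y where "Y T = three_arrows ?f cyc (restrict_word T u) (restrict_word T v) (restrict_word T w) a b c \<mu>" for T
    define \<delta> where "\<delta> \<epsilon> x = (if x = a \<or> x = c then \<epsilon> else if x = b then opposite \<epsilon> else Plus, \<mu> x)" for \<epsilon> x
    have \<delta>: "snd \<circ> \<delta> \<epsilon> = \<mu>" for \<epsilon> by (auto simp: \<delta>_def)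
    have abc: "a \<noteq> b" "b \<noteq> c" "a \<notin> ?S" "b \<notin> ?S" "c \<notin> ?S"
      using less.prems(1) by (auto simp: unseen_def)
    have sum0: "(\<Sum>T\<in>Pow ?S. six T + sign_value \<epsilon> * (Y T True False True - Y T False True False)) = 0" for \<epsilon>
    proof -
      let ?w = "place cyc u v w [Tail a, Tail b] [Tail c, Head a] [Head b, Head c]"
      let ?w' = "place cyc u v w [Tail b, Tail a] [Head a, Tail c] [Head c, Head b]"
      have g: "gauss_word ?w" "gauss_word ?w'"
        by (rule gauss_word_placeI[OF less.prems(1)]; use abc less.prems(1) in \<open>auto simp: gauss_word_mate unseen_def\<close>)+
      have \<epsilon>: "fst (\<delta> \<epsilon> a) = \<epsilon>" "fst (\<delta> \<epsilon> b) = opposite \<epsilon>" "fst (\<delta> \<epsilon> c) = \<epsilon>"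
        using abc by (auto simp: \<delta>_def)
      have "R3_move K (dgm ?w (\<delta> \<epsilon>)) (dgm ?w' (\<delta> \<epsilon>))"
        by (rule R3_move.intros[OF less.prems(1) _ \<epsilon>]) (use tri in \<open>simp add: \<delta>_def\<close>)
      hence "subdiagram_sum ?f ?w' (\<delta> \<epsilon>) - subdiagram_sum ?f ?w (\<delta> \<epsilon>) = 0"
        using formula g unfolding arrow_diagram_formula_def by (simp flip: pairing_eq_subdiagram_sum)
      hence "(\<Sum>T\<in>Pow ?S. sgn_prod T (\<delta> \<epsilon>) *
          (six T + sign_value \<epsilon> * (Y T True False True - Y T False True False))) = 0"
        using subdiagram_sum_R3[where \<delta> = "\<delta> \<epsilon>" and f = ?f and cyc = cyc, OF less.prems(1) \<epsilon>, of Y]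
        by (simp add: \<delta> six_def Y_def)
      moreover have "sgn_prod T (\<delta> \<epsilon>) = 1" if "T \<subseteq> ?S" for T
        unfolding sgn_prod_def by (rule prod.neutral) (use that abc in \<open>auto simp: \<delta>_def\<close>)
      ultimately show ?thesis by simp
    qed
    have "(\<Sum>T\<in>Pow ?S. six T) = 0"
      using sum0[of Plus] sum0[of Minus] by (simp add: sum.distrib sum_subtractf)
    moreover have "six T = 0" if "T \<in> Pow ?S - {?S}" for T
    proof -
      have "arrows (restrict_word T u @ restrict_word T v @ restrict_word T w) = T" using that by auto
      moreover have "card T < card ?S" using that by (intro psubset_card_mono) auto
      ultimately show ?thesis
        unfolding six_def using less.hyps unseen_restrict[OF less.prems(1)] tri by metis
    qed
    ultimately have "six ?S = 0" using sum.remove[of "Pow ?S" ?S six] by simp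
    moreover have "restrict_word ?S u = u" "restrict_word ?S v = v" "restrict_word ?S w = w"
      by (rule restrict_word_all; auto)+
    ultimately show ?case unfolding six_def by simp
  qed
qed

lemma AP_imp_vanishing:
  assumes "\<forall>r\<in>AP2. pairing A r = 0"
  shows "vanishes_on_AP2 (\<lambda>D. pairing A (gen D))"
  using assms unfolding AP2_def vanishes_on_AP2_def by blast

text \<open>
  The assumptions on \<open>AP\<^sub>1\<close> and \<open>AP\<^sub>2\<close> diagrams give invariance under \<open>R\<^sub>1\<close> and \<open>R\<^sub>2\<close>. For \<open>R\<^sub>3\<close>,
  those on \<open>AP\<^sub>2\<close> are used a second time, to compare the two sides with all three arrows present.
\<close>

lemma formula_if_6T:
  assumes AP1: "\<forall>r\<in>AP1 K. pairing A r = 0" and AP2: "\<forall>r\<in>AP2. pairing A r = 0"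
    and f: "vanishes_on_6T K (\<lambda>D. pairing A (gen D))" (is "vanishes_on_6T K ?f")
  shows "arrow_diagram_formula K A"
  unfolding arrow_diagram_formula_def
proof (intro allI impI, elim disjE)
  fix G G' assume "R1_move K G G'"
  thus "pairing (S_map A) (I_map (gen G)) = pairing (S_map A) (I_map (gen G'))"
  proof cases
    case (1 a w \<delta>)
    have "subdiagram_sum ?f ([Head a, Tail a] @ w) \<delta> = subdiagram_sum ?f w \<delta>"
    proof (rule subdiagram_sum_R1)
      fix T assume "gauss_word ([Head a, Tail a] @ restrict_word T w)"
      moreover have "(snd \<circ> \<delta>) a = 0" using 1 by simp
      ultimately show "pairing A (gen (dgm ([Head a, Tail a] @ restrict_word T w) (snd \<circ> \<delta>))) = 0"
        using AP1 unfolding AP1_def by fastforce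
    qed (use 1 in auto)
    moreover have "gauss_word w"
      using 1 gauss_word_appendD(1)[of "[Head a, Tail a]" w] by (simp add: gauss_word_mate)
    ultimately show ?thesis using 1 by (simp add: pairing_eq_subdiagram_sum)
  next
    case (2 a w \<delta>)
    have "subdiagram_sum ?f ([Tail a, Head a] @ w) \<delta> = subdiagram_sum ?f w \<delta>"
    proof (rule subdiagram_sum_R1)
      fix T assume "gauss_word ([Tail a, Head a] @ restrict_word T w)"
      moreover have "(snd \<circ> \<delta>) a = K" using 2 by simp
      ultimately show "pairing A (gen (dgm ([Tail a, Head a] @ restrict_word T w) (snd \<circ> \<delta>))) = 0"
        using AP1 unfolding AP1_def by fastforce
    qed (use 2 in auto)
    moreover have "gauss_word w"
      using 2 gauss_word_appendD(1)[of "[Tail a, Head a]" w] by (simp add: gauss_word_mate)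
    ultimately show ?thesis using 2 by (simp add: pairing_eq_subdiagram_sum)
  qed
next
  fix G G' assume "R2_move G G'"
  thus "pairing (S_map A) (I_map (gen G)) = pairing (S_map A) (I_map (gen G'))"
  proof cases
    case (1 a b u H v \<delta>)
    show ?thesis
      unfolding 1(1,2)
      using subdiagram_sum_R2[OF 1(3-7) AP_imp_vanishing[OF AP2]] 1(3) by (simp add: pairing_eq_subdiagram_sum)
  qed
next
  fix G G' assume "R3_move K G G'"
  thus "pairing (S_map A) (I_map (gen G)) = pairing (S_map A) (I_map (gen G'))"
  proof cases
    case (1 u v w a b c cyc \<delta> \<epsilon>)
    let ?w = "place cyc u v w [Tail a, Tail b] [Tail c, Head a] [Head b, Head c]"
    let ?w' = "place cyc u v w [Tail b, Tail a] [Head a, Tail c] [Head c, Head b]"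
    have g: "gauss_word ?w" "gauss_word ?w'"
      by (rule gauss_word_placeI[OF 1(3)]; use 1(3) in \<open>auto simp: gauss_word_mate unseen_def\<close>)+
    have tri: "triangle K cyc ((snd \<circ> \<delta>) a) ((snd \<circ> \<delta>) b) ((snd \<circ> \<delta>) c)" using 1(4) by simp
    have "six_term ?f cyc (restrict_word T u) (restrict_word T v) (restrict_word T w) a b c (snd \<circ> \<delta>) = 0" for T
      using f unseen_restrict[OF 1(3)] tri unfolding vanishes_on_6T_def by blast
    moreover have "three_arrows ?f cyc (restrict_word T u) (restrict_word T v) (restrict_word T w) a b c (snd \<circ> \<delta>)
        True False True = three_arrows ?f cyc (restrict_word T u) (restrict_word T v) (restrict_word T w) a b c
        (snd \<circ> \<delta>) False True False" for T
      by (rule triple_point_sides_agree[OF f AP_imp_vanishing[OF AP2] unseen_restrict[OF 1(3)] tri])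
    ultimately have "subdiagram_sum ?f ?w' \<delta> - subdiagram_sum ?f ?w \<delta> = 0"
      by (simp add: subdiagram_sum_R3[OF 1(3,5-7) refl])
    thus ?thesis unfolding 1(1,2) using g by (simp add: pairing_eq_subdiagram_sum)
  qed
qed

section \<open>Corners of diagrams\<close>

fun toggle :: "cyclic_order \<Rightarrow> cyclic_order" where
  "toggle Order123 = Order132"
| "toggle Order132 = Order123"

text \<open>
  The normal form of a nice based diagram: the base arc joins \<open>x\<close> (last letter) to \<open>y\<close> (first letter),
  and the other endpoints of these two arrows cut the rest of the circle into \<open>p\<close>, \<open>q\<close>, \<open>r\<close>. The
  cyclic order tells which of them comes first; equivalently, whether the arrows cross.
\<close>

fun corner :: "cyclic_order \<Rightarrow> word \<Rightarrow> word \<Rightarrow> word \<Rightarrow> nat endpoint \<Rightarrow> nat endpoint \<Rightarrow> word" where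
  "corner Order123 p q r x y = y # p @ mate x # q @ mate y # r @ [x]"
| "corner Order132 p q r x y = y # p @ mate y # q @ mate x # r @ [x]"

lemma toggle_neq [simp]: "toggle cyc \<noteq> cyc" "cyc \<noteq> toggle cyc"
  by (cases cyc; simp)+

lemma mate_simps [simp]: "mate (mate e) = e" "arrow (mate e) = arrow e" "mate e \<noteq> e" "e \<noteq> mate e"
  by (cases e; simp)+

lemma mate_inject [simp]: "mate e = mate e' \<longleftrightarrow> e = e'"
  by (metis mate_simps(1))

lemma swap_ends_corner: "swap_ends (corner cyc p q r x y) = corner (toggle cyc) p q r y x"
  using swap_ends_Cons_snoc[of y "p @ mate x # q @ mate y # r" x]
    swap_ends_Cons_snoc[of y "p @ mate y # q @ mate x # r" x]
  by (cases cyc) simp_all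

lemma mset_corner: "mset (corner cyc p q r x y) = mset ([x, mate x, y, mate y] @ p @ q @ r)"
  by (cases cyc) (simp_all add: union_ac)

lemma length_corner: "length (corner cyc p q r x y) = length p + length q + length r + 4"
  by (cases cyc) simp_all

lemma gauss_word_corner:
  assumes "unseen p q r [arrow x, arrow y]"
  shows "gauss_word (corner cyc p q r x y)"
proof (rule gauss_word_permute)
  have "gauss_word [x, mate x, y, mate y]" using assms by (auto simp: gauss_word_mate unseen_def)
  thus "gauss_word ([x, mate x, y, mate y] @ p @ q @ r)"
    using assms gauss_word_append_disjoint[of "p @ q @ r" "[x, mate x, y, mate y]"]
    by (simp add: unseen_def)
qed (simp add: mset_corner)

lemma nice_word_corner: "arrow x \<noteq> arrow y \<Longrightarrow> nice_word (corner cyc p q r x y)"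
  by (cases cyc) (auto simp: nice_word_def)

text \<open>
  Niceness makes the mates of the first and of the last letter lie strictly inside the word.
\<close>

lemma nice_word_is_corner:
  assumes w: "gauss_word w" "nice_word w"
  obtains cyc p q r x y where "w = corner cyc p q r x y" "unseen p q r [arrow x, arrow y]"
proof -
  obtain y w' where w': "w = y # w'" using w(2) by (cases w) (auto simp: nice_word_def)
  have "w' \<noteq> []" using w(2) by (auto simp: w' nice_word_def)
  then obtain m x where m: "w = y # m @ [x]" by (metis w' append_butlast_last_id)
  have xy: "arrow x \<noteq> arrow y" using w(2) by (simp add: m nice_word_def)
  have "mate x \<in> set w" "mate y \<in> set w" using w(1) by (auto simp: gauss_word_mate m)
  hence mem: "mate x \<in> set m" "mate y \<in> set m" using xy by (auto simp: m)
  have "\<exists>cyc p q r. w = corner cyc p q r x y"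
  proof -
    obtain s t where st: "m = s @ mate x # t" using split_list[OF mem(1)] by blast
    have "mate y \<noteq> mate x" using xy by (metis mate_simps(1))
    then consider "mate y \<in> set t" | "mate y \<in> set s" using mem(2) st by auto
    thus ?thesis
    proof cases
      case 1
      then obtain q r where "t = q @ mate y # r" using split_list by metis
      thus ?thesis using m st by (intro exI[of _ Order123] exI[of _ s] exI[of _ q] exI[of _ r]) simp
    next
      case 2
      then obtain p q where "s = p @ mate y # q" using split_list by metis
      thus ?thesis using m st by (intro exI[of _ Order132] exI[of _ p] exI[of _ q] exI[of _ t]) simp
    qed
  qed
  then obtain cyc p q r where c: "w = corner cyc p q r x y" by blast
  have "gauss_word ([x, mate x, y, mate y] @ (p @ q @ r))"
    by (rule gauss_word_permute[OF w(1)]) (simp add: c mset_corner)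
  moreover have "gauss_word [x, mate x, y, mate y]" using xy by (auto simp: gauss_word_mate)
  ultimately have "unseen p q r [arrow x, arrow y]"
    using gauss_word_appendD[of "[x, mate x, y, mate y]" "p @ q @ r"] xy by (auto simp: unseen_def)
  thus thesis using that c by blast
qed

text \<open>
  The factor \<open>\<eta>\<close> of \<open>\<epsilon>\<close>.
\<close>

definition corner_sign :: "cyclic_order \<Rightarrow> rat" where
  "corner_sign cyc = (if cyc = Order123 then 1 else - 1)"

lemma corner_sign_toggle [simp]: "corner_sign (toggle cyc) = - corner_sign cyc"
  by (cases cyc) (simp_all add: corner_sign_def)

lemma epsilon_corner:
  assumes "unseen p q r [arrow x, arrow y]"
  shows "epsilon (based (corner cyc p q r x y) \<mu>) =
    corner_sign cyc * (- 1) ^ (of_bool (is_head x) + of_bool (is_head y))"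
proof -
  have "filter (\<lambda>e. arrow e \<in> {arrow y, arrow x}) z = []" if "z \<in> {p, q, r}" for z
  proof -
    have "arrow x \<notin> arrows z" "arrow y \<notin> arrows z" using that assms by (auto simp: unseen_def)
    hence "arrow e \<noteq> arrow x \<and> arrow e \<noteq> arrow y" if "e \<in> set z" for e
      using that unfolding arrows_def by (metis imageI)
    thus ?thesis by (simp add: filter_empty_conv)
  qed
  hence "crosses (corner cyc p q r x y) (arrow y) (arrow x) \<longleftrightarrow> cyc = Order123"
    using assms by (cases cyc) (auto simp: crosses_def unseen_def)
  moreover have "corner cyc p q r x y \<noteq> []" "hd (corner cyc p q r x y) = y" "last (corner cyc p q r x y) = x"
    by (cases cyc; simp)+
  moreover have "epsilon (based w \<mu>) = epsilon_word w" if "gauss_word w" "w \<noteq> []" for w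
    using that unfolding based_def by (simp add: epsilon.abs_eq relabel_eq_refl)
  ultimately show ?thesis
    using gauss_word_corner[OF assms] by (simp add: epsilon_word_def corner_sign_def add.commute)
qed

lemma split_inject:
  assumes "distinct (a @ z # b)" "a @ z # b = a' @ z # b'"
  shows "a = a' \<and> b = b'"
  using assms by (metis append_Cons_eq_iff distinct.simps(2) distinct_append not_distinct_conv_prefix)

lemma corner_inject:
  assumes "distinct (corner cyc p q r x y)" "corner cyc p q r x y = corner cyc' p' q' r' x' y'"
  shows "cyc = cyc'" "p = p'" "q = q'" "r = r'" "x = x'" "y = y'"
proof -
  define m where "m c p q r = (if c = Order123 then p @ mate x # q @ mate y # r else p @ mate y # q @ mate x # r)" for c p q r
  have y: "y = y'" using assms(2) by (cases cyc; cases cyc') simp_all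
  have "last (corner c p q r x y) = x" for c p q r x y by (cases c) simp_all
  hence x: "x = x'" using assms(2) by metis
  have cm: "corner c p q r x y = y # m c p q r @ [x]" for c p q r by (cases c) (simp_all add: m_def)
  have eq: "m cyc p q r = m cyc' p' q' r'" and dist: "distinct (m cyc p q r)"
    using assms unfolding x[symmetric] y[symmetric] cm by simp_all
  have dist': "distinct (m cyc' p' q' r')" using eq dist by simp
  have *: "a = a'" "b = b'" if "a @ z # b = a' @ z # b'" "distinct (a @ z # b)" for a b a' b' and z :: "nat endpoint"
    using split_inject[OF that(2,1)] by simp_all
  have "cyc = cyc' \<and> p = p' \<and> q = q' \<and> r = r'"
  proof (cases cyc; cases cyc')
    assume c: "cyc = Order123" "cyc' = Order123"
    have e: "p @ mate x # (q @ mate y # r) = p' @ mate x # (q' @ mate y # r')" using eq c by (simp add: m_def)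
    have d: "distinct (p @ mate x # (q @ mate y # r))" using dist c by (simp add: m_def)
    from *[OF e d] have "p = p'" "q @ mate y # r = q' @ mate y # r'" by simp_all
    with *[of q "mate y" r q' r'] d c show ?thesis by simp
  next
    assume c: "cyc = Order132" "cyc' = Order132"
    have e: "p @ mate y # (q @ mate x # r) = p' @ mate y # (q' @ mate x # r')" using eq c by (simp add: m_def)
    have d: "distinct (p @ mate y # (q @ mate x # r))" using dist c by (simp add: m_def)
    from *[OF e d] have "p = p'" "q @ mate x # r = q' @ mate x # r'" by simp_all
    with *[of q "mate x" r q' r'] d c show ?thesis by simp
  next
    assume c: "cyc = Order123" "cyc' = Order132"
    have e: "p @ mate x # (q @ mate y # r) = (p' @ mate y # q') @ mate x # r'" using eq c by (simp add: m_def)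
    have d: "distinct (p @ mate x # (q @ mate y # r))" using dist c by (simp add: m_def)
    show ?thesis using d unfolding *(1)[OF e d] by simp
  next
    assume c: "cyc = Order132" "cyc' = Order123"
    have e: "p @ mate y # (q @ mate x # r) = (p' @ mate x # q') @ mate y # r'" using eq c by (simp add: m_def)
    have d: "distinct (p @ mate y # (q @ mate x # r))" using dist c by (simp add: m_def)
    show ?thesis using d unfolding *(1)[OF e d] by simp
  qed
  thus "cyc = cyc'" "p = p'" "q = q'" "r = r'" "x = x'" "y = y'" using x y by simp_all
qed

text \<open>
  The three arcs carry the same unseen arrows up to a common relabelling. Together with the cyclic
  order, the two types of endpoints at the base arc and the two markings, this determines a based
  diagram in corner form.
\<close>

definition arcs_eq ::
  "word \<Rightarrow> word \<Rightarrow> word \<Rightarrow> (nat \<Rightarrow> int) \<Rightarrow> word \<Rightarrow> word \<Rightarrow> word \<Rightarrow> (nat \<Rightarrow> int) \<Rightarrow> bool" where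
  "arcs_eq p q r \<mu> p' q' r' \<mu>' \<longleftrightarrow> (\<exists>f. inj_on f (arrows (p @ q @ r)) \<and>
     p' = map (map_endpoint f) p \<and> q' = map (map_endpoint f) q \<and> r' = map (map_endpoint f) r \<and>
     (\<forall>a\<in>arrows (p @ q @ r). \<mu>' (f a) = \<mu> a))"

lemma arcs_eq_rotate: "arcs_eq q r p \<mu> q' r' p' \<mu>' \<longleftrightarrow> arcs_eq p q r \<mu> p' q' r' \<mu>'"
  unfolding arcs_eq_def by (auto simp: Un_ac)

lemma map_corner:
  "map (map_endpoint f) (corner cyc p q r x y) =
     corner cyc (map (map_endpoint f) p) (map (map_endpoint f) q) (map (map_endpoint f) r)
       (map_endpoint f x) (map_endpoint f y)"
  by (cases cyc) simp_all

lemma arrows_corner: "arrows (corner cyc p q r x y) = {arrow x, arrow y} \<union> arrows (p @ q @ r)"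
  by (cases cyc) auto

lemma map_endpoint_eq_self_iff: "map_endpoint f e = e' \<longleftrightarrow> is_tail e = is_tail e' \<and> f (arrow e) = arrow e'"
  by (cases e; cases e') auto

lemma based_corner_eq_iff:
  assumes u: "unseen p q r [arrow x, arrow y]" and u': "unseen p' q' r' [arrow x', arrow y']"
  shows "based (corner cyc p q r x y) \<mu> = based (corner cyc' p' q' r' x' y') \<mu>' \<longleftrightarrow>
    cyc = cyc' \<and> is_tail x = is_tail x' \<and> is_tail y = is_tail y' \<and>
    \<mu> (arrow x) = \<mu>' (arrow x') \<and> \<mu> (arrow y) = \<mu>' (arrow y') \<and> arcs_eq p q r \<mu> p' q' r' \<mu>'"
    (is "?L \<longleftrightarrow> ?R")
proof
  note g = gauss_word_corner[OF u] gauss_word_corner[OF u']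
  assume ?L
  then obtain f where f: "inj_on f (arrows (corner cyc p q r x y))"
      "corner cyc' p' q' r' x' y' = map (map_endpoint f) (corner cyc p q r x y)"
      "\<forall>a\<in>arrows (corner cyc p q r x y). \<mu>' (f a) = \<mu> a"
    using g by (auto simp: based_eq_iff relabel_eq_def)
  have "distinct (corner cyc' p' q' r' x' y')" using g by (simp add: gauss_word_mate)
  note eq = corner_inject[OF this f(2)[unfolded map_corner]]
  have "arcs_eq p q r \<mu> p' q' r' \<mu>'"
    unfolding arcs_eq_def by (rule exI[of _ f]) (use f(1,3) eq in \<open>auto simp: arrows_corner intro: inj_on_subset\<close>)
  moreover have "is_tail x = is_tail x' \<and> f (arrow x) = arrow x'" "is_tail y = is_tail y' \<and> f (arrow y) = arrow y'"
    using eq(5,6) by (simp_all add: map_endpoint_eq_self_iff[symmetric])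
  ultimately show ?R using f(3) eq(1) by (auto simp: arrows_corner)
next
  assume R: ?R
  then obtain f where f: "inj_on f (arrows (p @ q @ r))"
     "p' = map (map_endpoint f) p" "q' = map (map_endpoint f) q" "r' = map (map_endpoint f) r"
     "\<forall>a\<in>arrows (p @ q @ r). \<mu>' (f a) = \<mu> a"
    unfolding arcs_eq_def by blast
  let ?f = "f(arrow x := arrow x', arrow y := arrow y')"
  have new: "arrow x \<notin> arrows (p @ q @ r)" "arrow y \<notin> arrows (p @ q @ r)" "arrow x \<noteq> arrow y"
    "arrow x' \<notin> arrows (p' @ q' @ r')" "arrow y' \<notin> arrows (p' @ q' @ r')" "arrow x' \<noteq> arrow y'"
    using u u' by (auto simp: unseen_def)
  have agree: "?f a = f a" if "a \<in> arrows (p @ q @ r)" for a using that new by auto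
  have "map (map_endpoint ?f) p = p'" "map (map_endpoint ?f) q = q'" "map (map_endpoint ?f) r = r'"
    unfolding f(2-4) map_endpoint_eq_iff by (intro ballI agree; simp)+
  moreover have "map_endpoint ?f x = x'" "map_endpoint ?f y = y'"
    using R new by (auto simp: map_endpoint_eq_self_iff)
  ultimately have "corner cyc' p' q' r' x' y' = map (map_endpoint ?f) (corner cyc p q r x y)"
    using R by (simp add: map_corner)
  moreover have "inj_on ?f (arrows (corner cyc p q r x y))"
  proof -
    have "?f ` arrows (p @ q @ r) = arrows (p' @ q' @ r')" using agree f(2-4) by (simp add: image_Un)
    moreover have "inj_on ?f (arrows (p @ q @ r))" using f(1) inj_on_cong[of "arrows (p @ q @ r)" ?f f, OF agree] by blast
    ultimately show ?thesis unfolding arrows_corner using new by (simp add: inj_on_insert)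
  qed
  moreover have "\<forall>a\<in>arrows (corner cyc p q r x y). \<mu>' (?f a) = \<mu> a"
    using R f(5) new agree unfolding arrows_corner by auto
  ultimately have "relabel_eq (corner cyc p q r x y, \<mu>) (corner cyc' p' q' r' x' y', \<mu>')"
    unfolding relabel_eq_def prod.case
    using gauss_word_corner[OF u, of cyc] gauss_word_corner[OF u', of cyc'] by (intro conjI exI[of _ ?f])
  thus ?L by (rule based_eqI)
qed

definition degenerate :: "cyclic_order \<Rightarrow> word \<Rightarrow> word \<Rightarrow> word \<Rightarrow> nat endpoint \<Rightarrow> nat endpoint \<Rightarrow> (nat \<Rightarrow> int) \<Rightarrow>
    degenerate_diagram" where
  "degenerate cyc p q r x y \<mu> = shrink (based (corner cyc p q r x y) \<mu>)"

lemma shrink_eq_iff: "shrink B = shrink B' \<longleftrightarrow> B' = B \<or> nice B \<and> B' = swap_base B"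
  by (simp add: shrink_def degenerate_diagram.abs_eq_iff shrink_eq_def)

text \<open>
  A degenerate diagram has exactly the two resolutions that differ by the order of \<open>x\<close> and \<open>y\<close>; in
  corner form, exchanging them toggles the cyclic order and keeps the arcs.
\<close>

lemma degenerate_eq_iff:
  assumes u: "unseen p q r [arrow x, arrow y]" and u': "unseen p' q' r' [arrow x', arrow y']"
  shows "degenerate cyc p q r x y \<mu> = degenerate cyc' p' q' r' x' y' \<mu>' \<longleftrightarrow>
    cyc = cyc' \<and> is_tail x = is_tail x' \<and> is_tail y = is_tail y' \<and>
      \<mu> (arrow x) = \<mu>' (arrow x') \<and> \<mu> (arrow y) = \<mu>' (arrow y') \<and> arcs_eq p q r \<mu> p' q' r' \<mu>' \<or>
    toggle cyc = cyc' \<and> is_tail x = is_tail y' \<and> is_tail y = is_tail x' \<and>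
      \<mu> (arrow x) = \<mu>' (arrow y') \<and> \<mu> (arrow y) = \<mu>' (arrow x') \<and> arcs_eq p q r \<mu> p' q' r' \<mu>'"
proof -
  have nice: "nice (based (corner cyc p q r x y) \<mu>)"
    using u nice_word_corner by (simp add: nice_based gauss_word_corner unseen_def)
  have "unseen p q r [arrow y, arrow x]" using u by (auto simp: unseen_def)
  note eqs = based_corner_eq_iff[OF u u'] based_corner_eq_iff[OF this u']
  have "swap_base (based (corner cyc p q r x y) \<mu>) = based (corner (toggle cyc) p q r y x) \<mu>"
    using gauss_word_corner[OF u] by (simp add: swap_base_based swap_ends_corner)
  thus ?thesis
    unfolding degenerate_def shrink_eq_iff using nice
    by (simp only: eq_commute[of "based (corner cyc' p' q' r' x' y') \<mu>'"] eqs) auto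
qed

section \<open>The coefficients of the differential\<close>

lemma lookup_basings:
  assumes "num_endpoints B > 0"
  shows "Poly_Mapping.lookup (basings D) B = (if D = abs_diagram B then of_nat (aut_order D) else 0)"
proof -
  have "\<exists>B0. D = abs_diagram B0" by (induct D rule: diagram.abs_induct) auto
  then obtain B0 where D: "D = abs_diagram B0" ..
  have "Poly_Mapping.lookup (basings D) B = of_nat (card {r. r < num_endpoints B0 \<and> rotate_based r B0 = B})"
    by (auto simp: D basings.abs_eq lookup_sum lookup_gen eq_commute[of B] sum.If_cases Int_def)
  also have "\<dots> = of_nat (if rotation_eq B0 B then aut_order (abs_diagram B) else 0)"
  proof (cases "num_endpoints B0 = 0")
    case True
    hence "\<not> rotation_eq B0 B" using assms by (auto simp: rotation_eq_def)
    thus ?thesis using True by simp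
  next
    case False
    thus ?thesis using card_rotations[of B0 B] by (simp add: max_def)
  qed
  also have "\<dots> = (if D = abs_diagram B then of_nat (aut_order D) else 0)"
  proof -
    have "rotation_eq B0 B \<longleftrightarrow> D = abs_diagram B" by (simp add: D diagram.abs_eq_iff)
    thus ?thesis by simp
  qed
  finally show ?thesis .
qed

text \<open>
  A based diagram occurs \<open>|Aut(D)|\<close> times in \<open>\<bullet>(D)\<close>, where \<open>D\<close> is the underlying diagram: this is the
  factor by which \<open>\<langle>,\<rangle>\<close> differs from the scalar product.
\<close>

lemma lookup_bullet:
  assumes "num_endpoints B > 0"
  shows "Poly_Mapping.lookup (bullet A) B = pairing A (gen (abs_diagram B))"
proof -
  have "Poly_Mapping.lookup (bullet A) B = (\<Sum>D\<in>Poly_Mapping.keys A.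
      if D = abs_diagram B then Poly_Mapping.lookup A (abs_diagram B) * of_nat (aut_order (abs_diagram B)) else 0)"
    unfolding bullet_def lookup_lin_ext lookup_basings[OF assms] by (rule sum.cong) auto
  also have "\<dots> = pairing A (gen (abs_diagram B))"
    by (simp add: pairing_gen in_keys_iff)
  finally show ?thesis .
qed

lemma lookup_d_map_not_nice: "\<not> nice B \<Longrightarrow> Poly_Mapping.lookup (d_map A) (shrink B) = 0"
  by (auto simp: d_map_def lookup_lin_ext d_based_def lookup_gen shrink_eq_iff intro!: sum.neutral)

text \<open>
  Both resolutions of a degenerate diagram contribute, with opposite signs, as exchanging the two
  endpoints changes the crossing of the two arrows and nothing else. For the same reason the two
  resolutions are never isomorphic.
\<close>

lemma lookup_d_map:
  assumes u: "unseen p q r [arrow x, arrow y]"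
  shows "Poly_Mapping.lookup (d_map A) (degenerate cyc p q r x y \<mu>) =
    corner_sign cyc * (- 1) ^ (of_bool (is_head x) + of_bool (is_head y)) *
      (pairing A (gen (dgm (corner cyc p q r x y) \<mu>)) - pairing A (gen (dgm (corner (toggle cyc) p q r y x) \<mu>)))"
proof -
  let ?B = "based (corner cyc p q r x y) \<mu>" and ?B' = "based (corner (toggle cyc) p q r y x) \<mu>"
  have u': "unseen p q r [arrow y, arrow x]" using u by (auto simp: unseen_def)
  have nice: "nice ?B" "nice ?B'" and swap: "swap_base ?B = ?B'"
    using u gauss_word_corner[OF u] gauss_word_corner[OF u']
    by (simp_all add: nice_based nice_word_corner swap_base_based swap_ends_corner unseen_def)
  have ne: "?B \<noteq> ?B'" using based_corner_eq_iff[OF u u'] by simp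
  have pos: "num_endpoints ?B > 0" "num_endpoints ?B' > 0"
    by (simp_all add: num_endpoints_based gauss_word_corner[OF u] gauss_word_corner[OF u'] length_corner)
  have sgn: "epsilon ?B' = - epsilon ?B"
    by (simp add: epsilon_corner[OF u] epsilon_corner[OF u'] add.commute)
  let ?g = "\<lambda>B. Poly_Mapping.lookup (bullet A) B * Poly_Mapping.lookup (d_based B) (shrink ?B)"
  have d: "Poly_Mapping.lookup (d_based B) (shrink ?B) = (if B \<in> {?B, ?B'} then epsilon B else 0)" for B
  proof -
    have "shrink ?B = shrink B \<longleftrightarrow> B \<in> {?B, ?B'}" using nice swap by (auto simp: shrink_eq_iff)
    thus ?thesis using nice by (auto simp: d_based_def lookup_gen)
  qed
  have "Poly_Mapping.lookup (d_map A) (shrink ?B) = sum ?g (Poly_Mapping.keys (bullet A))"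
    by (simp add: d_map_def lookup_lin_ext)
  also have "\<dots> = sum ?g (Poly_Mapping.keys (bullet A) \<union> {?B, ?B'})"
    by (rule sum.mono_neutral_left) (auto simp: in_keys_iff)
  also have "\<dots> = sum ?g {?B, ?B'}"
    by (rule sum.mono_neutral_right) (auto simp: d)
  also have "\<dots> = epsilon ?B * (pairing A (gen (abs_diagram ?B)) - pairing A (gen (abs_diagram ?B')))"
    using ne by (simp add: d lookup_bullet pos sgn algebra_simps)
  finally show ?thesis by (simp add: degenerate_def dgm_def epsilon_corner[OF u])
qed

section \<open>The three corners of a transitive triangle\<close>

lemma unseen_sub:
  assumes "unseen u v w ls" "distinct ls'" "set ls' \<subseteq> set ls"
  shows "unseen u v w ls'"
  using assms unfolding unseen_def by blast

lemma unseen_rotate: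
  assumes "unseen u v w ls"
  shows "unseen v w u ls"
proof -
  have "gauss_word (v @ w @ u)"
    by (rule gauss_word_permute[of "u @ v @ w"]) (use assms in \<open>auto simp: unseen_def union_ac\<close>)
  thus ?thesis using assms by (auto simp: unseen_def)
qed

text \<open>
  The arrows \<open>1 \<rightarrow> 2\<close>, \<open>1 \<rightarrow> 3\<close>, \<open>2 \<rightarrow> 3\<close> are \<open>a\<close>, \<open>b\<close>, \<open>c\<close>, with \<open>u\<close>, \<open>v\<close>, \<open>w\<close> as in \<open>place\<close>. At the corners
  \<open>2\<close> and \<open>3\<close> the arcs have to be listed starting from that corner, which rotates them in a way that
  depends on the cyclic order of \<open>1\<close>, \<open>2\<close>, \<open>3\<close>.
\<close>

definition source_corner ::
  "cyclic_order \<Rightarrow> word \<Rightarrow> word \<Rightarrow> word \<Rightarrow> nat \<Rightarrow> nat \<Rightarrow> (nat \<Rightarrow> int) \<Rightarrow> degenerate_diagram"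
where
  "source_corner cyc u v w a b \<mu> = degenerate cyc u v w (Tail a) (Tail b) \<mu>"

fun middle_corner ::
  "cyclic_order \<Rightarrow> word \<Rightarrow> word \<Rightarrow> word \<Rightarrow> nat \<Rightarrow> nat \<Rightarrow> (nat \<Rightarrow> int) \<Rightarrow> degenerate_diagram"
where
  "middle_corner Order123 u v w a c \<mu> = degenerate Order132 v w u (Head a) (Tail c) \<mu>"
| "middle_corner Order132 u v w a c \<mu> = degenerate Order123 w u v (Head a) (Tail c) \<mu>"

fun sink_corner ::
  "cyclic_order \<Rightarrow> word \<Rightarrow> word \<Rightarrow> word \<Rightarrow> nat \<Rightarrow> nat \<Rightarrow> (nat \<Rightarrow> int) \<Rightarrow> degenerate_diagram"
where
  "sink_corner Order123 u v w b c \<mu> = degenerate Order123 w u v (Head b) (Head c) \<mu>"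
| "sink_corner Order132 u v w b c \<mu> = degenerate Order132 v w u (Head b) (Head c) \<mu>"

definition corner_sum ::
  "(degenerate_diagram \<Rightarrow>\<^sub>0 rat) \<Rightarrow> cyclic_order \<Rightarrow> word \<Rightarrow> word \<Rightarrow> word \<Rightarrow> nat \<Rightarrow> nat \<Rightarrow> nat \<Rightarrow>
   (nat \<Rightarrow> int) \<Rightarrow> rat"
where
  "corner_sum y cyc u v w a b c \<mu> = Poly_Mapping.lookup y (source_corner cyc u v w a b \<mu>)
     + Poly_Mapping.lookup y (middle_corner cyc u v w a c \<mu>)
     + Poly_Mapping.lookup y (sink_corner cyc u v w b c \<mu>)"

lemma dgm_eq_rotated:
  "gauss_word z \<Longrightarrow> z = t @ s \<Longrightarrow> z' = s @ t \<Longrightarrow> dgm z \<delta> = dgm z' \<delta>"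
  using dgm_append_commute[of t s \<delta>] by simp

text \<open>
  The signs of the three corners agree: passing from one corner to the next changes the number of
  arrowheads at the degenerate point by one, and also changes whether the two arrows cross.
\<close>

lemma corner_sum_d_map:
  assumes u: "unseen u v w [a, b, c]"
  shows "corner_sum (d_map A) cyc u v w a b c \<mu> =
    corner_sign cyc * six_term (\<lambda>D. pairing A (gen D)) cyc u v w a b c \<mu>"
proof -
  have abc: "a \<noteq> b" "a \<noteq> c" "b \<noteq> c" using u by (auto simp: unseen_def)
  have s: "unseen p q r [x, y]" if "x \<noteq> y" "{x, y} \<subseteq> {a, b, c}" "(p, q, r) \<in> {(u, v, w), (v, w, u), (w, u, v)}"
    for x y p q r
    using that unseen_sub[OF u, of "[x, y]"] unseen_rotate by auto
  note rot = dgm_eq_rotated[OF gauss_word_corner]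
  show ?thesis
  proof (cases cyc)
    case Order123
    have "dgm (corner Order123 u v w (Tail a) (Tail b)) \<mu> = dgm (place cyc u v w [Tail a, Tail b] [Head a] [Head b]) \<mu>"
      by (rule rot[of _ _ _ _ _ _ _ "[Tail a]"]) (use abc s Order123 in auto)
    moreover have "dgm (corner Order132 u v w (Tail b) (Tail a)) \<mu> = dgm (place cyc u v w [Tail b, Tail a] [Head a] [Head b]) \<mu>"
      by (rule rot[of _ _ _ _ _ _ _ "[Tail b]"]) (use abc s Order123 in auto)
    moreover have "dgm (corner Order132 v w u (Head a) (Tail c)) \<mu> = dgm (place cyc u v w [Tail a] [Head a, Tail c] [Head c]) \<mu>"
      by (rule rot[of _ _ _ _ _ _ _ "Tail a # u @ [Head a]"]) (use abc s Order123 in auto)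
    moreover have "dgm (corner Order123 v w u (Tail c) (Head a)) \<mu> = dgm (place cyc u v w [Tail a] [Tail c, Head a] [Head c]) \<mu>"
      by (rule rot[of _ _ _ _ _ _ _ "Tail a # u @ [Tail c]"]) (use abc s Order123 in auto)
    moreover have "dgm (corner Order123 w u v (Head b) (Head c)) \<mu> = dgm (place cyc u v w [Tail b] [Tail c] [Head b, Head c]) \<mu>"
      by (rule rot[of _ _ _ _ _ _ _ "Tail b # u @ Tail c # v @ [Head b]"]) (use abc s Order123 in auto)
    moreover have "dgm (corner Order132 w u v (Head c) (Head b)) \<mu> = dgm (place cyc u v w [Tail b] [Tail c] [Head c, Head b]) \<mu>"
      by (rule rot[of _ _ _ _ _ _ _ "Tail b # u @ Tail c # v @ [Head c]"]) (use abc s Order123 in auto)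
    ultimately show ?thesis
      using abc s Order123 by (simp add: corner_sum_def source_corner_def lookup_d_map six_term_def corner_sign_def del: corner.simps place.simps)
  next
    case Order132
    have "dgm (corner Order132 u v w (Tail a) (Tail b)) \<mu> = dgm (place cyc u v w [Tail a, Tail b] [Head a] [Head b]) \<mu>"
      by (rule rot[of _ _ _ _ _ _ _ "[Tail a]"]) (use abc s Order132 in auto)
    moreover have "dgm (corner Order123 u v w (Tail b) (Tail a)) \<mu> = dgm (place cyc u v w [Tail b, Tail a] [Head a] [Head b]) \<mu>"
      by (rule rot[of _ _ _ _ _ _ _ "[Tail b]"]) (use abc s Order132 in auto)
    moreover have "dgm (corner Order123 w u v (Head a) (Tail c)) \<mu> = dgm (place cyc u v w [Tail a] [Head a, Tail c] [Head c]) \<mu>"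
      by (rule rot[of _ _ _ _ _ _ _ "Tail a # u @ Head c # v @ [Head a]"]) (use abc s Order132 in auto)
    moreover have "dgm (corner Order132 w u v (Tail c) (Head a)) \<mu> = dgm (place cyc u v w [Tail a] [Tail c, Head a] [Head c]) \<mu>"
      by (rule rot[of _ _ _ _ _ _ _ "Tail a # u @ Head c # v @ [Tail c]"]) (use abc s Order132 in auto)
    moreover have "dgm (corner Order132 v w u (Head b) (Head c)) \<mu> = dgm (place cyc u v w [Tail b] [Tail c] [Head b, Head c]) \<mu>"
      by (rule rot[of _ _ _ _ _ _ _ "Tail b # u @ [Head b]"]) (use abc s Order132 in auto)
    moreover have "dgm (corner Order123 v w u (Head c) (Head b)) \<mu> = dgm (place cyc u v w [Tail b] [Tail c] [Head c, Head b]) \<mu>"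
      by (rule rot[of _ _ _ _ _ _ _ "Tail b # u @ [Head c]"]) (use abc s Order132 in auto)
    ultimately show ?thesis
      using abc s Order132 by (simp add: corner_sum_def source_corner_def lookup_d_map six_term_def corner_sign_def del: corner.simps place.simps)
  qed
qed

section \<open>The triangle relations\<close>

text \<open>
  The triangle relations in terms of corners. In the first family \<open>P\<close> is the source \<open>1\<close> of the
  triangle, and the last term is the middle corner of the triangle with \<open>2\<close> and \<open>3\<close> exchanged. In the
  second one \<open>P\<close> is the sink \<open>3\<close>, and \<open>1\<close> and \<open>2\<close> are exchanged, which rotates the arcs. The arrow \<open>d\<close> is
  the reverse of \<open>c\<close>, respectively of \<open>a\<close>.
\<close>

definition source_relation ::
  "cyclic_order \<Rightarrow> word \<Rightarrow> word \<Rightarrow> word \<Rightarrow> nat \<Rightarrow> nat \<Rightarrow> nat \<Rightarrow> nat \<Rightarrow> (nat \<Rightarrow> int) \<Rightarrow> (degenerate_diagram \<Rightarrow>\<^sub>0 rat)"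
where
  "source_relation cyc u v w a b c d \<mu> = gen (source_corner cyc u v w a b \<mu>)
     - (gen (middle_corner cyc u v w a c \<mu>) + gen (middle_corner (toggle cyc) u v w b d \<mu>))"

fun sink_relation ::
  "cyclic_order \<Rightarrow> word \<Rightarrow> word \<Rightarrow> word \<Rightarrow> nat \<Rightarrow> nat \<Rightarrow> nat \<Rightarrow> nat \<Rightarrow> (nat \<Rightarrow> int) \<Rightarrow> (degenerate_diagram \<Rightarrow>\<^sub>0 rat)"
where
  "sink_relation Order123 u v w a b c d \<mu> = gen (sink_corner Order123 u v w b c \<mu>)
     - (gen (middle_corner Order123 u v w a c \<mu>) + gen (middle_corner Order132 v w u d b \<mu>))"
| "sink_relation Order132 u v w a b c d \<mu> = gen (sink_corner Order132 u v w b c \<mu>)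
     - (gen (middle_corner Order132 u v w a c \<mu>) + gen (middle_corner Order123 w u v d b \<mu>))"

lemma degen_append:
  assumes "e \<notin> set s"
  shows "degen e (s @ e # t) \<mu> = gen (shrink (based (e # t @ s) \<mu>))"
proof -
  have "dropWhile (\<lambda>x. x \<noteq> e) (s @ e # t) = e # t" "takeWhile (\<lambda>x. x \<noteq> e) (s @ e # t) = s"
    using assms by (induction s) auto
  thus ?thesis by (simp add: degen_def)
qed

text \<open>
  The three positions that the degenerate point can have in \<open>place\<close>, relative to the two other points.
\<close>

lemma degen_corner:
  assumes "unseen u v w ls" "{x, y} = {Tail a, Head b} \<or> {x, y} = {Tail a, Tail b} \<or> {x, y} = {Head a, Head b}"
    "{a, b} \<subseteq> set ls" "a \<noteq> b"
  shows "degen y (place cyc u v w [x, y] [mate x] [mate y]) \<mu> = gen (degenerate cyc u v w x y \<mu>)" (is ?A)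
    and "degen y (place cyc u v w [mate x] [x, y] [mate y]) \<mu> = gen (case cyc of
      Order123 \<Rightarrow> degenerate Order132 v w u x y \<mu> | Order132 \<Rightarrow> degenerate Order123 w u v x y \<mu>)" (is ?B)
    and "degen y (place cyc u v w [mate y] [mate x] [x, y]) \<mu> = gen (case cyc of
      Order123 \<Rightarrow> degenerate Order132 w u v x y \<mu> | Order132 \<Rightarrow> degenerate Order123 v w u x y \<mu>)" (is ?C)
proof -
  have xy: "y \<noteq> x" "y \<noteq> mate x" "arrow y \<in> {a, b}"
    using assms(2,4) by (auto simp: doubleton_eq_iff)
  have y: "y \<notin> set u" "y \<notin> set v" "y \<notin> set w"
    using assms(1,3) xy(3) unfolding unseen_def arrows_def by auto
  show ?A
    using degen_append[of y "[x]"] xy by (cases cyc) (simp_all add: degenerate_def)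
  show ?B
    using degen_append[of y "mate x # u @ [x]"] degen_append[of y "mate x # u @ mate y # v @ [x]"] xy y
    by (cases cyc) (simp_all add: degenerate_def)
  show ?C
    using degen_append[of y "mate y # u @ mate x # v @ [x]"] degen_append[of y "mate y # u @ [x]"] xy y
    by (cases cyc) (simp_all add: degenerate_def)
qed

lemma place_toggle: "place (toggle cyc) u v w I1 I2 I3 = place cyc u v w I1 I3 I2"
  by (cases cyc) auto

lemma source_relation_eq:
  assumes u: "unseen u v w [a, b, c, d]"
  shows "degen (Tail b) (place cyc u v w [Tail a, Tail b] [Head a] [Head b]) \<mu>
      - (degen (Tail c) (place cyc u v w [Tail a] [Head a, Tail c] [Head c]) \<mu>
       + degen (Tail d) (place cyc u v w [Tail b] [Head d] [Head b, Tail d]) \<mu>)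
    = source_relation cyc u v w a b c d \<mu>"
proof -
  have "a \<noteq> b" "c \<noteq> a" "d \<noteq> b" using u by (auto simp: unseen_def)
  thus ?thesis
    using degen_corner(1)[OF u, of "Tail a" "Tail b" a b cyc \<mu>]
      degen_corner(2)[OF u, of "Head a" "Tail c" c a cyc \<mu>]
      degen_corner(2)[OF u, of "Head b" "Tail d" d b "toggle cyc" \<mu>]
    by (cases cyc) (simp_all add: source_relation_def source_corner_def place_toggle insert_commute)
qed

lemma sink_relation_eq:
  assumes u: "unseen u v w [a, b, c, d]"
  shows "degen (Head b) (place cyc u v w [Head a, Head b] [Tail a] [Tail b]) \<mu>
      - (degen (Tail b) (place cyc u v w [Head b] [Tail c] [Head c, Tail b]) \<mu>
       + degen (Tail a) (place cyc u v w [Head a] [Head d, Tail a] [Tail d]) \<mu>)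
    = (case cyc of Order123 \<Rightarrow> sink_relation cyc v w u c a b d \<mu> | Order132 \<Rightarrow> sink_relation cyc w u v c a b d \<mu>)"
proof -
  have "a \<noteq> b" "b \<noteq> c" "a \<noteq> d" using u by (auto simp: unseen_def)
  thus ?thesis
    using degen_corner(1)[OF u, of "Head a" "Head b" a b cyc \<mu>]
      degen_corner(3)[OF u, of "Head c" "Tail b" b c cyc \<mu>]
      degen_corner(3)[OF u, of "Head d" "Tail a" a d "toggle cyc" \<mu>]
    by (cases cyc) (simp_all add: place_toggle insert_commute)
qed

lemma source_relation_in:
  assumes "unseen u v w [a, b, c, d]" "\<mu> c + \<mu> d = K" "triangle K cyc (\<mu> a) (\<mu> b) (\<mu> c)"
  shows "source_relation cyc u v w a b c d \<mu> \<in> triangle_relations K"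
  unfolding triangle_relations_def source_relation_eq[OF assms(1), symmetric] using assms by blast

lemma sink_relation_in:
  assumes u: "unseen u v w [a, b, c, d]" and "\<mu> a + \<mu> d = K" "triangle K cyc (\<mu> a) (\<mu> b) (\<mu> c)"
  shows "sink_relation cyc u v w a b c d \<mu> \<in> triangle_relations K"
proof -
  define p q r where "p = (if cyc = Order123 then w else v)" and "q = (if cyc = Order123 then u else w)"
    and "r = (if cyc = Order123 then v else u)"
  have "unseen p q r [a, b, c, d]" using u unseen_rotate by (auto simp: p_def q_def r_def)
  hence un: "unseen p q r [b, c, a, d]" by (rule unseen_sub) (use u in \<open>auto simp: unseen_def\<close>)
  have "sink_relation cyc u v w a b c d \<mu> = (case cyc of Order123 \<Rightarrow> sink_relation cyc q r p a b c d \<mu>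
      | Order132 \<Rightarrow> sink_relation cyc r p q a b c d \<mu>)"
    by (cases cyc) (simp_all add: p_def q_def r_def)
  also note sink_relation_eq[OF un, of cyc \<mu>, symmetric]
  finally show ?thesis unfolding triangle_relations_def using un assms(2,3) by blast
qed

lemma triangle_relation_cases:
  assumes "\<rho> \<in> triangle_relations K"
  obtains cyc u v w a b c d \<mu> where "\<rho> = source_relation cyc u v w a b c d \<mu>"
      "unseen u v w [a, b, c, d]" "\<mu> c + \<mu> d = K" "triangle K cyc (\<mu> a) (\<mu> b) (\<mu> c)"
    | cyc u v w a b c d \<mu> where "\<rho> = sink_relation cyc u v w a b c d \<mu>"
      "unseen u v w [a, b, c, d]" "\<mu> a + \<mu> d = K" "triangle K cyc (\<mu> a) (\<mu> b) (\<mu> c)"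
  using assms unfolding triangle_relations_def
proof (elim UnE)
  assume "\<rho> \<in> {degen (Tail b) (place cyc u v w [Tail a, Tail b] [Head a] [Head b]) \<mu>
      - (degen (Tail c) (place cyc u v w [Tail a] [Head a, Tail c] [Head c]) \<mu>
       + degen (Tail d) (place cyc u v w [Tail b] [Head d] [Head b, Tail d]) \<mu>)
      | cyc u v w a b c d \<mu>.
        unseen u v w [a, b, c, d] \<and> \<mu> c + \<mu> d = K \<and> triangle K cyc (\<mu> a) (\<mu> b) (\<mu> c)}"
  thus thesis using that(1) source_relation_eq by blast
next
  assume "\<rho> \<in> {degen (Head b) (place cyc u v w [Head a, Head b] [Tail a] [Tail b]) \<mu>
      - (degen (Tail b) (place cyc u v w [Head b] [Tail c] [Head c, Tail b]) \<mu>
       + degen (Tail a) (place cyc u v w [Head a] [Head d, Tail a] [Tail d]) \<mu>)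
      | cyc u v w a b c d \<mu>.
        unseen u v w [a, b, c, d] \<and> \<mu> c + \<mu> d = K \<and> triangle K cyc (\<mu> c) (\<mu> a) (\<mu> b)}"
  then obtain cyc u v w a b c d \<mu> where
    \<rho>: "\<rho> = (case cyc of Order123 \<Rightarrow> sink_relation cyc v w u c a b d \<mu> | Order132 \<Rightarrow> sink_relation cyc w u v c a b d \<mu>)"
    and u: "unseen u v w [a, b, c, d]" and *: "\<mu> c + \<mu> d = K" "triangle K cyc (\<mu> c) (\<mu> a) (\<mu> b)"
    using sink_relation_eq by blast
  have "unseen u v w [c, a, b, d]" by (rule unseen_sub[OF u]) (use u in \<open>auto simp: unseen_def\<close>)
  hence "unseen v w u [c, a, b, d]" "unseen w u v [c, a, b, d]" using unseen_rotate by blast+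
  thus thesis using that(2)[of cyc] \<rho> * by (cases cyc) auto
qed

text \<open>
  The leading term is the source corner of exactly two triangles, the one it is written for and the one
  with \<open>2\<close> and \<open>3\<close> exchanged, and the two other terms are the middle corners of these and of no
  other triangle. The triangle condition and \<open>\<mu> c + \<mu> d = K\<close> make the markings match.
\<close>

lemma corner_sum_source_relation:
  assumes s: "unseen u v w [a, b, c]" "triangle K cyc (\<mu> a) (\<mu> b) (\<mu> c)"
    and t: "unseen u' v' w' [a', b', c', d']" "\<mu>' c' + \<mu>' d' = K" "triangle K cyc' (\<mu>' a') (\<mu>' b') (\<mu>' c')"
  shows "corner_sum (source_relation cyc' u' v' w' a' b' c' d' \<mu>') cyc u v w a b c \<mu> = 0"
proof -
  have "a \<noteq> b" "a \<noteq> c" "b \<noteq> c" using s(1) by (auto simp: unseen_def)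
  hence un: "unseen u v w [a, b]" "unseen v w u [a, c]" "unseen w u v [a, c]" "unseen v w u [b, c]" "unseen w u v [b, c]"
    using unseen_sub[OF s(1)] unseen_rotate by simp_all
  have "a' \<noteq> b'" "a' \<noteq> c'" "b' \<noteq> d'" using t(1) by (auto simp: unseen_def)
  hence un': "unseen u' v' w' [a', b']" "unseen v' w' u' [a', c']" "unseen w' u' v' [a', c']"
    "unseen v' w' u' [b', d']" "unseen w' u' v' [b', d']"
    using unseen_sub[OF t(1)] unseen_rotate by simp_all
  have rot: "arcs_eq v w u \<mu> x y z \<mu>' = arcs_eq u v w \<mu> z x y \<mu>'" "arcs_eq w u v \<mu> x y z \<mu>' = arcs_eq u v w \<mu> y z x \<mu>'"
    for x y z using arcs_eq_rotate by metis+
  show ?thesis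
    using s(2) t(2,3)
    by (cases cyc; cases cyc')
      (auto simp: corner_sum_def source_relation_def source_corner_def lookup_minus lookup_add lookup_gen
        degenerate_eq_iff un un' rot)
qed

lemma corner_sum_sink_relation:
  assumes s: "unseen u v w [a, b, c]" "triangle K cyc (\<mu> a) (\<mu> b) (\<mu> c)"
    and t: "unseen u' v' w' [a', b', c', d']" "\<mu>' a' + \<mu>' d' = K" "triangle K cyc' (\<mu>' a') (\<mu>' b') (\<mu>' c')"
  shows "corner_sum (sink_relation cyc' u' v' w' a' b' c' d' \<mu>') cyc u v w a b c \<mu> = 0"
proof -
  have "a \<noteq> b" "a \<noteq> c" "b \<noteq> c" using s(1) by (auto simp: unseen_def)
  hence un: "unseen u v w [a, b]" "unseen v w u [a, c]" "unseen w u v [a, c]" "unseen v w u [b, c]" "unseen w u v [b, c]"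
    using unseen_sub[OF s(1)] unseen_rotate by simp_all
  have "b' \<noteq> c'" "a' \<noteq> c'" "d' \<noteq> b'" using t(1) by (auto simp: unseen_def)
  hence un': "unseen v' w' u' [b', c']" "unseen w' u' v' [b', c']" "unseen v' w' u' [a', c']" "unseen w' u' v' [a', c']"
    "unseen u' v' w' [d', b']"
    using unseen_sub[OF t(1)] unseen_rotate by simp_all
  have rot: "arcs_eq v w u \<mu> x y z \<mu>' = arcs_eq u v w \<mu> z x y \<mu>'" "arcs_eq w u v \<mu> x y z \<mu>' = arcs_eq u v w \<mu> y z x \<mu>'"
    for x y z using arcs_eq_rotate by metis+
  show ?thesis
    using s(2) t(2,3)
    by (cases cyc; cases cyc')
      (auto simp: corner_sum_def source_corner_def lookup_minus lookup_add lookup_gen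
        degenerate_eq_iff un un' rot)
qed

section \<open>Classes modulo the triangle relations\<close>

lemma corner_sum_diff: "corner_sum (y - z) cyc u v w a b c \<mu> =
    corner_sum y cyc u v w a b c \<mu> - corner_sum z cyc u v w a b c \<mu>"
  by (simp add: corner_sum_def lookup_minus algebra_simps)

lemma corner_sum_add: "corner_sum (y + z) cyc u v w a b c \<mu> =
    corner_sum y cyc u v w a b c \<mu> + corner_sum z cyc u v w a b c \<mu>"
  by (simp add: corner_sum_def lookup_add algebra_simps)

lemma corner_sum_scl: "corner_sum (scl k y) cyc u v w a b c \<mu> = k * corner_sum y cyc u v w a b c \<mu>"
  by (simp add: corner_sum_def distrib_left)

lemma corner_sum_triangle_relation:
  assumes "unseen u v w [a, b, c]" "triangle K cyc (\<mu> a) (\<mu> b) (\<mu> c)" "\<rho> \<in> triangle_relations K"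
  shows "corner_sum \<rho> cyc u v w a b c \<mu> = 0"
  using assms(3)
proof (cases rule: triangle_relation_cases)
  case 1
  thus ?thesis using corner_sum_source_relation[OF assms(1,2)] by simp
next
  case 2
  thus ?thesis using corner_sum_sink_relation[OF assms(1,2)] by simp
qed

lemma corner_sum_span:
  assumes "unseen u v w [a, b, c]" "triangle K cyc (\<mu> a) (\<mu> b) (\<mu> c)" "y \<in> free_vs.span (triangle_relations K)"
  shows "corner_sum y cyc u v w a b c \<mu> = 0"
proof (rule free_vs.span_induct[OF assms(3)])
  show "free_vs.subspace {y. corner_sum y cyc u v w a b c \<mu> = 0}"
    by (rule free_vs.subspaceI) (simp_all add: corner_sum_scl corner_sum_add, simp add: corner_sum_def)
qed (rule corner_sum_triangle_relation[OF assms(1,2)])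

text \<open>
  The degenerate diagrams with a head and a tail at the degenerate point, that is, the middle corners.
\<close>

definition mixed :: "degenerate_diagram \<Rightarrow> bool" where
  "mixed E \<longleftrightarrow> (\<exists>cyc p q r a c \<mu>. unseen p q r [a, c] \<and> E = degenerate cyc p q r (Head a) (Tail c) \<mu>)"

lemma mixed_degenerate_iff:
  assumes "unseen p q r [arrow x, arrow y]"
  shows "mixed (degenerate cyc p q r x y \<mu>) \<longleftrightarrow> is_tail x \<noteq> is_tail y"
proof
  assume "mixed (degenerate cyc p q r x y \<mu>)"
  thus "is_tail x \<noteq> is_tail y" unfolding mixed_def using degenerate_eq_iff[OF assms] by fastforce
next
  assume "is_tail x \<noteq> is_tail y"
  have u': "unseen p q r [arrow y, arrow x]" using assms by (auto simp: unseen_def)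
  have swap: "degenerate cyc p q r x y \<mu> = degenerate (toggle cyc) p q r y x \<mu>"
    using degenerate_eq_iff[OF assms u'] unfolding arcs_eq_def
    by (auto simp: endpoint.map_id0 intro!: exI[of _ id])
  show "mixed (degenerate cyc p q r x y \<mu>)"
  proof (cases x)
    case (Head a)
    then obtain c where "y = Tail c" using \<open>is_tail x \<noteq> is_tail y\<close> by (cases y) auto
    thus ?thesis
      using Head assms unfolding mixed_def
      by (intro exI[of _ cyc] exI[of _ p] exI[of _ q] exI[of _ r] exI[of _ a] exI[of _ c] exI[of _ \<mu>]) simp
  next
    case (Tail c)
    then obtain a where "y = Head a" using \<open>is_tail x \<noteq> is_tail y\<close> by (cases y) auto
    thus ?thesis
      using Tail u' unfolding swap mixed_def
      by (intro exI[of _ "toggle cyc"] exI[of _ p] exI[of _ q] exI[of _ r] exI[of _ a] exI[of _ c] exI[of _ \<mu>]) simp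
  qed
qed

lemma degenerate_cases:
  obtains B where "E = shrink B" "\<not> nice B"
  | cyc p q r x y \<mu> where "E = degenerate cyc p q r x y \<mu>" "unseen p q r [arrow x, arrow y]"
proof -
  have "\<exists>B. E = shrink B"
    by (induct E rule: degenerate_diagram.abs_induct) (auto simp: shrink_def)
  then obtain B where B: "E = shrink B" ..
  show thesis
  proof (cases "nice B")
    case True
    obtain w \<mu> where w: "B = based w \<mu>" "gauss_word w" by (rule based_cases)
    with True have "nice_word w" by (simp add: nice_based)
    with w(2) obtain cyc p q r x y where "w = corner cyc p q r x y" "unseen p q r [arrow x, arrow y]"
      by (rule nice_word_is_corner)
    thus thesis using that(2) B w(1) by (simp add: degenerate_def)
  qed (use that B in blast)
qed

lemma degenerate_cong:
  assumes "unseen p q r [arrow x, arrow y]" "\<And>a. a \<in> {arrow x, arrow y} \<union> arrows (p @ q @ r) \<Longrightarrow> \<mu> a = \<mu>' a"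
  shows "degenerate cyc p q r x y \<mu> = degenerate cyc p q r x y \<mu>'"
proof -
  have "arcs_eq p q r \<mu> p q r \<mu>'"
    unfolding arcs_eq_def using assms(2) by (intro exI[of _ id]) (auto simp: endpoint.map_id0)
  thus ?thesis using degenerate_eq_iff[OF assms(1,1)] assms(2) by simp
qed

text \<open>
  Two tails at the degenerate point make it a source corner, two heads a sink corner. In either case
  the arrow that completes the triangle, and its reverse, receive fresh labels and the markings forced
  by the triangle condition.
\<close>

lemma triangle_relation_with_leading_term:
  assumes E: "E = degenerate cyc p q r x y \<mu>" and u: "unseen p q r [arrow x, arrow y]"
    and same: "is_tail x = is_tail y"
  obtains \<rho> where "\<rho> \<in> triangle_relations K"
    "\<And>E'. \<not> mixed E' \<Longrightarrow> Poly_Mapping.lookup \<rho> E' = (if E' = E then 1 else 0)"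
    "\<And>B. \<not> nice B \<Longrightarrow> Poly_Mapping.lookup \<rho> (shrink B) = 0"
proof -
  have nice: "nice (based (corner cyc' p' q' r' x' y') \<mu>')" if "unseen p' q' r' [arrow x', arrow y']"
    for cyc' p' q' r' x' y' and \<mu>' :: "nat \<Rightarrow> int"
    using that nice_word_corner by (simp add: nice_based gauss_word_corner unseen_def)
  have not_nice: "shrink B \<noteq> degenerate cyc' p' q' r' x' y' \<mu>'"
    if "\<not> nice B" "unseen p' q' r' [arrow x', arrow y']" for B cyc' p' q' r' x' y' \<mu>'
    using that nice[OF that(2)] by (auto simp: degenerate_def shrink_eq_iff)
  define S where "S = set [arrow x, arrow y] \<union> arrows (p @ q @ r)"
  have "finite S" by (simp add: S_def)
  then obtain c where c: "c \<notin> S" using ex_new_if_finite[OF infinite_UNIV_nat] by blast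
  from \<open>finite S\<close> obtain d where d: "d \<notin> insert c S"
    using ex_new_if_finite[OF infinite_UNIV_nat, of "insert c S"] by auto
  have cd: "c \<noteq> d" "c \<notin> arrows (p @ q @ r)" "d \<notin> arrows (p @ q @ r)" "c \<noteq> arrow x" "c \<noteq> arrow y" "d \<noteq> arrow x" "d \<noteq> arrow y"
    using c d by (auto simp: S_def)
  define k where "k = (if cyc = Order123 then K else 0)"
  have base: "unseen p q r [arrow x, arrow y, c, d]"
    using u cd by (auto simp: unseen_def)
  have perm: "unseen p' q' r' ls" if "(p', q', r') \<in> {(p, q, r), (q, r, p), (r, p, q)}" "distinct ls"
    "set ls \<subseteq> {arrow x, arrow y, c, d}" for p' q' r' ls
    using that base unseen_rotate unseen_sub[of p' q' r' "[arrow x, arrow y, c, d]" ls] by auto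
  have ne: "arrow x \<noteq> arrow y" using u by (auto simp: unseen_def)
  show thesis
  proof (cases x)
    case (Tail a)
    then obtain b where b: "y = Tail b" using same by (cases y) auto
    \<comment> \<open>The marking that the triangle condition imposes on \<open>2 \<rightarrow> 3\<close>.\<close>
    define m where "m = \<mu> b - \<mu> a + k"
    define \<mu>' where "\<mu>' = \<mu>(c := m, d := K - m)"
    have \<mu>': "\<mu>' a = \<mu> a" "\<mu>' b = \<mu> b" "\<mu>' c = m" "\<mu>' d = K - m" using cd Tail b by (auto simp: \<mu>'_def)
    have E': "E = source_corner cyc p q r a b \<mu>'"
      unfolding E source_corner_def Tail b using cd u Tail b
      by (intro degenerate_cong) (auto simp: \<mu>'_def)
    have mid: "mixed (middle_corner cyc p q r a c \<mu>')" "mixed (middle_corner (toggle cyc) p q r b d \<mu>')"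
      using perm cd Tail b ne by (cases cyc; simp add: mixed_degenerate_iff)+
    have "source_relation cyc p q r a b c d \<mu>' \<in> triangle_relations K"
      by (rule source_relation_in)
        (use base Tail b in \<open>simp_all add: \<mu>'\<close>, cases cyc, simp_all add: m_def k_def)
    moreover have "Poly_Mapping.lookup (source_relation cyc p q r a b c d \<mu>') E' = (if E' = E then 1 else 0)"
      if "\<not> mixed E'" for E'
      using that mid E' by (auto simp: source_relation_def lookup_minus lookup_add lookup_gen)
    moreover have "Poly_Mapping.lookup (source_relation cyc p q r a b c d \<mu>') (shrink B) = 0" if "\<not> nice B" for B
      using not_nice[OF that] perm cd Tail b ne
      by (cases cyc) (simp_all add: source_relation_def source_corner_def lookup_minus lookup_add lookup_gen)
    ultimately show thesis by (rule that)
  next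
    case (Head b)
    then obtain c' where c': "y = Head c'" using same by (cases y) auto
    \<comment> \<open>The marking that the triangle condition imposes on \<open>1 \<rightarrow> 2\<close>.\<close>
    define m where "m = \<mu> b - \<mu> c' + k"
    define \<mu>' where "\<mu>' = \<mu>(c := m, d := K - m)"
    have \<mu>': "\<mu>' b = \<mu> b" "\<mu>' c' = \<mu> c'" "\<mu>' c = m" "\<mu>' d = K - m" using cd Head c' by (auto simp: \<mu>'_def)
    \<comment> \<open>Lists the arcs starting at the source instead of the degenerate point.\<close>
    define u' v' w' where "u' = (if cyc = Order123 then q else r)" and "v' = (if cyc = Order123 then r else p)"
      and "w' = (if cyc = Order123 then p else q)"
    have "E = degenerate cyc p q r x y \<mu>'"
      unfolding E using cd u by (intro degenerate_cong) (auto simp: \<mu>'_def)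
    hence E': "E = sink_corner cyc u' v' w' b c' \<mu>'"
      by (cases cyc) (simp_all add: Head c' u'_def v'_def w'_def)
    have un: "unseen u' v' w' [c, b, c', d]"
      using perm[of u' v' w'] cd Head c' ne by (auto simp: u'_def v'_def w'_def)
    have "sink_relation cyc u' v' w' c b c' d \<mu>' \<in> triangle_relations K"
      by (rule sink_relation_in[OF un]) (simp add: \<mu>', cases cyc, simp_all add: m_def k_def \<mu>')
    moreover have "Poly_Mapping.lookup (sink_relation cyc u' v' w' c b c' d \<mu>') E' = (if E' = E then 1 else 0)"
      if "\<not> mixed E'" for E'
    proof -
      have "mixed (middle_corner cyc u' v' w' c c' \<mu>')" "mixed (middle_corner Order132 v' w' u' d b \<mu>')"
        "mixed (middle_corner Order123 w' u' v' d b \<mu>')"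
        using perm cd Head c' ne by (cases cyc; simp add: mixed_degenerate_iff u'_def v'_def w'_def)+
      thus ?thesis using that E' by (cases cyc) (auto simp: lookup_minus lookup_add lookup_gen)
    qed
    moreover have "Poly_Mapping.lookup (sink_relation cyc u' v' w' c b c' d \<mu>') (shrink B) = 0" if "\<not> nice B" for B
      using not_nice[OF that] perm cd Head c' ne
      by (cases cyc) (simp_all add: u'_def v'_def w'_def lookup_minus lookup_add lookup_gen)
    ultimately show thesis by (rule that)
  qed
qed

text \<open>
  Subtracting a multiple of a triangle relation removes a source or sink corner \<open>E\<close> and creates no
  other, so their number decreases. When there are none, the coefficient of a middle corner is the
  corner sum of the triangle that it determines.
\<close>

lemma in_span_triangle_relations:
  assumes "\<And>B. \<not> nice B \<Longrightarrow> Poly_Mapping.lookup y (shrink B) = 0"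
    and "\<And>cyc u v w a b c \<mu>. unseen u v w [a, b, c] \<Longrightarrow> triangle K cyc (\<mu> a) (\<mu> b) (\<mu> c) \<Longrightarrow>
      corner_sum y cyc u v w a b c \<mu> = 0"
  shows "y \<in> free_vs.span (triangle_relations K)"
  using assms
proof (induction "card {E \<in> Poly_Mapping.keys y. \<not> mixed E}" arbitrary: y rule: less_induct)
  case less
  show ?case
  proof (cases "\<exists>E \<in> Poly_Mapping.keys y. \<not> mixed E")
    case True
    then obtain E where E: "E \<in> Poly_Mapping.keys y" "\<not> mixed E" by blast
    obtain cyc p q r x z \<mu> where x: "E = degenerate cyc p q r x z \<mu>" "unseen p q r [arrow x, arrow z]"
    proof (cases E rule: degenerate_cases)
      case (1 B)
      thus ?thesis using E(1) less.prems(1) by (simp add: in_keys_iff)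
    qed (rule that)
    have "is_tail x = is_tail z" using E(2) mixed_degenerate_iff[OF x(2)] x(1) by blast
    with x obtain \<rho> where \<rho>: "\<rho> \<in> triangle_relations K"
      "\<And>E'. \<not> mixed E' \<Longrightarrow> Poly_Mapping.lookup \<rho> E' = (if E' = E then 1 else 0)"
      "\<And>B. \<not> nice B \<Longrightarrow> Poly_Mapping.lookup \<rho> (shrink B) = 0"
      by (rule triangle_relation_with_leading_term[where K = K]) (rule that)
    define t where "t = scl (Poly_Mapping.lookup y E) \<rho>"
    have t: "t \<in> free_vs.span (triangle_relations K)"
      unfolding t_def by (intro free_vs.span_scale free_vs.span_base \<rho>(1))
    have "y - t \<in> free_vs.span (triangle_relations K)"
    proof (rule less.hyps)
      have "{E' \<in> Poly_Mapping.keys (y - t). \<not> mixed E'} \<subseteq> {E' \<in> Poly_Mapping.keys y. \<not> mixed E'} - {E}"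
        using \<rho>(2) by (auto simp: t_def in_keys_iff lookup_minus split: if_splits)
      hence "{E' \<in> Poly_Mapping.keys (y - t). \<not> mixed E'} \<subset> {E' \<in> Poly_Mapping.keys y. \<not> mixed E'}"
        using E by blast
      thus "card {E' \<in> Poly_Mapping.keys (y - t). \<not> mixed E'} < card {E' \<in> Poly_Mapping.keys y. \<not> mixed E'}"
        by (rule psubset_card_mono[rotated]) simp
      show "Poly_Mapping.lookup (y - t) (shrink B) = 0" if "\<not> nice B" for B
        using that less.prems(1) \<rho>(3) by (simp add: t_def lookup_minus)
      show "corner_sum (y - t) cyc u v w a b c \<mu> = 0"
        if "unseen u v w [a, b, c]" "triangle K cyc (\<mu> a) (\<mu> b) (\<mu> c)" for cyc u v w a b c \<mu>
        using less.prems(2)[where \<mu> = \<mu>, OF that] corner_sum_span[where \<mu> = \<mu>, OF that t] by (simp add: corner_sum_diff)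
    qed
    from free_vs.span_add[OF this t] show ?thesis by simp
  next
    case False
    have "Poly_Mapping.lookup y E = 0" for E
    proof (rule ccontr)
      assume "Poly_Mapping.lookup y E \<noteq> 0"
      hence "mixed E" using False by (auto simp: in_keys_iff)
      then obtain cyc' p q r a c \<mu> where u: "unseen p q r [a, c]" and E: "E = degenerate cyc' p q r (Head a) (Tail c) \<mu>"
        unfolding mixed_def by blast
      obtain b where b: "b \<notin> set [a, c] \<union> arrows (p @ q @ r)"
        using ex_new_if_finite[OF infinite_UNIV_nat, of "set [a, c] \<union> arrows (p @ q @ r)"] by auto
      define cyc where "cyc = toggle cyc'"
      define u' v' w' where "u' = (if cyc = Order123 then r else q)" and "v' = (if cyc = Order123 then p else r)"
        and "w' = (if cyc = Order123 then q else p)"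
      define \<mu>' where "\<mu>' = \<mu>(b := \<mu> a + \<mu> c - (if cyc = Order123 then K else 0))"
      have "unseen p q r [a, b, c]" using u b by (auto simp: unseen_def)
      hence un: "unseen u' v' w' [a, b, c]" using unseen_rotate by (auto simp: u'_def v'_def w'_def)
      have tri: "triangle K cyc (\<mu>' a) (\<mu>' b) (\<mu>' c)" using b by (cases cyc) (auto simp: \<mu>'_def)
      have ne: "a \<noteq> b" "a \<noteq> c" "b \<noteq> c" using un by (auto simp: unseen_def)
      have "E = degenerate cyc' p q r (Head a) (Tail c) \<mu>'"
        unfolding E using u b by (intro degenerate_cong) (auto simp: \<mu>'_def)
      hence E': "E = middle_corner cyc u' v' w' a c \<mu>'"
        by (cases cyc') (simp_all add: cyc_def u'_def v'_def w'_def)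
      have zero: "Poly_Mapping.lookup y E'' = 0" if "\<not> mixed E''" for E''
        using that False by (auto simp: in_keys_iff)
      have rots: "unseen u' v' w' [a, b]" "unseen v' w' u' [b, c]" "unseen w' u' v' [b, c]"
        using ne unseen_sub[OF un] unseen_rotate by simp_all
      have "\<not> mixed (source_corner cyc u' v' w' a b \<mu>')" "\<not> mixed (sink_corner cyc u' v' w' b c \<mu>')"
        using rots by (cases cyc; simp add: source_corner_def mixed_degenerate_iff)+
      hence "Poly_Mapping.lookup y E = 0"
        using less.prems(2)[where \<mu> = \<mu>', OF un tri] zero E' by (simp add: corner_sum_def)
      thus False using \<open>Poly_Mapping.lookup y E \<noteq> 0\<close> by simp
    qed
    hence "y = 0" by (intro poly_mapping_eqI) simp
    thus ?thesis by (simp add: free_vs.span_zero)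
  qed
qed

lemma d_map_vanishes_iff:
  "eq_mod_triangle K (d_map A) 0 \<longleftrightarrow> vanishes_on_6T K (\<lambda>D. pairing A (gen D))"
proof
  assume "eq_mod_triangle K (d_map A) 0"
  hence "d_map A \<in> free_vs.span (triangle_relations K)" by (simp add: eq_mod_triangle_def)
  note sums = corner_sum_span[OF _ _ this]
  show "vanishes_on_6T K (\<lambda>D. pairing A (gen D))"
    unfolding vanishes_on_6T_def
  proof (intro allI impI)
    fix cyc u v w a b c and \<mu> :: "nat \<Rightarrow> int"
    assume *: "unseen u v w [a, b, c]" "triangle K cyc (\<mu> a) (\<mu> b) (\<mu> c)"
    show "six_term (\<lambda>D. pairing A (gen D)) cyc u v w a b c \<mu> = 0"
      using sums[where \<mu> = \<mu>, OF *] corner_sum_d_map[where \<mu> = \<mu>, OF *(1)]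
      by (simp add: corner_sign_def split: if_splits)
  qed
next
  assume "vanishes_on_6T K (\<lambda>D. pairing A (gen D))"
  hence "d_map A \<in> free_vs.span (triangle_relations K)"
    by (intro in_span_triangle_relations lookup_d_map_not_nice) (auto simp: corner_sum_d_map vanishes_on_6T_def)
  thus "eq_mod_triangle K (d_map A) 0" by (simp add: eq_mod_triangle_def)
qed

theorem theorem3p6:
  fixes K :: int and A :: "arrow_diagram \<Rightarrow>\<^sub>0 rat"
  assumes "\<forall>r\<in>AP1 K. pairing A r = 0"
    and "\<forall>r\<in>AP2. pairing A r = 0"
  shows "(arrow_diagram_formula K A \<longleftrightarrow> eq_mod_triangle K (d_map A) 0) \<and>
         (eq_mod_triangle K (d_map A) 0 \<longleftrightarrow> (\<forall>r\<in>A6T K. pairing A r = 0))"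
  unfolding d_map_vanishes_iff vanishes_on_6T_iff
  using formula_imp_6T formula_if_6T[OF assms] by blast

end
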